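(* Let $H$ be a regular Fourier hypergroup with left Haar measure $m_H$. Let $\mathcal{L}A(H)=L^1(H)\cap A(H)$ with norm $|||f|||=\|f\|_1+\|f\|_{A(H)}$, and suppose that $\mathcal{L}A(H)$ with the pointwise product is an amenable Banach algebra. Then $H$ is compact, and the Fourier algebra $A(H)$ (with pointwise product) is amenable.
   Context: A hypergroup (in the sense of Jewett) is a nonempty locally compact Hausdorff space $H$ together with a bilinear associative product (convolution) $*$ on the space $M(H)$ of bounded complex Radon measures such that: $\delta_x*\delta_y$ is a compactly supported probability measure for all $x,y\in H$; the convolution is continuous on nonnegative measures in the weak topology given by the test functions $C_c(H)\cup\{1\}$; $(x,y)\mapsto \mathrm{supp}(\delta_x*\delta_y)$ is continuous into the compact subsets of $H$ with the Michael topology; there is an identity $e\in H$ with $\delta_e*\delta_x=\delta_x*\delta_e=\delta_x$; there is a homeomorphic involution $x\mapsto\check{x}$ with $(\delta_x*\delta_y)\check{\ }=\delta_{\check y}*\delta_{\check x}$, and $e\in\mathrm{supp}(\delta_x*\delta_y)$ if and only if $x=\check y$. All hypergroups are assumed to admit a left Haar measure $m_H$ (a nonzero positive Radon measure with $\int f(xy)\,dm_H(y)=\int f\,dm_H$ for $f\in C_c(H)$, $x\in H$), and $dt$ means $dm_H(t)$. Here $f(xy):=\int_H f\,d(\delta_x*\delta_y)$. $L^p(H)=L^p(H,m_H)$. For $f\in L^1(H)$, $g\in L^p(H)$, $(f*g)(x)=\int_H f(y)\,g(\check y x)\,dy$. Put $\tilde f(x)=\overline{f(\check x)}$. The left regular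 representation $\lambda$ on $L^2(H)$ is $\lambda(x)f(y)=f(\check x y)$, extended to $L^1(H)$ by integration. $C_\lambda^*(H)$ is the completion of $L^1(H)$ in the norm $\|f\|_{C^*_\lambda(H)}=\|\lambda(f)\|_{\mathcal{B}(L^2(H))}$, and $B_\lambda(H)=C_\lambda^*(H)^*$, whose elements are realized as functions $u$ on $H$ via $\langle u,f\rangle=\int_H u f\,dm_H$, $f\in L^1(H)$. The Fourier space $A(H)$ is the norm-closed subspace of $B_\lambda(H)$ spanned by $\{f*\tilde f: f\in C_c(H)\}$, with the norm $\|\cdot\|_{A(H)}$ of $B_\lambda(H)$; its elements are continuous functions vanishing at infinity. $H$ is a regular Fourier hypergroup if $A(H)$ is a Banach algebra with its original norm $\|\cdot\|_{A(H)}$ and pointwise product; in that case $(\mathcal{L}A(H),|||\cdot|||)$ with pointwise product is a Banach algebra. A Banach algebra $\mathcal{A}$ is amenable if every bounded derivation from $\mathcal{A}$ into a dual Banach $\mathcal{A}$-bimodule is inner. *)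

theory Defs
  imports "HOL-Analysis.Analysis" "HOL-Algebra.Module"
begin

section \<open>Banach spaces, Banach algebras, amenability\<close>

text \<open>
  Complex vector spaces are modules over the following ring. The multiplicative fields of the
  record are used only for algebras; its field \<open>one\<close> is never referred to, so that
  algebras need not be unital.
\<close>

definition complex_ring :: "complex ring" where
  "complex_ring = \<lparr>carrier = UNIV, monoid.mult = (*), one = 1, ring.zero = 0, add = (+)\<rparr>"

record 'a cnspace = "(complex, 'a) module" +
  nrm :: "'a \<Rightarrow> real"

definition cnormed_space :: "'a cnspace \<Rightarrow> bool" where
  "cnormed_space V \<longleftrightarrow> Module.module complex_ring V \<and>
     (\<forall>x\<in>carrier V. nrm V x \<ge> 0 \<and> (nrm V x = 0 \<longleftrightarrow> x = \<zero>\<^bsub>V\<^esub>)) \<and>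
     (\<forall>x\<in>carrier V. \<forall>y\<in>carrier V. nrm V (x \<oplus>\<^bsub>V\<^esub> y) \<le> nrm V x + nrm V y) \<and>
     (\<forall>c. \<forall>x\<in>carrier V. nrm V (c \<odot>\<^bsub>V\<^esub> x) = norm c * nrm V x)"

definition banach_space :: "'a cnspace \<Rightarrow> bool" where
  "banach_space V \<longleftrightarrow> cnormed_space V \<and>
     (\<forall>s::nat \<Rightarrow> 'a. range s \<subseteq> carrier V \<longrightarrow>
        (\<forall>\<epsilon>>0. \<exists>N. \<forall>i\<ge>N. \<forall>j\<ge>N. nrm V (s i \<ominus>\<^bsub>V\<^esub> s j) < \<epsilon>) \<longrightarrow>
        (\<exists>l\<in>carrier V. (\<lambda>i. nrm V (s i \<ominus>\<^bsub>V\<^esub> l)) \<longlonglongrightarrow> 0))"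

definition clinear_on :: "'a cnspace \<Rightarrow> 'b cnspace \<Rightarrow> ('a \<Rightarrow> 'b) \<Rightarrow> bool" where
  "clinear_on V W T \<longleftrightarrow> T \<in> carrier V \<rightarrow> carrier W \<and>
     (\<forall>x\<in>carrier V. \<forall>y\<in>carrier V. T (x \<oplus>\<^bsub>V\<^esub> y) = T x \<oplus>\<^bsub>W\<^esub> T y) \<and>
     (\<forall>c. \<forall>x\<in>carrier V. T (c \<odot>\<^bsub>V\<^esub> x) = c \<odot>\<^bsub>W\<^esub> T x)"

definition banach_algebra :: "'a cnspace \<Rightarrow> bool" where
  "banach_algebra A \<longleftrightarrow> banach_space A \<and>
     (\<forall>a\<in>carrier A. clinear_on A A (\<lambda>b. a \<otimes>\<^bsub>A\<^esub> b) \<and> clinear_on A A (\<lambda>b. b \<otimes>\<^bsub>A\<^esub> a)) \<and>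
     (\<forall>a\<in>carrier A. \<forall>b\<in>carrier A. \<forall>c\<in>carrier A.
        (a \<otimes>\<^bsub>A\<^esub> b) \<otimes>\<^bsub>A\<^esub> c = a \<otimes>\<^bsub>A\<^esub> (b \<otimes>\<^bsub>A\<^esub> c)) \<and>
     (\<forall>a\<in>carrier A. \<forall>b\<in>carrier A. nrm A (a \<otimes>\<^bsub>A\<^esub> b) \<le> nrm A a * nrm A b)"

text \<open>Functionals are made extensional, so that they are determined by their values on the
  carrier.\<close>

definition dual_space :: "'a cnspace \<Rightarrow> ('a \<Rightarrow> complex) cnspace" where
  "dual_space V =
    \<lparr>carrier = {\<phi> \<in> extensional (carrier V).
        (\<forall>x\<in>carrier V. \<forall>y\<in>carrier V. \<phi> (x \<oplus>\<^bsub>V\<^esub> y) = \<phi> x + \<phi> y) \<and>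
        (\<forall>c. \<forall>x\<in>carrier V. \<phi> (c \<odot>\<^bsub>V\<^esub> x) = c * \<phi> x) \<and>
        (\<exists>K. \<forall>x\<in>carrier V. norm (\<phi> x) \<le> K * nrm V x)},
     monoid.mult = undefined, one = undefined,
     ring.zero = (\<lambda>x\<in>carrier V. 0),
     add = (\<lambda>\<phi> \<psi>. \<lambda>x\<in>carrier V. \<phi> x + \<psi> x),
     smult = (\<lambda>c \<phi>. \<lambda>x\<in>carrier V. c * \<phi> x),
     nrm = (\<lambda>\<phi>. Sup {norm (\<phi> x) | x. x \<in> carrier V \<and> nrm V x \<le> 1})\<rparr>"

definition banach_bimodule ::
    "'a cnspace \<Rightarrow> 'x cnspace \<Rightarrow> ('a \<Rightarrow> 'x \<Rightarrow> 'x) \<Rightarrow> ('x \<Rightarrow> 'a \<Rightarrow> 'x) \<Rightarrow> bool" where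
  "banach_bimodule A X L R \<longleftrightarrow> banach_space X \<and>
     (\<forall>a\<in>carrier A. clinear_on X X (\<lambda>x. L a x) \<and> clinear_on X X (\<lambda>x. R x a)) \<and>
     (\<forall>x\<in>carrier X. clinear_on A X (\<lambda>a. L a x) \<and> clinear_on A X (\<lambda>a. R x a)) \<and>
     (\<forall>a\<in>carrier A. \<forall>b\<in>carrier A. \<forall>x\<in>carrier X.
        L (a \<otimes>\<^bsub>A\<^esub> b) x = L a (L b x) \<and> R x (a \<otimes>\<^bsub>A\<^esub> b) = R (R x a) b \<and>
        R (L a x) b = L a (R x b)) \<and>
     (\<exists>K. \<forall>a\<in>carrier A. \<forall>x\<in>carrier X.
        nrm X (L a x) \<le> K * nrm A a * nrm X x \<and> nrm X (R x a) \<le> K * nrm A a * nrm X x)"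

text \<open>The actions on the dual: \<open>(a \<cdot> \<phi>)(x) = \<phi>(x \<cdot> a)\<close> and \<open>(\<phi> \<cdot> a)(x) = \<phi>(a \<cdot> x)\<close>.\<close>

definition dual_lact ::
    "'x cnspace \<Rightarrow> ('x \<Rightarrow> 'a \<Rightarrow> 'x) \<Rightarrow> 'a \<Rightarrow> ('x \<Rightarrow> complex) \<Rightarrow> ('x \<Rightarrow> complex)" where
  "dual_lact X R a \<phi> = (\<lambda>x\<in>carrier X. \<phi> (R x a))"

definition dual_ract ::
    "'x cnspace \<Rightarrow> ('a \<Rightarrow> 'x \<Rightarrow> 'x) \<Rightarrow> ('x \<Rightarrow> complex) \<Rightarrow> 'a \<Rightarrow> ('x \<Rightarrow> complex)" where
  "dual_ract X L \<phi> a = (\<lambda>x\<in>carrier X. \<phi> (L a x))"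

definition bounded_derivation ::
    "'a cnspace \<Rightarrow> 'x cnspace \<Rightarrow> ('a \<Rightarrow> 'x \<Rightarrow> 'x) \<Rightarrow> ('x \<Rightarrow> 'a \<Rightarrow> 'x) \<Rightarrow> ('a \<Rightarrow> 'x) \<Rightarrow> bool" where
  "bounded_derivation A X L R D \<longleftrightarrow> clinear_on A X D \<and>
     (\<exists>K. \<forall>a\<in>carrier A. nrm X (D a) \<le> K * nrm A a) \<and>
     (\<forall>a\<in>carrier A. \<forall>b\<in>carrier A. D (a \<otimes>\<^bsub>A\<^esub> b) = L a (D b) \<oplus>\<^bsub>X\<^esub> R (D a) b)"

definition inner_derivation ::
    "'a cnspace \<Rightarrow> 'x cnspace \<Rightarrow> ('a \<Rightarrow> 'x \<Rightarrow> 'x) \<Rightarrow> ('x \<Rightarrow> 'a \<Rightarrow> 'x) \<Rightarrow> ('a \<Rightarrow> 'x) \<Rightarrow> bool" where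
  "inner_derivation A X L R D \<longleftrightarrow>
     (\<exists>x\<in>carrier X. \<forall>a\<in>carrier A. D a = L a x \<ominus>\<^bsub>X\<^esub> R x a)"

text \<open>
  A formula cannot quantify over types, so amenability is relative to a type \<open>'x\<close>: it is
  tested on all Banach \<open>A\<close>-bimodules \<open>X\<close> whose underlying set is a subset of \<open>'x\<close>.
  Amenability of \<open>A\<close> means \<open>amenable TYPE('x) A\<close> for all types \<open>'x\<close>. In a conclusion,
  a free type variable \<open>'x\<close> expresses this; assuming amenability amounts to assuming
  \<open>amenable TYPE('x) A\<close> for every type \<open>'x\<close> that is needed.
\<close>

definition amenable :: "'x itself \<Rightarrow> 'a cnspace \<Rightarrow> bool" where
  "amenable (_ :: 'x itself) A \<longleftrightarrow> banach_algebra A \<and>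
     (\<forall>(X :: 'x cnspace) L R D. banach_bimodule A X L R \<longrightarrow>
        bounded_derivation A (dual_space X) (dual_lact X R) (dual_ract X L) D \<longrightarrow>
        inner_derivation A (dual_space X) (dual_lact X R) (dual_ract X L) D)"

text \<open>A set of complex functions with the pointwise operations and a given norm.\<close>

definition fun_space ::
    "('h \<Rightarrow> complex) set \<Rightarrow> (('h \<Rightarrow> complex) \<Rightarrow> real) \<Rightarrow> ('h \<Rightarrow> complex) cnspace" where
  "fun_space S N =
    \<lparr>carrier = S, monoid.mult = (\<lambda>f g x. f x * g x), one = (\<lambda>_. 1), ring.zero = (\<lambda>_. 0),
     add = (\<lambda>f g x. f x + g x), smult = (\<lambda>c f x. c * f x), nrm = N\<rparr>"


section \<open>Bounded complex Radon measures\<close>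

text \<open>
  A complex measure is a countably additive set function on the Borel sets, extended by \<open>0\<close>
  to all sets. The last clause is inner regularity of its total variation.
\<close>

definition radon_measures :: "('h::t2_space set \<Rightarrow> complex) set" where
  "radon_measures = {\<mu>. (\<forall>A. A \<notin> sets borel \<longrightarrow> \<mu> A = 0) \<and>
     (\<forall>F::nat \<Rightarrow> 'h set. range F \<subseteq> sets borel \<longrightarrow> disjoint_family F \<longrightarrow>
        (\<lambda>n. \<mu> (F n)) sums \<mu> (\<Union>n. F n)) \<and>
     (\<forall>A\<in>sets borel. \<forall>\<epsilon>>0. \<exists>K. compact K \<and> K \<subseteq> A \<and>
        (\<forall>B\<in>sets borel. B \<subseteq> A - K \<longrightarrow> norm (\<mu> B) < \<epsilon>))}"

definition nonneg_radon_measures :: "('h::t2_space set \<Rightarrow> complex) set" where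
  "nonneg_radon_measures = {\<mu> \<in> radon_measures. \<forall>A. \<mu> A \<in> \<real>\<^sub>\<ge>\<^sub>0}"

definition to_measure :: "('h::t2_space set \<Rightarrow> complex) \<Rightarrow> 'h measure" where
  "to_measure \<mu> = measure_of UNIV (sets borel) (\<lambda>A. ennreal (Re (\<mu> A)))"

definition point_mass :: "'h::t2_space \<Rightarrow> 'h set \<Rightarrow> complex" where
  "point_mass x A = (if A \<in> sets borel \<and> x \<in> A then 1 else 0)"

definition msupp :: "('h::t2_space set \<Rightarrow> complex) \<Rightarrow> 'h set" where
  "msupp \<mu> = {x. \<forall>U. open U \<longrightarrow> x \<in> U \<longrightarrow> (\<exists>B\<in>sets borel. B \<subseteq> U \<and> \<mu> B \<noteq> 0)}"

definition Cc :: "('h::t2_space \<Rightarrow> complex) set" where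
  "Cc = {f. continuous_on UNIV f \<and> compact (closure {x. f x \<noteq> 0})}"

definition weak_topology :: "('h::t2_space set \<Rightarrow> complex) topology" where
  "weak_topology = pullback_topology nonneg_radon_measures
     (\<lambda>\<mu>. \<lambda>f\<in>Cc \<union> {\<lambda>_. 1}. \<integral>x. f x \<partial>to_measure \<mu>)
     (product_topology (\<lambda>_. euclidean) (Cc \<union> {\<lambda>_. 1}))"

definition michael_topology :: "('h::t2_space) set topology" where
  "michael_topology = topology_generated_by
     {{C. compact C \<and> C \<noteq> {} \<and> C \<inter> U \<noteq> {} \<and> C \<subseteq> V} | U V. open U \<and> open V}"


section \<open>Hypergroups\<close>

text \<open>
  The underlying space is the whole type \<open>'h\<close>. Of \<open>convol\<close>, only the restriction to
  \<open>radon_measures\<close> matters.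
\<close>

record 'h hypergroup_data =
  convol :: "('h set \<Rightarrow> complex) \<Rightarrow> ('h set \<Rightarrow> complex) \<Rightarrow> ('h set \<Rightarrow> complex)"
  ident :: 'h
  invol :: "'h \<Rightarrow> 'h"

abbreviation point_conv :: "'h::t2_space hypergroup_data \<Rightarrow> 'h \<Rightarrow> 'h \<Rightarrow> 'h set \<Rightarrow> complex" where
  "point_conv H x y \<equiv> convol H (point_mass x) (point_mass y)"

locale hypergroup =
  fixes H :: "'h::t2_space hypergroup_data"
  assumes locally_compact: "locally_compact_space (euclidean :: 'h topology)"
    and convol_closed:
      "\<lbrakk>\<mu> \<in> radon_measures; \<nu> \<in> radon_measures\<rbrakk> \<Longrightarrow> convol H \<mu> \<nu> \<in> radon_measures"
    and convol_add_left:
      "\<lbrakk>\<mu> \<in> radon_measures; \<mu>' \<in> radon_measures; \<nu> \<in> radon_measures\<rbrakk> \<Longrightarrow>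
        convol H (\<lambda>A. \<mu> A + \<mu>' A) \<nu> = (\<lambda>A. convol H \<mu> \<nu> A + convol H \<mu>' \<nu> A)"
    and convol_add_right:
      "\<lbrakk>\<mu> \<in> radon_measures; \<nu> \<in> radon_measures; \<nu>' \<in> radon_measures\<rbrakk> \<Longrightarrow>
        convol H \<mu> (\<lambda>A. \<nu> A + \<nu>' A) = (\<lambda>A. convol H \<mu> \<nu> A + convol H \<mu> \<nu>' A)"
    and convol_scale_left:
      "\<lbrakk>\<mu> \<in> radon_measures; \<nu> \<in> radon_measures\<rbrakk> \<Longrightarrow>
        convol H (\<lambda>A. c * \<mu> A) \<nu> = (\<lambda>A. c * convol H \<mu> \<nu> A)"
    and convol_scale_right:
      "\<lbrakk>\<mu> \<in> radon_measures; \<nu> \<in> radon_measures\<rbrakk> \<Longrightarrow>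
        convol H \<mu> (\<lambda>A. c * \<nu> A) = (\<lambda>A. c * convol H \<mu> \<nu> A)"
    and convol_assoc:
      "\<lbrakk>\<mu> \<in> radon_measures; \<nu> \<in> radon_measures; \<rho> \<in> radon_measures\<rbrakk> \<Longrightarrow>
        convol H (convol H \<mu> \<nu>) \<rho> = convol H \<mu> (convol H \<nu> \<rho>)"
    and point_conv_nonneg: "point_conv H x y \<in> nonneg_radon_measures"
    and point_conv_prob: "point_conv H x y UNIV = 1"
    and point_conv_compact_supp: "compact (msupp (point_conv H x y))"
    and convol_continuous:
      "continuous_map (prod_topology weak_topology weak_topology) weak_topology
        (\<lambda>(\<mu>, \<nu>). convol H \<mu> \<nu>)"
    and supp_continuous:
      "continuous_map (euclidean :: ('h \<times> 'h) topology) michael_topology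
        (\<lambda>(x, y). msupp (point_conv H x y))"
    and ident_left: "point_conv H (ident H) x = point_mass x"
    and ident_right: "point_conv H x (ident H) = point_mass x"
    and invol_invol: "invol H (invol H x) = x"
    and invol_continuous: "continuous_on UNIV (invol H)"
    and invol_point_conv:
      "(\<lambda>A. point_conv H x y (invol H ` A)) = point_conv H (invol H y) (invol H x)"
    and ident_in_supp: "ident H \<in> msupp (point_conv H x y) \<longleftrightarrow> x = invol H y"

text \<open>\<open>hval H f x y\<close> is \<open>f(xy)\<close>.\<close>

definition hval :: "'h::t2_space hypergroup_data \<Rightarrow> ('h \<Rightarrow> complex) \<Rightarrow> 'h \<Rightarrow> 'h \<Rightarrow> complex" where
  "hval H f x y = (\<integral>t. f t \<partial>to_measure (point_conv H x y))"

text \<open>Radon measures are locally finite, outer regular on Borel sets and inner regular on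
  open sets.\<close>

definition left_haar_measure :: "'h::t2_space hypergroup_data \<Rightarrow> 'h measure \<Rightarrow> bool" where
  "left_haar_measure H m \<longleftrightarrow> sets m = sets borel \<and>
     (\<forall>K. compact K \<longrightarrow> emeasure m K < \<infinity>) \<and>
     (\<forall>A\<in>sets borel. emeasure m A = (INF U\<in>{U. open U \<and> A \<subseteq> U}. emeasure m U)) \<and>
     (\<forall>U. open U \<longrightarrow> emeasure m U = (SUP K\<in>{K. compact K \<and> K \<subseteq> U}. emeasure m K)) \<and>
     emeasure m UNIV \<noteq> 0 \<and>
     (\<forall>f\<in>Cc. \<forall>x. (\<integral>y. hval H f x y \<partial>m) = (\<integral>y. f y \<partial>m))"


section \<open>The Fourier space\<close>

text \<open>
  Elements of \<open>L\<^sup>1\<close> and \<open>L\<^sup>2\<close> are represented by functions, not by their classes modulo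
  equality almost everywhere.
\<close>

definition L1_norm :: "'h measure \<Rightarrow> ('h \<Rightarrow> complex) \<Rightarrow> real" where
  "L1_norm m f = (\<integral>x. norm (f x) \<partial>m)"

definition L2 :: "'h measure \<Rightarrow> ('h \<Rightarrow> complex) set" where
  "L2 m = {f \<in> borel_measurable m. integrable m (\<lambda>x. (norm (f x))\<^sup>2)}"

definition L2_norm :: "'h measure \<Rightarrow> ('h \<Rightarrow> complex) \<Rightarrow> real" where
  "L2_norm m f = sqrt (\<integral>x. (norm (f x))\<^sup>2 \<partial>m)"

definition hconv :: "'h::t2_space hypergroup_data \<Rightarrow> 'h measure \<Rightarrow>
    ('h \<Rightarrow> complex) \<Rightarrow> ('h \<Rightarrow> complex) \<Rightarrow> 'h \<Rightarrow> complex" where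
  "hconv H m f g x = (\<integral>y. f y * hval H g (invol H y) x \<partial>m)"

definition htilde :: "'h hypergroup_data \<Rightarrow> ('h \<Rightarrow> complex) \<Rightarrow> 'h \<Rightarrow> complex" where
  "htilde H f x = cnj (f (invol H x))"

definition left_reg :: "'h::t2_space hypergroup_data \<Rightarrow> 'h \<Rightarrow> ('h \<Rightarrow> complex) \<Rightarrow> 'h \<Rightarrow> complex" where
  "left_reg H x g y = hval H g (invol H x) y"

definition left_reg_L1 :: "'h::t2_space hypergroup_data \<Rightarrow> 'h measure \<Rightarrow>
    ('h \<Rightarrow> complex) \<Rightarrow> ('h \<Rightarrow> complex) \<Rightarrow> 'h \<Rightarrow> complex" where
  "left_reg_L1 H m f g y = (\<integral>x. f x * left_reg H x g y \<partial>m)"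

definition Cstar_norm :: "'h::t2_space hypergroup_data \<Rightarrow> 'h measure \<Rightarrow> ('h \<Rightarrow> complex) \<Rightarrow> real" where
  "Cstar_norm H m f = Sup {L2_norm m (left_reg_L1 H m f g) | g. g \<in> L2 m \<and> L2_norm m g \<le> 1}"

text \<open>
  The dual of the completion of a normed space is the dual of the space itself, with the same
  norm. Hence the dual of the reduced \<open>C\<^sup>*\<close>-algebra is the dual of \<open>L\<^sup>1\<close> with the norm
  \<open>Cstar_norm\<close>.
\<close>

definition B_dual :: "'h::t2_space hypergroup_data \<Rightarrow> 'h measure \<Rightarrow>
    (('h \<Rightarrow> complex) \<Rightarrow> complex) cnspace" where
  "B_dual H m = dual_space (fun_space {f. integrable m f} (Cstar_norm H m))"

definition functional :: "'h measure \<Rightarrow> ('h \<Rightarrow> complex) \<Rightarrow> ('h \<Rightarrow> complex) \<Rightarrow> complex" where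
  "functional m u = (\<lambda>f\<in>{f. integrable m f}. \<integral>x. u x * f x \<partial>m)"

text \<open>
  Every element of the dual is given by exactly one bounded continuous function.
\<close>

definition B_lambda :: "'h::t2_space hypergroup_data \<Rightarrow> 'h measure \<Rightarrow> ('h \<Rightarrow> complex) set" where
  "B_lambda H m = {u. continuous_on UNIV u \<and> bounded (range u) \<and>
     functional m u \<in> carrier (B_dual H m)}"

definition B_norm :: "'h::t2_space hypergroup_data \<Rightarrow> 'h measure \<Rightarrow> ('h \<Rightarrow> complex) \<Rightarrow> real" where
  "B_norm H m u = nrm (B_dual H m) (functional m u)"

definition A_span :: "'h::t2_space hypergroup_data \<Rightarrow> 'h measure \<Rightarrow> ('h \<Rightarrow> complex) set" where
  "A_span H m = {\<lambda>x. \<Sum>i<n. c i * hconv H m (f i) (htilde H (f i)) x |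
     (n::nat) (c::nat \<Rightarrow> complex) f. \<forall>i<n. f i \<in> Cc}"

definition A_set :: "'h::t2_space hypergroup_data \<Rightarrow> 'h measure \<Rightarrow> ('h \<Rightarrow> complex) set" where
  "A_set H m = {u \<in> B_lambda H m. \<forall>\<epsilon>>0. \<exists>v\<in>A_span H m. B_norm H m (\<lambda>x. u x - v x) < \<epsilon>}"

definition fourier_algebra ::
    "'h::t2_space hypergroup_data \<Rightarrow> 'h measure \<Rightarrow> ('h \<Rightarrow> complex) cnspace" where
  "fourier_algebra H m = fun_space (A_set H m) (B_norm H m)"

definition lebesgue_fourier_algebra ::
    "'h::t2_space hypergroup_data \<Rightarrow> 'h measure \<Rightarrow> ('h \<Rightarrow> complex) cnspace" where
  "lebesgue_fourier_algebra H m =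
     fun_space ({f. integrable m f} \<inter> A_set H m) (\<lambda>f. L1_norm m f + B_norm H m f)"

definition regular_fourier_hypergroup ::
    "'h::t2_space hypergroup_data \<Rightarrow> 'h measure \<Rightarrow> bool" where
  "regular_fourier_hypergroup H m \<longleftrightarrow> hypergroup H \<and> left_haar_measure H m \<and>
     banach_algebra (fourier_algebra H m)"

end

theory Submission
  imports Defs
begin

text \<open>
  An amenable Banach algebra has a bounded approximate identity; a weak\<open>\<^sup>*\<close> limit
  of it in the bidual of the Lebesgue-Fourier algebra is a functional \<open>E\<close> that sends \<open>\<phi>(a \<cdot>)\<close> to \<open>\<phi>(a)\<close>
  (\<open>amenable_bidual_unit\<close>). The norm of the algebra dominates the \<open>L\<^sup>1\<close> norm, so integration against
  a function bounded by \<open>1\<close> has norm at most \<open>1\<close>; testing \<open>E\<close> on such functionals gives \<open>m(K) \<le> \<parallel>E\<parallel>\<close> for every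
  compact set \<open>K\<close> (\<open>amenable_Lebesgue_Fourier_imp_finite\<close>). A hypergroup of finite Haar measure is compact,
  because a compact set of more than half of the total mass meets all its translates
  (\<open>finite_haar_imp_compact\<close>). On a compact hypergroup all elements of the Fourier algebra are integrable,
  and amenability passes from the larger norm to the smaller one (\<open>amenable_from_Lebesgue_Fourier\<close>).

  The test against \<open>E\<close> requires, for every compact set, an integrable element of the Fourier algebra that
  is positive on it. It is \<open>\<phi> * \<phi>\<^sup>~\<close> for a suitable \<open>\<phi> \<ge> 0\<close> of compact support (\<open>corr_pos\<close>, \<open>corr_in_A_set\<close>),
  and most of the work is to show that this function has the required properties.

  Its support is compact, and Haar measure charges all open sets, because of the rule that \<open>z\<close> is in the support of \<open>xy\<close> only if \<open>x\<close> is in the support of the product of \<open>z\<close> and the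
  involution of \<open>y\<close> (\<open>supp_exchange\<close>). It is an instance of associativity once convolution is known to be
  the integral of convolutions of point masses, which follows from weak continuity alone
  (\<open>weakly_continuous_linear_integral\<close>).

  The functional given by \<open>\<phi> * \<phi>\<^sup>~\<close> sends \<open>g\<close> to a matrix coefficient of \<open>\<lambda>(g)\<close>
  (\<open>corr_pairing\<close>), so it is bounded as soon as \<open>\<lambda>(g)\<close> is a bounded operator on \<open>L\<^sup>2\<close>
  (\<open>left_reg_square_bound\<close>). The usual proof interchanges integrals of Borel functions of two variables.
  Here Haar measure need not be \<open>\<sigma>\<close>-finite and Borel functions on the product space need not be measurable
  for the product, so Fubini's theorem is applied only to continuous functions on compact rectangles
  (\<open>fubini_compact\<close>). It is carried over to indicators of open sets by monotone convergence along directed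
  families (\<open>radon_nn_integral_directed_SUP\<close>), and Borel functions are dominated by series of such
  indicators (\<open>radon_open_majorant\<close>).
\<close>

section \<open>Dual spaces and the bidual of an amenable algebra\<close>

lemma complex_ring_simps [simp]:
  "carrier complex_ring = UNIV" "x \<otimes>\<^bsub>complex_ring\<^esub> y = x * y" "\<one>\<^bsub>complex_ring\<^esub> = 1"
  "\<zero>\<^bsub>complex_ring\<^esub> = 0" "x \<oplus>\<^bsub>complex_ring\<^esub> y = x + y"
  by (simp_all add: complex_ring_def)

lemma complex_ring_cring: "cring complex_ring"
proof (rule cringI)
  show "abelian_group complex_ring"
  proof (rule abelian_groupI)
    fix x :: complex
    show "\<exists>y\<in>carrier complex_ring. y \<oplus>\<^bsub>complex_ring\<^esub> x = \<zero>\<^bsub>complex_ring\<^esub>"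
      by (rule bexI[of _ "-x"]) auto
  qed auto
  show "comm_monoid complex_ring"
    by (rule comm_monoidI) auto
qed (auto simp: algebra_simps)

lemma cnormed_spaceD:
  assumes "cnormed_space V"
  shows cnormed_space_module: "Module.module complex_ring V"
    and nrm_nonneg: "\<And>x. x \<in> carrier V \<Longrightarrow> nrm V x \<ge> 0"
    and nrm_eq_0_iff: "\<And>x. x \<in> carrier V \<Longrightarrow> nrm V x = 0 \<longleftrightarrow> x = \<zero>\<^bsub>V\<^esub>"
    and nrm_smult: "\<And>c x. x \<in> carrier V \<Longrightarrow> nrm V (c \<odot>\<^bsub>V\<^esub> x) = norm c * nrm V x"
    and smult_in_carrier: "\<And>c x. x \<in> carrier V \<Longrightarrow> c \<odot>\<^bsub>V\<^esub> x \<in> carrier V"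
    and add_in_carrier: "\<And>x y. x \<in> carrier V \<Longrightarrow> y \<in> carrier V \<Longrightarrow> x \<oplus>\<^bsub>V\<^esub> y \<in> carrier V"
proof -
  from assms have "Module.module complex_ring V" by (simp add: cnormed_space_def)
  then interpret module complex_ring V .
  show "Module.module complex_ring V" by fact
  show "\<And>x. x \<in> carrier V \<Longrightarrow> nrm V x \<ge> 0"
    "\<And>x. x \<in> carrier V \<Longrightarrow> nrm V x = 0 \<longleftrightarrow> x = \<zero>\<^bsub>V\<^esub>"
    "\<And>c x. x \<in> carrier V \<Longrightarrow> nrm V (c \<odot>\<^bsub>V\<^esub> x) = norm c * nrm V x"
    using assms by (auto simp: cnormed_space_def)
  show "\<And>c x. x \<in> carrier V \<Longrightarrow> c \<odot>\<^bsub>V\<^esub> x \<in> carrier V" by simp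
  show "\<And>x y. x \<in> carrier V \<Longrightarrow> y \<in> carrier V \<Longrightarrow> x \<oplus>\<^bsub>V\<^esub> y \<in> carrier V" by simp
qed

lemma mem_dual_iff:
  "\<phi> \<in> carrier (dual_space V) \<longleftrightarrow> \<phi> \<in> extensional (carrier V) \<and>
    (\<forall>x\<in>carrier V. \<forall>y\<in>carrier V. \<phi> (x \<oplus>\<^bsub>V\<^esub> y) = \<phi> x + \<phi> y) \<and>
    (\<forall>c. \<forall>x\<in>carrier V. \<phi> (c \<odot>\<^bsub>V\<^esub> x) = c * \<phi> x) \<and>
    (\<exists>K. \<forall>x\<in>carrier V. norm (\<phi> x) \<le> K * nrm V x)"
  by (simp add: dual_space_def)

lemma dual_space_ops:
  "\<phi> \<oplus>\<^bsub>dual_space V\<^esub> \<psi> = (\<lambda>x\<in>carrier V. \<phi> x + \<psi> x)"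
  "c \<odot>\<^bsub>dual_space V\<^esub> \<phi> = (\<lambda>x\<in>carrier V. c * \<phi> x)"
  "\<zero>\<^bsub>dual_space V\<^esub> = (\<lambda>x\<in>carrier V. 0)"
  "nrm (dual_space V) \<phi> = Sup {norm (\<phi> x) | x. x \<in> carrier V \<and> nrm V x \<le> 1}"
  by (simp_all add: dual_space_def)

lemma dual_eqI:
  assumes "\<phi> \<in> carrier (dual_space V)" "\<psi> \<in> carrier (dual_space V)"
    and "\<And>x. x \<in> carrier V \<Longrightarrow> \<phi> x = \<psi> x"
  shows "\<phi> = \<psi>"
  using assms extensionalityI[of \<phi> "carrier V" \<psi>] by (simp add: mem_dual_iff)

text \<open>The supremum that defines the dual norm is one of real numbers, so it is an upper bound only because
  the functional is bounded. A vector of norm \<open>0\<close> cannot be normalised; there boundedness itself gives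
  the claim.\<close>

lemma dual_norm_bound:
  assumes V: "cnormed_space V" and \<phi>: "\<phi> \<in> carrier (dual_space V)" and x: "x \<in> carrier V"
  shows "norm (\<phi> x) \<le> nrm (dual_space V) \<phi> * nrm V x"
proof -
  interpret V: module complex_ring V by (rule cnormed_space_module[OF V])
  obtain K where K: "\<And>x. x \<in> carrier V \<Longrightarrow> norm (\<phi> x) \<le> K * nrm V x"
    using \<phi> unfolding mem_dual_iff by blast
  have bdd: "bdd_above {norm (\<phi> x) | x. x \<in> carrier V \<and> nrm V x \<le> 1}"
  proof (rule bdd_aboveI)
    fix r assume "r \<in> {norm (\<phi> x) | x. x \<in> carrier V \<and> nrm V x \<le> 1}"
    then obtain x where x: "r = norm (\<phi> x)" "x \<in> carrier V" "nrm V x \<le> 1" by auto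
    have "r \<le> K * nrm V x" using K x by simp
    also have "\<dots> \<le> \<bar>K\<bar> * 1"
      using x nrm_nonneg[OF V x(2)] by (intro mult_mono) auto
    finally show "r \<le> \<bar>K\<bar>" by simp
  qed
  show ?thesis
  proof (cases "nrm V x = 0")
    case True
    then show ?thesis using K[OF x] by simp
  next
    case False
    define t where "t = nrm V x"
    have t: "t > 0" using False nrm_nonneg[OF V x] by (simp add: t_def)
    define y where "y = complex_of_real (1/t) \<odot>\<^bsub>V\<^esub> x"
    have y: "y \<in> carrier V" using x by (simp add: y_def)
    have "nrm V y = norm (complex_of_real (1/t)) * nrm V x"
      unfolding y_def by (rule nrm_smult[OF V x])
    also have "\<dots> = 1" using t by (simp add: t_def norm_divide)
    finally have ny: "nrm V y = 1" .
    have "\<phi> y = complex_of_real (1/t) * \<phi> x"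
      using \<phi> x by (simp add: y_def mem_dual_iff)
    then have "norm (\<phi> y) = norm (\<phi> x) / t" using t by (simp add: norm_mult norm_divide)
    moreover have "norm (\<phi> y) \<le> nrm (dual_space V) \<phi>"
      unfolding dual_space_ops by (rule cSup_upper[OF _ bdd]) (use y ny in auto)
    ultimately show ?thesis using t by (simp add: t_def field_simps)
  qed
qed

lemma dual_norm_least:
  assumes V: "cnormed_space V" and K: "K \<ge> 0"
    and "\<And>x. x \<in> carrier V \<Longrightarrow> norm (\<phi> x) \<le> K * nrm V x"
  shows "nrm (dual_space V) \<phi> \<le> K"
  unfolding dual_space_ops
proof (rule cSup_least)
  interpret V: module complex_ring V by (rule cnormed_space_module[OF V])
  have "nrm V \<zero>\<^bsub>V\<^esub> \<le> 1" using nrm_eq_0_iff[OF V, of "\<zero>\<^bsub>V\<^esub>"] by simp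
  then show "{norm (\<phi> x) | x. x \<in> carrier V \<and> nrm V x \<le> 1} \<noteq> {}" by auto
  fix r assume "r \<in> {norm (\<phi> x) | x. x \<in> carrier V \<and> nrm V x \<le> 1}"
  then obtain x where x: "r = norm (\<phi> x)" "x \<in> carrier V" "nrm V x \<le> 1" by auto
  have "r \<le> K * nrm V x" using assms(3) x by simp
  also have "\<dots> \<le> K * 1" using x K by (intro mult_left_mono) auto
  finally show "r \<le> K" by simp
qed

lemma dual_norm_nonneg:
  assumes V: "cnormed_space V" and \<phi>: "\<phi> \<in> carrier (dual_space V)"
  shows "nrm (dual_space V) \<phi> \<ge> 0"
proof (rule ccontr)
  assume neg: "\<not> ?thesis"
  interpret V: module complex_ring V by (rule cnormed_space_module[OF V])
  have z: "\<zero>\<^bsub>V\<^esub> \<in> carrier V" "nrm V \<zero>\<^bsub>V\<^esub> \<le> 1" using nrm_eq_0_iff[OF V, of "\<zero>\<^bsub>V\<^esub>"] by auto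
  have zero: "norm (\<phi> x) = 0" if "x \<in> carrier V" for x
    using dual_norm_bound[OF V \<phi> that] nrm_nonneg[OF V that] neg
    by (smt (verit) mult_nonpos_nonneg norm_ge_zero)
  have "{norm (\<phi> x) | x. x \<in> carrier V \<and> nrm V x \<le> 1} = {0}"
    using z zero by force
  with neg show False unfolding dual_space_ops by simp
qed

lemma dual_closed:
  assumes V: "cnormed_space V"
    and \<phi>: "\<phi> \<in> carrier (dual_space V)" and \<psi>: "\<psi> \<in> carrier (dual_space V)"
  shows dual_add_closed: "(\<lambda>x\<in>carrier V. \<phi> x + \<psi> x) \<in> carrier (dual_space V)"
    and dual_smult_closed: "(\<lambda>x\<in>carrier V. c * \<phi> x) \<in> carrier (dual_space V)"
proof -
  interpret V: module complex_ring V by (rule cnormed_space_module[OF V])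
  note b = dual_norm_bound[OF V \<phi>] dual_norm_bound[OF V \<psi>]
  show "(\<lambda>x\<in>carrier V. \<phi> x + \<psi> x) \<in> carrier (dual_space V)"
    unfolding mem_dual_iff
  proof (intro conjI allI ballI exI)
    fix x assume x: "x \<in> carrier V"
    show "norm ((\<lambda>x\<in>carrier V. \<phi> x + \<psi> x) x) \<le> (nrm (dual_space V) \<phi> + nrm (dual_space V) \<psi>) * nrm V x"
      using x b[OF x] norm_triangle_ineq[of "\<phi> x" "\<psi> x"] by (simp add: algebra_simps)
  qed (use \<phi> \<psi> in \<open>auto simp: mem_dual_iff algebra_simps\<close>)
  show "(\<lambda>x\<in>carrier V. c * \<phi> x) \<in> carrier (dual_space V)"
    unfolding mem_dual_iff
  proof (intro conjI allI ballI exI)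
    fix x assume x: "x \<in> carrier V"
    show "norm ((\<lambda>x\<in>carrier V. c * \<phi> x) x) \<le> (norm c * nrm (dual_space V) \<phi>) * nrm V x"
      using x b(1)[OF x] by (simp add: norm_mult mult.assoc mult_left_mono)
  qed (use \<phi> \<psi> in \<open>auto simp: mem_dual_iff algebra_simps\<close>)
qed

lemma dual_abelian_group:
  assumes V: "cnormed_space V"
  shows "abelian_group (dual_space V)"
proof (rule abelian_groupI)
  interpret V: module complex_ring V by (rule cnormed_space_module[OF V])
  show "\<zero>\<^bsub>dual_space V\<^esub> \<in> carrier (dual_space V)"
    by (auto simp: mem_dual_iff dual_space_ops intro!: exI[of _ 0])
  fix \<phi> assume \<phi>: "\<phi> \<in> carrier (dual_space V)"
  show "\<zero>\<^bsub>dual_space V\<^esub> \<oplus>\<^bsub>dual_space V\<^esub> \<phi> = \<phi>"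
    using \<phi> by (auto simp: dual_space_ops mem_dual_iff fun_eq_iff extensional_def)
  show "\<exists>y\<in>carrier (dual_space V). y \<oplus>\<^bsub>dual_space V\<^esub> \<phi> = \<zero>\<^bsub>dual_space V\<^esub>"
    using dual_smult_closed[OF V \<phi> \<phi>, of "-1"]
    by (rule bexI[rotated]) (auto simp: dual_space_ops fun_eq_iff)
qed (auto simp: dual_space_ops fun_eq_iff algebra_simps dual_add_closed[OF V])

lemma dual_minus:
  assumes V: "cnormed_space V"
    and \<phi>: "\<phi> \<in> carrier (dual_space V)" and \<psi>: "\<psi> \<in> carrier (dual_space V)"
  shows "\<phi> \<ominus>\<^bsub>dual_space V\<^esub> \<psi> = (\<lambda>x\<in>carrier V. \<phi> x - \<psi> x)"
proof -
  interpret D: abelian_group "dual_space V" by (rule dual_abelian_group[OF V])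
  have "\<ominus>\<^bsub>dual_space V\<^esub> \<psi> = (\<lambda>x\<in>carrier V. (-1) * \<psi> x)"
    by (rule D.minus_equality[OF _ \<psi>])
      (use dual_smult_closed[OF V \<psi> \<psi>, of "-1"] in \<open>auto simp: dual_space_ops fun_eq_iff\<close>)
  then show ?thesis by (auto simp: a_minus_def dual_space_ops fun_eq_iff)
qed

lemma dual_cnormed_space:
  assumes V: "cnormed_space V"
  shows "cnormed_space (dual_space V)"
  unfolding cnormed_space_def
proof (intro conjI ballI allI)
  interpret V: module complex_ring V by (rule cnormed_space_module[OF V])
  interpret D: abelian_group "dual_space V" by (rule dual_abelian_group[OF V])
  show "Module.module complex_ring (dual_space V)"
  proof (rule moduleI[OF complex_ring_cring D.abelian_group_axioms])
    fix a x assume "x \<in> carrier (dual_space V)"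
    then show "a \<odot>\<^bsub>dual_space V\<^esub> x \<in> carrier (dual_space V)"
      using dual_smult_closed[OF V, of x x] by (simp add: dual_space_ops)
  next
    fix x assume "x \<in> carrier (dual_space V)"
    then show "\<one>\<^bsub>complex_ring\<^esub> \<odot>\<^bsub>dual_space V\<^esub> x = x"
      by (auto simp: dual_space_ops fun_eq_iff mem_dual_iff extensional_def)
  qed (auto simp: dual_space_ops fun_eq_iff algebra_simps)
  fix \<phi> assume \<phi>: "\<phi> \<in> carrier (dual_space V)"
  note b = dual_norm_bound[OF V \<phi>] and n = dual_norm_nonneg[OF V \<phi>]
  show "nrm (dual_space V) \<phi> \<ge> 0" by (rule n)
  show "nrm (dual_space V) \<phi> = 0 \<longleftrightarrow> \<phi> = \<zero>\<^bsub>dual_space V\<^esub>"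
  proof
    assume "nrm (dual_space V) \<phi> = 0"
    then show "\<phi> = \<zero>\<^bsub>dual_space V\<^esub>"
      using b by (intro dual_eqI[OF \<phi> D.zero_closed]) (auto simp: dual_space_ops)
  next
    assume "\<phi> = \<zero>\<^bsub>dual_space V\<^esub>"
    then have "nrm (dual_space V) \<phi> \<le> 0"
      by (intro dual_norm_least[OF V]) (auto simp: dual_space_ops)
    with n show "nrm (dual_space V) \<phi> = 0" by simp
  qed
  show "nrm (dual_space V) (c \<odot>\<^bsub>dual_space V\<^esub> \<phi>) = norm c * nrm (dual_space V) \<phi>" for c
  proof -
    have le: "nrm (dual_space V) (c \<odot>\<^bsub>dual_space V\<^esub> \<psi>) \<le> norm c * nrm (dual_space V) \<psi>"
      if \<psi>: "\<psi> \<in> carrier (dual_space V)" for c \<psi>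
      using dual_norm_bound[OF V \<psi>] dual_norm_nonneg[OF V \<psi>]
      by (intro dual_norm_least[OF V])
        (auto simp: dual_space_ops norm_mult mult.assoc intro!: mult_left_mono)
    show ?thesis
    proof (cases "c = 0")
      case True
      have "c \<odot>\<^bsub>dual_space V\<^esub> \<phi> \<in> carrier (dual_space V)"
        using dual_smult_closed[OF V \<phi> \<phi>] by (simp add: dual_space_ops)
      then show ?thesis using le[OF \<phi>, of c] dual_norm_nonneg[OF V] True
        by (metis mult_zero_left norm_zero order_antisym)
    next
      case False
      have c: "c \<odot>\<^bsub>dual_space V\<^esub> \<phi> \<in> carrier (dual_space V)"
        using dual_smult_closed[OF V \<phi> \<phi>] by (simp add: dual_space_ops)
      have "inverse c \<odot>\<^bsub>dual_space V\<^esub> (c \<odot>\<^bsub>dual_space V\<^esub> \<phi>) = \<phi>"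
        using False \<phi> by (auto simp: dual_space_ops fun_eq_iff mem_dual_iff extensional_def)
      then have "nrm (dual_space V) \<phi> \<le> norm (inverse c) * nrm (dual_space V) (c \<odot>\<^bsub>dual_space V\<^esub> \<phi>)"
        using le[OF c, of "inverse c"] by simp
      then have "norm c * nrm (dual_space V) \<phi> \<le> nrm (dual_space V) (c \<odot>\<^bsub>dual_space V\<^esub> \<phi>)"
        using False by (simp add: norm_divide norm_inverse field_simps)
      with le[OF \<phi>, of c] show ?thesis by simp
    qed
  qed
  fix \<psi> assume \<psi>: "\<psi> \<in> carrier (dual_space V)"
  show "nrm (dual_space V) (\<phi> \<oplus>\<^bsub>dual_space V\<^esub> \<psi>) \<le> nrm (dual_space V) \<phi> + nrm (dual_space V) \<psi>"
  proof (rule dual_norm_least[OF V])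
    fix x assume x: "x \<in> carrier V"
    show "norm ((\<phi> \<oplus>\<^bsub>dual_space V\<^esub> \<psi>) x) \<le> (nrm (dual_space V) \<phi> + nrm (dual_space V) \<psi>) * nrm V x"
      using b[OF x] dual_norm_bound[OF V \<psi> x] norm_triangle_ineq[of "\<phi> x" "\<psi> x"] x
      by (simp add: dual_space_ops algebra_simps)
  qed (use n dual_norm_nonneg[OF V \<psi>] in simp)
qed

text \<open>A Cauchy sequence of functionals converges pointwise; the limit is bounded and is approached in
  norm because the Cauchy estimate is uniform on the unit ball.\<close>

lemma dual_banach_space:
  assumes V: "cnormed_space V"
  shows "banach_space (dual_space V)"
  unfolding banach_space_def
proof (intro conjI allI impI)
  show "cnormed_space (dual_space V)" by (rule dual_cnormed_space[OF V])
  fix s :: "nat \<Rightarrow> 'a \<Rightarrow> complex"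
  assume ran: "range s \<subseteq> carrier (dual_space V)"
    and "\<forall>\<epsilon>>0. \<exists>N. \<forall>i\<ge>N. \<forall>j\<ge>N. nrm (dual_space V) (s i \<ominus>\<^bsub>dual_space V\<^esub> s j) < \<epsilon>"
  then have cau: "\<exists>N. \<forall>i\<ge>N. \<forall>j\<ge>N. nrm (dual_space V) (s i \<ominus>\<^bsub>dual_space V\<^esub> s j) < \<epsilon>" if "\<epsilon> > 0" for \<epsilon>
    using that by auto
  interpret V: module complex_ring V by (rule cnormed_space_module[OF V])
  interpret D: abelian_group "dual_space V" by (rule dual_abelian_group[OF V])
  have s: "s i \<in> carrier (dual_space V)" for i using ran by auto
  have diff: "norm (s i x - s j x) \<le> nrm (dual_space V) (s i \<ominus>\<^bsub>dual_space V\<^esub> s j) * nrm V x"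
    if "x \<in> carrier V" for i j x
    using dual_norm_bound[OF V D.minus_closed[OF s[of i] s[of j]] that] that
    by (simp add: dual_minus[OF V s s])
  have unif: "\<exists>N. \<forall>i\<ge>N. \<forall>j\<ge>N. \<forall>x\<in>carrier V. norm (s i x - s j x) \<le> \<epsilon> * nrm V x" if "\<epsilon> > 0" for \<epsilon>
  proof -
    obtain N where "\<forall>i\<ge>N. \<forall>j\<ge>N. nrm (dual_space V) (s i \<ominus>\<^bsub>dual_space V\<^esub> s j) < \<epsilon>"
      using cau \<open>\<epsilon> > 0\<close> by blast
    then show ?thesis
      using diff nrm_nonneg[OF V]
      by (intro exI[of _ N]) (meson less_imp_le mult_right_mono order_trans)
  qed
  have conv: "convergent (\<lambda>i. s i x)" if x: "x \<in> carrier V" for x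
  proof (rule Cauchy_convergent, rule metric_CauchyI)
    fix e :: real assume e: "e > 0"
    have n: "nrm V x \<ge> 0" using nrm_nonneg[OF V x] .
    then have "e / (nrm V x + 1) > 0" using e by simp
    then obtain N where N: "\<forall>i\<ge>N. \<forall>j\<ge>N. \<forall>x'\<in>carrier V.
        norm (s i x' - s j x') \<le> (e / (nrm V x + 1)) * nrm V x'"
      using unif by blast
    have "(e / (nrm V x + 1)) * nrm V x < e" using e n by (simp add: field_simps)
    then show "\<exists>M. \<forall>m\<ge>M. \<forall>n\<ge>M. dist (s m x) (s n x) < e"
      using N x unfolding dist_norm by (meson order_le_less_trans)
  qed
  define l where "l = (\<lambda>x\<in>carrier V. lim (\<lambda>i. s i x))"
  have lim: "(\<lambda>i. s i x) \<longlonglongrightarrow> l x" if x: "x \<in> carrier V" for x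
    using conv[OF x] x by (simp add: l_def convergent_LIMSEQ_iff)
  have close: "\<exists>N. \<forall>i\<ge>N. \<forall>x\<in>carrier V. norm (s i x - l x) \<le> \<epsilon> * nrm V x" if \<epsilon>: "\<epsilon> > 0" for \<epsilon>
  proof -
    obtain N where N: "\<forall>i\<ge>N. \<forall>j\<ge>N. \<forall>x\<in>carrier V. norm (s i x - s j x) \<le> \<epsilon> * nrm V x"
      using unif[OF \<epsilon>] by blast
    have "norm (s i x - l x) \<le> \<epsilon> * nrm V x" if "i \<ge> N" "x \<in> carrier V" for i x
    proof (rule Lim_bounded)
      show "(\<lambda>j. norm (s i x - s j x)) \<longlonglongrightarrow> norm (s i x - l x)"
        by (intro tendsto_intros lim that)
      show "\<forall>j\<ge>N. norm (s i x - s j x) \<le> \<epsilon> * nrm V x" using N that by blast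
    qed
    then show ?thesis by blast
  qed
  have l: "l \<in> carrier (dual_space V)"
    unfolding mem_dual_iff
  proof (intro conjI ballI allI)
    show "l \<in> extensional (carrier V)" by (simp add: l_def)
    fix x assume x: "x \<in> carrier V"
    show "l (c \<odot>\<^bsub>V\<^esub> x) = c * l x" for c
    proof (rule LIMSEQ_unique[OF lim])
      show "(\<lambda>i. s i (c \<odot>\<^bsub>V\<^esub> x)) \<longlonglongrightarrow> c * l x"
        using tendsto_mult_left[OF lim[OF x], of c] s x by (simp add: mem_dual_iff)
    qed (use x in simp)
    fix y assume y: "y \<in> carrier V"
    show "l (x \<oplus>\<^bsub>V\<^esub> y) = l x + l y"
    proof (rule LIMSEQ_unique[OF lim])
      show "(\<lambda>i. s i (x \<oplus>\<^bsub>V\<^esub> y)) \<longlonglongrightarrow> l x + l y"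
        using tendsto_add[OF lim[OF x] lim[OF y]] s x y by (simp add: mem_dual_iff)
    qed (use x y in simp)
  next
    obtain N where N: "\<forall>i\<ge>N. \<forall>x\<in>carrier V. norm (s i x - l x) \<le> 1 * nrm V x"
      using close[of 1] by auto
    show "\<exists>K. \<forall>x\<in>carrier V. norm (l x) \<le> K * nrm V x"
    proof (intro exI ballI)
      fix x assume x: "x \<in> carrier V"
      have "norm (l x) \<le> norm (s N x) + norm (s N x - l x)"
        by (metis norm_minus_commute norm_triangle_sub)
      also have "\<dots> \<le> nrm (dual_space V) (s N) * nrm V x + 1 * nrm V x"
        using N x by (intro add_mono dual_norm_bound[OF V s x]) auto
      finally show "norm (l x) \<le> (nrm (dual_space V) (s N) + 1) * nrm V x"
        by (simp add: algebra_simps)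
    qed
  qed
  show "\<exists>l\<in>carrier (dual_space V). (\<lambda>i. nrm (dual_space V) (s i \<ominus>\<^bsub>dual_space V\<^esub> l)) \<longlonglongrightarrow> 0"
  proof (rule bexI[OF _ l], rule LIMSEQ_I)
    fix r :: real assume r: "r > 0"
    obtain N where N: "\<forall>i\<ge>N. \<forall>x\<in>carrier V. norm (s i x - l x) \<le> r/2 * nrm V x"
      using close[of "r/2"] r by auto
    have "nrm (dual_space V) (s i \<ominus>\<^bsub>dual_space V\<^esub> l) \<le> r/2" if "i \<ge> N" for i
      using N that r by (intro dual_norm_least[OF V]) (auto simp: dual_minus[OF V s l])
    moreover have "nrm (dual_space V) (s i \<ominus>\<^bsub>dual_space V\<^esub> l) \<ge> 0" for i
      by (intro dual_norm_nonneg[OF V] D.minus_closed s l)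
    ultimately have "norm (nrm (dual_space V) (s i \<ominus>\<^bsub>dual_space V\<^esub> l) - 0) < r" if "i \<ge> N" for i
      using that r by (smt (verit) field_sum_of_halves real_norm_def)
    then show "\<exists>no. \<forall>n\<ge>no. norm (nrm (dual_space V) (s n \<ominus>\<^bsub>dual_space V\<^esub> l) - 0) < r" by blast
  qed
qed

text \<open>The standard argument that an amenable Banach algebra has a bounded approximate identity, stopped
  before the approximate identity is extracted from its weak\<open>\<^sup>*\<close> limit \<open>E\<close> in the bidual. Give
  \<open>A\<^sup>*\<close> the right action \<open>(\<phi> \<cdot> a)(b) = \<phi>(a b)\<close> and the left action \<open>0\<close>. Then the canonical map
  \<open>A \<rightarrow> A\<^sup>*\<^sup>*\<close> is a bounded derivation into the dual of this bimodule, and \<open>E\<close> implements it.\<close>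

lemma amenable_bidual_unit:
  fixes A :: "'a cnspace"
  assumes am: "amenable TYPE('a \<Rightarrow> complex) A"
  obtains E where "E \<in> carrier (dual_space (dual_space A))"
    and "\<And>\<phi> a. \<phi> \<in> carrier (dual_space A) \<Longrightarrow> a \<in> carrier A \<Longrightarrow>
      E (\<lambda>b\<in>carrier A. \<phi> (a \<otimes>\<^bsub>A\<^esub> b)) = \<phi> a"
proof -
  define X where "X = dual_space A"
  define L :: "'a \<Rightarrow> ('a \<Rightarrow> complex) \<Rightarrow> ('a \<Rightarrow> complex)" where "L = (\<lambda>a \<phi>. \<zero>\<^bsub>X\<^esub>)"
  define R :: "('a \<Rightarrow> complex) \<Rightarrow> 'a \<Rightarrow> ('a \<Rightarrow> complex)" where
    "R = (\<lambda>\<phi> a. \<lambda>b\<in>carrier A. \<phi> (a \<otimes>\<^bsub>A\<^esub> b))"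
  define D :: "'a \<Rightarrow> ('a \<Rightarrow> complex) \<Rightarrow> complex" where "D = (\<lambda>a. \<lambda>\<phi>\<in>carrier X. \<phi> a)"
  have ba: "banach_algebra A" using am by (simp add: amenable_def)
  then have A: "cnormed_space A" by (simp add: banach_algebra_def banach_space_def)
  interpret A: module complex_ring A by (rule cnormed_space_module[OF A])
  have X: "cnormed_space X" unfolding X_def by (rule dual_cnormed_space[OF A])
  interpret X: module complex_ring X by (rule cnormed_space_module[OF X])
  have prod: "a \<otimes>\<^bsub>A\<^esub> b \<in> carrier A" if "a \<in> carrier A" "b \<in> carrier A" for a b
    using ba that by (auto simp: banach_algebra_def clinear_on_def)
  have prodlin: "a \<otimes>\<^bsub>A\<^esub> (b \<oplus>\<^bsub>A\<^esub> c) = a \<otimes>\<^bsub>A\<^esub> b \<oplus>\<^bsub>A\<^esub> a \<otimes>\<^bsub>A\<^esub> c" "(b \<oplus>\<^bsub>A\<^esub> c) \<otimes>\<^bsub>A\<^esub> a = b \<otimes>\<^bsub>A\<^esub> a \<oplus>\<^bsub>A\<^esub> c \<otimes>\<^bsub>A\<^esub> a"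
    "a \<otimes>\<^bsub>A\<^esub> (k \<odot>\<^bsub>A\<^esub> b) = k \<odot>\<^bsub>A\<^esub> (a \<otimes>\<^bsub>A\<^esub> b)" "(k \<odot>\<^bsub>A\<^esub> b) \<otimes>\<^bsub>A\<^esub> a = k \<odot>\<^bsub>A\<^esub> (b \<otimes>\<^bsub>A\<^esub> a)"
    if "a \<in> carrier A" "b \<in> carrier A" "c \<in> carrier A" for a b c k
    using ba that by (auto simp: banach_algebra_def clinear_on_def)
  have assoc: "(a \<otimes>\<^bsub>A\<^esub> b) \<otimes>\<^bsub>A\<^esub> c = a \<otimes>\<^bsub>A\<^esub> (b \<otimes>\<^bsub>A\<^esub> c)"
    and nprod: "nrm A (a \<otimes>\<^bsub>A\<^esub> b) \<le> nrm A a * nrm A b"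
    if "a \<in> carrier A" "b \<in> carrier A" "c \<in> carrier A" for a b c
    using ba that by (auto simp: banach_algebra_def)
  have Rb: "norm (R \<phi> a b) \<le> (nrm X \<phi> * nrm A a) * nrm A b"
    if \<phi>: "\<phi> \<in> carrier X" and a: "a \<in> carrier A" and b: "b \<in> carrier A" for \<phi> a b
  proof -
    have "norm (R \<phi> a b) \<le> nrm X \<phi> * nrm A (a \<otimes>\<^bsub>A\<^esub> b)"
      unfolding R_def using dual_norm_bound[OF A _ prod[OF a b], of \<phi>] \<phi> b by (simp add: X_def)
    also have "\<dots> \<le> nrm X \<phi> * (nrm A a * nrm A b)"
      using \<phi> a b by (intro mult_left_mono nprod nrm_nonneg[OF X]) auto
    finally show ?thesis by (simp add: mult.assoc)
  qed
  have R: "R \<phi> a \<in> carrier X" if \<phi>: "\<phi> \<in> carrier X" and a: "a \<in> carrier A" for \<phi> a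
    unfolding X_def mem_dual_iff
  proof (intro conjI)
    show "\<exists>K. \<forall>x\<in>carrier A. norm (R \<phi> a x) \<le> K * nrm A x"
      using Rb[OF \<phi> a] by blast
  qed (use \<phi> a prod in \<open>auto simp: R_def prodlin X_def mem_dual_iff\<close>)
  have \<phi>lin: "\<phi> (x \<oplus>\<^bsub>A\<^esub> y) = \<phi> x + \<phi> y" "\<phi> (c \<odot>\<^bsub>A\<^esub> x) = c * \<phi> x"
    if "\<phi> \<in> carrier X" "x \<in> carrier A" "y \<in> carrier A" for \<phi> x y c
    using that by (auto simp: X_def mem_dual_iff)
  have Xops: "\<phi> \<oplus>\<^bsub>X\<^esub> \<psi> = (\<lambda>x\<in>carrier A. \<phi> x + \<psi> x)" "c \<odot>\<^bsub>X\<^esub> \<phi> = (\<lambda>x\<in>carrier A. c * \<phi> x)"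
    for \<phi> \<psi> c by (simp_all add: X_def dual_space_ops)
  have zsm: "c \<odot>\<^bsub>X\<^esub> \<zero>\<^bsub>X\<^esub> = \<zero>\<^bsub>X\<^esub>" for c
    by (auto simp: X_def dual_space_ops fun_eq_iff)
  have bimod: "banach_bimodule A X L R"
    unfolding banach_bimodule_def
  proof (intro conjI ballI)
    show "banach_space X" unfolding X_def by (rule dual_banach_space[OF A])
    show "\<exists>K. \<forall>a\<in>carrier A. \<forall>x\<in>carrier X.
        nrm X (L a x) \<le> K * nrm A a * nrm X x \<and> nrm X (R x a) \<le> K * nrm A a * nrm X x"
    proof (intro exI[of _ 1] ballI conjI)
      fix a \<phi> assume a: "a \<in> carrier A" and \<phi>: "\<phi> \<in> carrier X"
      show "nrm X (L a \<phi>) \<le> 1 * nrm A a * nrm X \<phi>"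
        using nrm_eq_0_iff[OF X, of "\<zero>\<^bsub>X\<^esub>"] nrm_nonneg[OF X \<phi>] nrm_nonneg[OF A a] by (simp add: L_def)
      show "nrm X (R \<phi> a) \<le> 1 * nrm A a * nrm X \<phi>"
        using Rb[OF \<phi> a] nrm_nonneg[OF X \<phi>] nrm_nonneg[OF A a] unfolding X_def
        by (intro dual_norm_least[OF A]) (auto simp: mult.commute)
    qed
    fix a \<phi> b assume a: "a \<in> carrier A" and \<phi>: "\<phi> \<in> carrier X" and b: "b \<in> carrier A"
    show "L (a \<otimes>\<^bsub>A\<^esub> b) \<phi> = L a (L b \<phi>)" by (simp add: L_def)
    show "R \<phi> (a \<otimes>\<^bsub>A\<^esub> b) = R (R \<phi> a) b"
      using a b \<phi> by (auto simp: R_def fun_eq_iff prod assoc)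
    show "R (L a \<phi>) b = L a (R \<phi> b)"
      using a b \<phi> by (auto simp: R_def L_def fun_eq_iff prod X_def dual_space_ops)
  qed (use R in \<open>auto simp: clinear_on_def L_def Pi_iff zsm\<close>,
       auto simp: R_def Xops fun_eq_iff prod prodlin \<phi>lin)
  have Dc: "D a \<in> carrier (dual_space X)" if a: "a \<in> carrier A" for a
    unfolding mem_dual_iff
  proof (intro conjI)
    show "\<exists>K. \<forall>\<phi>\<in>carrier X. norm (D a \<phi>) \<le> K * nrm X \<phi>"
      using dual_norm_bound[OF A _ a] by (intro exI[of _ "nrm A a"]) (simp add: D_def X_def mult.commute)
  qed (use a in \<open>auto simp: D_def, auto simp: Xops\<close>)
  have der: "bounded_derivation A (dual_space X) (dual_lact X R) (dual_ract X L) D"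
    unfolding bounded_derivation_def
  proof (intro conjI)
    show "clinear_on A (dual_space X) D"
      unfolding clinear_on_def
      using Dc \<phi>lin by (auto simp: dual_space_ops fun_eq_iff D_def)
    have "nrm (dual_space X) (D a) \<le> 1 * nrm A a" if a: "a \<in> carrier A" for a
      using dual_norm_bound[OF A _ a] nrm_nonneg[OF A a]
      by (intro dual_norm_least[OF X]) (auto simp: D_def X_def mult.commute)
    then show "\<exists>K. \<forall>a\<in>carrier A. nrm (dual_space X) (D a) \<le> K * nrm A a" by blast
    show "\<forall>a\<in>carrier A. \<forall>b\<in>carrier A. D (a \<otimes>\<^bsub>A\<^esub> b) =
        dual_lact X R a (D b) \<oplus>\<^bsub>dual_space X\<^esub> dual_ract X L (D a) b"
      using R by (auto simp: dual_lact_def dual_ract_def D_def dual_space_ops fun_eq_iff L_def)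
        (auto simp: R_def X_def dual_space_ops)
  qed
  obtain E where E: "E \<in> carrier (dual_space X)" and
    in_eq: "\<And>a. a \<in> carrier A \<Longrightarrow> D a = dual_lact X R a E \<ominus>\<^bsub>dual_space X\<^esub> dual_ract X L E a"
    using am bimod der unfolding amenable_def inner_derivation_def by blast
  \<comment> \<open>As the left action is \<open>0\<close>, so is \<open>E \<cdot> a\<close>, and inner means \<open>D a = a \<cdot> E\<close>.\<close>
  have E0: "E \<zero>\<^bsub>X\<^esub> = 0"
    using dual_norm_bound[OF X E X.zero_closed] nrm_eq_0_iff[OF X X.zero_closed] by simp
  have lact: "dual_lact X R a E \<in> carrier (dual_space X)" if a: "a \<in> carrier A" for a
    unfolding mem_dual_iff
  proof (intro conjI)
    have "norm (E (R \<phi> a)) \<le> (nrm (dual_space X) E * nrm A a) * nrm X \<phi>" if \<phi>: "\<phi> \<in> carrier X" for \<phi>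
    proof -
      have "norm (E (R \<phi> a)) \<le> nrm (dual_space X) E * nrm X (R \<phi> a)"
        by (rule dual_norm_bound[OF X E R[OF \<phi> a]])
      also have "\<dots> \<le> nrm (dual_space X) E * (nrm X \<phi> * nrm A a)"
        using Rb[OF \<phi> a] nrm_nonneg[OF X \<phi>] nrm_nonneg[OF A a] dual_norm_nonneg[OF X E] unfolding X_def
        by (intro mult_left_mono dual_norm_least[OF A]) auto
      finally show ?thesis by (simp add: mult_ac)
    qed
    then show "\<exists>K. \<forall>\<phi>\<in>carrier X. norm (dual_lact X R a E \<phi>) \<le> K * nrm X \<phi>"
      by (auto simp: dual_lact_def)
    have "R (\<phi> \<oplus>\<^bsub>X\<^esub> \<psi>) a = R \<phi> a \<oplus>\<^bsub>X\<^esub> R \<psi> a" for \<phi> \<psi>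
      using a by (auto simp: R_def Xops fun_eq_iff prod)
    then show "\<forall>x\<in>carrier X. \<forall>y\<in>carrier X. dual_lact X R a E (x \<oplus>\<^bsub>X\<^esub> y) = dual_lact X R a E x + dual_lact X R a E y"
      using E R a by (auto simp: dual_lact_def mem_dual_iff)
    have "R (c \<odot>\<^bsub>X\<^esub> \<phi>) a = c \<odot>\<^bsub>X\<^esub> R \<phi> a" for \<phi> c
      using a by (auto simp: R_def Xops fun_eq_iff prod)
    then show "\<forall>c. \<forall>x\<in>carrier X. dual_lact X R a E (c \<odot>\<^bsub>X\<^esub> x) = c * dual_lact X R a E x"
      using E R a by (auto simp: dual_lact_def mem_dual_iff)
  qed (simp add: dual_lact_def)
  have ract: "dual_ract X L E a = \<zero>\<^bsub>dual_space X\<^esub>" for a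
    by (auto simp: dual_ract_def L_def E0 dual_space_ops)
  interpret DX: abelian_group "dual_space X" by (rule dual_abelian_group[OF X])
  show thesis
  proof (rule that)
    show "E \<in> carrier (dual_space (dual_space A))" using E by (simp add: X_def)
    fix \<phi> a assume "\<phi> \<in> carrier (dual_space A)" and a: "a \<in> carrier A"
    then have \<phi>: "\<phi> \<in> carrier X" by (simp add: X_def)
    have "D a = dual_lact X R a E"
      using in_eq[OF a] lact[OF a] by (simp add: ract DX.minus_eq)
    then have "D a \<phi> = E (R \<phi> a)" using \<phi> by (simp add: dual_lact_def)
    then show "E (\<lambda>b\<in>carrier A. \<phi> (a \<otimes>\<^bsub>A\<^esub> b)) = \<phi> a"
      using \<phi> by (simp add: D_def R_def)
  qed
qed

section \<open>Integration against Radon measures\<close>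

text \<open>For open \<open>U\<close> this is an upwards directed family with pointwise supremum the indicator of \<open>U\<close>. It
  replaces approximating sequences, which need not exist in a space without countable bases.\<close>

definition bump :: "'h::t2_space set \<Rightarrow> ('h \<Rightarrow> real) set" where
  "bump U = {\<phi>. continuous_on UNIV \<phi> \<and> (\<forall>x. 0 \<le> \<phi> x \<and> \<phi> x \<le> 1) \<and>
     compact (closure {x. \<phi> x \<noteq> 0}) \<and> (\<forall>x. x \<notin> U \<longrightarrow> \<phi> x = 0)}"

lemma bumpD:
  assumes "\<phi> \<in> bump U"
  shows "continuous_on UNIV \<phi>" "0 \<le> \<phi> x" "\<phi> x \<le> 1" "compact (closure {x. \<phi> x \<noteq> 0})"
    "x \<notin> U \<Longrightarrow> \<phi> x = 0"
  using assms unfolding bump_def by blast+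

lemma bump_outside_closure: "x \<notin> closure {x. \<phi> x \<noteq> 0} \<Longrightarrow> \<phi> x = (0::real)"
  using closure_subset[of "{x. \<phi> x \<noteq> 0}"] by blast

lemma nonzero_in_closure: "\<phi> x \<noteq> 0 \<Longrightarrow> x \<in> closure {x. \<phi> x \<noteq> (0::real)}"
  using closure_subset[of "{x. \<phi> x \<noteq> 0}"] by blast

lemma bump_of_real_Cc: "\<phi> \<in> bump U \<Longrightarrow> (\<lambda>x. complex_of_real (\<phi> x)) \<in> Cc"
  using bumpD(1,4)[of \<phi> U] unfolding Cc_def by (simp add: continuous_on_of_real)

lemma compact_closed_subset:
  assumes "compact L" "closed C" "C \<subseteq> L"
  shows "compact C"
  using compact_Int_closed[OF assms(1,2)] assms(3) by (simp add: Int_absorb1)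

lemma bump_max:
  assumes "\<phi> \<in> bump U" "\<psi> \<in> bump U"
  shows "(\<lambda>x. max (\<phi> x) (\<psi> x)) \<in> bump U"
proof -
  have "closure {x. max (\<phi> x) (\<psi> x) \<noteq> 0} \<subseteq> closure ({x. \<phi> x \<noteq> 0} \<union> {x. \<psi> x \<noteq> 0})"
    by (rule closure_mono) (auto simp: max_def)
  also have "\<dots> = closure {x. \<phi> x \<noteq> 0} \<union> closure {x. \<psi> x \<noteq> 0}" by (rule closure_Un)
  finally have "closure {x. max (\<phi> x) (\<psi> x) \<noteq> 0} \<subseteq> \<dots>" .
  moreover have "compact (closure {x. \<phi> x \<noteq> 0} \<union> closure {x. \<psi> x \<noteq> 0})"
    using assms by (intro compact_Un bumpD(4))
  ultimately have "compact (closure {x. max (\<phi> x) (\<psi> x) \<noteq> 0})"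
    using compact_closed_subset closed_closure by blast
  moreover have "continuous_on UNIV (\<lambda>x. max (\<phi> x) (\<psi> x))"
    by (intro continuous_on_max bumpD(1)[OF assms(1)] bumpD(1)[OF assms(2)])
  ultimately show ?thesis
    unfolding bump_def using bumpD[OF assms(1)] bumpD[OF assms(2)] by (simp add: le_max_iff_disj)
qed

lemma urysohn_bump:
  fixes K U :: "'h::t2_space set"
  assumes lc: "locally_compact_space (euclidean :: 'h topology)"
    and K: "compact K" and U: "open U" and KU: "K \<subseteq> U"
  obtains \<phi> where "\<phi> \<in> bump U" "\<And>x. x \<in> K \<Longrightarrow> \<phi> x = 1"
proof -
  have haus: "Hausdorff_space (euclidean :: 'h topology)"
    unfolding Hausdorff_space_def disjnt_def using hausdorff by simp blast
  obtain W L where W: "open W" "compact L" "closed L" "K \<subseteq> W" "W \<subseteq> L"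
    using lc K locally_compact_space_compact_closed_compact[of "euclidean :: 'h topology"] haus by auto
  have cr: "completely_regular_space (euclidean :: 'h topology)"
    by (rule locally_compact_regular_imp_completely_regular_space[OF lc]) (use haus in simp)
  have cl: "closedin euclidean (- (U \<inter> W))" unfolding closed_closedin[symmetric]
    by (intro closed_Compl open_Int U W)
  have dj: "disjnt (- (U \<inter> W)) K" using KU W by (auto simp: disjnt_def)
  obtain \<phi> :: "'h \<Rightarrow> real" where \<phi>: "continuous_map euclidean (subtopology euclidean {0..1}) \<phi>"
      "\<phi> ` K \<subseteq> {1}" "\<phi> ` (- (U \<inter> W)) \<subseteq> {0}"
  proof -
    have "compactin euclidean K" using K by simp
    from Urysohn_completely_regular_closed_compact[OF zero_le_one cr cl this dj]
    obtain f :: "'h \<Rightarrow> real" where f: "continuous_map euclidean (subtopology euclidean {0..1}) f"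
      "f ` K \<subseteq> {0}" "f ` (- (U \<inter> W)) \<subseteq> {1}" by blast
    show thesis
    proof (rule that)
      show "continuous_map euclidean (subtopology euclidean {0..1}) (\<lambda>x. 1 - f x)"
        using f(1) by (simp add: continuous_map_in_subtopology Pi_iff image_subset_iff continuous_on_diff)
    qed (use f in auto)
  qed
  have cont: "continuous_on UNIV \<phi>" and rng: "\<And>x. \<phi> x \<in> {0..1}"
    using \<phi>(1) by (simp_all add: continuous_map_in_subtopology image_subset_iff Pi_iff)
  have "closure {x. \<phi> x \<noteq> 0} \<subseteq> L"
    using \<phi>(3) W by (intro closure_minimal) auto
  then have "compact (closure {x. \<phi> x \<noteq> 0})"
    by (rule compact_closed_subset[OF W(2) closed_closure])
  then have "\<phi> \<in> bump U"
    using cont rng \<phi>(3) unfolding bump_def by (simp add: image_subset_iff)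
  then show thesis by (rule that) (use \<phi>(2) in auto)
qed

definition radon :: "'h::t2_space measure \<Rightarrow> bool" where
  "radon M \<longleftrightarrow> sets M = sets borel \<and>
     (\<forall>K. compact K \<longrightarrow> emeasure M K < \<infinity>) \<and>
     (\<forall>A\<in>sets borel. emeasure M A = (INF U\<in>{U. open U \<and> A \<subseteq> U}. emeasure M U)) \<and>
     (\<forall>U. open U \<longrightarrow> emeasure M U = (SUP K\<in>{K. compact K \<and> K \<subseteq> U}. emeasure M K))"

lemma radon_sets: "radon M \<Longrightarrow> sets M = sets borel"
  by (simp add: radon_def)

lemma radon_compact_finite: "radon M \<Longrightarrow> compact K \<Longrightarrow> emeasure M K < \<infinity>"
  unfolding radon_def by (elim conjE) simp

lemma radon_space: "radon M \<Longrightarrow> space M = UNIV"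
  by (metis radon_sets sets_eq_imp_space_eq space_borel)

lemma directed_finite_upper:
  assumes "finite J" "J \<subseteq> I" "I \<noteq> {}"
    and dir: "\<And>i j. i \<in> I \<Longrightarrow> j \<in> I \<Longrightarrow> \<exists>k\<in>I. U i \<union> U j \<subseteq> U k"
  shows "\<exists>k\<in>I. (\<Union>j\<in>J. U j) \<subseteq> U k"
  using assms(1,2)
proof (induction J rule: finite_induct)
  case empty
  then show ?case using \<open>I \<noteq> {}\<close> by auto
next
  case (insert j J)
  then obtain k where k: "k \<in> I" "(\<Union>j\<in>J. U j) \<subseteq> U k" by auto
  obtain l where "l \<in> I" "U j \<union> U k \<subseteq> U l" using dir[of j k] insert k by auto
  then show ?case using k by (intro bexI[of _ l]) auto
qed

text \<open>Inner regularity makes a Radon measure continuous along directed families of open sets of any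
  cardinality, since a compact subset of the union lies in one member of the family.\<close>

lemma radon_directed_Union:
  assumes M: "radon M" and I: "I \<noteq> {}" and op: "\<And>i. i \<in> I \<Longrightarrow> open (U i)"
    and dir: "\<And>i j. i \<in> I \<Longrightarrow> j \<in> I \<Longrightarrow> \<exists>k\<in>I. U i \<union> U j \<subseteq> U k"
  shows "emeasure M (\<Union>i\<in>I. U i) = (SUP i\<in>I. emeasure M (U i))"
proof (rule antisym)
  have ou: "open (\<Union>i\<in>I. U i)" using op by auto
  have "emeasure M (\<Union>i\<in>I. U i) = (SUP K\<in>{K. compact K \<and> K \<subseteq> (\<Union>i\<in>I. U i)}. emeasure M K)"
    using M ou unfolding radon_def by blast
  also have "\<dots> \<le> (SUP i\<in>I. emeasure M (U i))"
  proof (rule SUP_least)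
    fix K assume K: "K \<in> {K. compact K \<and> K \<subseteq> (\<Union>i\<in>I. U i)}"
    then obtain J where J: "J \<subseteq> I" "finite J" "K \<subseteq> (\<Union>j\<in>J. U j)"
      using compactE_image[of K I U] op by auto
    obtain k where k: "k \<in> I" "(\<Union>j\<in>J. U j) \<subseteq> U k"
      using directed_finite_upper[OF J(2,1) I dir] by auto
    have "emeasure M K \<le> emeasure M (U k)"
      using J k op radon_sets[OF M] by (intro emeasure_mono) auto
    also have "\<dots> \<le> (SUP i\<in>I. emeasure M (U i))" using k by (intro SUP_upper)
    finally show "emeasure M K \<le> (SUP i\<in>I. emeasure M (U i))" .
  qed
  finally show "emeasure M (\<Union>i\<in>I. U i) \<le> (SUP i\<in>I. emeasure M (U i))" .
  show "(SUP i\<in>I. emeasure M (U i)) \<le> emeasure M (\<Union>i\<in>I. U i)"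
    using ou radon_sets[OF M] by (intro SUP_least emeasure_mono) auto
qed

text \<open>The approximation of \<open>s\<close> from below by the strict superlevel sets \<open>{s > i / 2\<^sup>n}\<close>. The standard
  dyadic approximation uses the sets \<open>{s \<ge> i / 2\<^sup>n}\<close>, which are not open for lower semicontinuous \<open>s\<close>.\<close>

definition staircase :: "nat \<Rightarrow> ('a \<Rightarrow> ennreal) \<Rightarrow> 'a \<Rightarrow> ennreal" where
  "staircase n s x = (\<Sum>i\<in>{1..n*2^n}. ennreal (1/2^n) * indicator {x. ennreal (real i/2^n) < s x} x)"

lemma staircase_card:
  "staircase n s x = ennreal (real (card {i\<in>{1..n*2^n}. ennreal (real i/2^n) < s x}) / 2^n)"
proof -
  have "staircase n s x = (\<Sum>i\<in>{i\<in>{1..n*2^n}. ennreal (real i/2^n) < s x}. ennreal (1/2^n))"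
    unfolding staircase_def by (rule sum.mono_neutral_cong_right) (auto simp: indicator_def)
  also have "\<dots> = of_nat (card {i\<in>{1..n*2^n}. ennreal (real i/2^n) < s x}) * ennreal (1/2^n)" by simp
  also have "\<dots> = ennreal (real (card {i\<in>{1..n*2^n}. ennreal (real i/2^n) < s x}) / 2^n)"
    by (simp add: ennreal_of_nat_eq_real_of_nat ennreal_mult[symmetric])
  finally show ?thesis .
qed

lemma staircase_le: "staircase n s x \<le> s x"
proof (cases "{i\<in>{1..n*2^n}. ennreal (real i/2^n) < s x} = {}")
  case True
  show ?thesis unfolding staircase_card True by simp
next
  case False
  define B where "B = {i\<in>{1..n*2^n}. ennreal (real i/2^n) < s x}"
  have B: "finite B" "B \<noteq> {}" using False by (auto simp: B_def)
  have "B \<subseteq> {1..Max B}" using B by (auto simp: B_def)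
  then have "card B \<le> Max B" using card_mono[of "{1..Max B}" B] by simp
  then have "ennreal (real (card B) / 2^n) \<le> ennreal (real (Max B) / 2^n)"
    by (intro ennreal_leI divide_right_mono) auto
  also have "\<dots> < s x" using Max_in[OF B] by (auto simp: B_def)
  finally show ?thesis unfolding staircase_card B_def by simp
qed

lemma staircase_eventually_ge:
  assumes "a < s x"
  shows "eventually (\<lambda>n. a \<le> staircase n s x) sequentially"
proof -
  obtain c where c: "a = ennreal c" "c \<ge> 0" using assms by (cases a) auto
  obtain b where b: "a < b" "b < s x" using assms dense by blast
  then obtain d where d: "b = ennreal d" "d \<ge> 0" by (cases b) auto
  have cd: "c < d" using b c d by (simp add: ennreal_less_iff)
  have "(\<lambda>n. (1/2)^n :: real) \<longlonglongrightarrow> 0" by (rule LIMSEQ_realpow_zero) auto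
  then have "eventually (\<lambda>n. (1/2)^n < d - c) sequentially"
    by (rule order_tendstoD) (use cd in simp)
  moreover have "eventually (\<lambda>n. n \<ge> nat \<lceil>c\<rceil> + 1) sequentially" by (rule eventually_ge_at_top)
  ultimately show ?thesis
  proof eventually_elim
    case (elim n)
    define j where "j = nat \<lfloor>2^n * c\<rfloor> + 1"
    have j1: "real j \<le> 2^n * c + 1" "2^n * c \<le> real j" using c by (auto simp: j_def) linarith+
    have "real n \<ge> c + 1" using elim(2) c by linarith
    then have "2^n * (c + 1) \<le> 2^n * real n" by (intro mult_left_mono) auto
    moreover have "(1::real) \<le> 2^n" by simp
    ultimately have "2^n * c + 1 \<le> 2^n * real n" unfolding distrib_left by linarith
    then have "real j \<le> real (n * 2^n)" using j1 by (simp add: mult.commute)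
    then have jn: "j \<le> n * 2^n" by (simp only: of_nat_le_iff)
    have "{1..j} \<subseteq> {i\<in>{1..n*2^n}. ennreal (real i/2^n) < s x}"
    proof clarsimp
      fix i assume i: "Suc 0 \<le> i" "i \<le> j"
      have "real i / 2^n \<le> real j / 2^n" using i by (simp add: divide_right_mono)
      also have "\<dots> \<le> c + (1/2)^n" using j1 by (simp add: field_simps power_one_over)
      also have "\<dots> < d" using elim by simp
      finally have "ennreal (real i / 2^n) < b" using d by (simp add: ennreal_less_iff)
      then show "i \<le> n * 2^n \<and> ennreal (real i / 2^n) < s x" using b i jn by auto
    qed
    then have "card {1..j} \<le> card {i\<in>{1..n*2^n}. ennreal (real i/2^n) < s x}"
      by (rule card_mono[rotated]) simp
    then have "j \<le> card {i\<in>{1..n*2^n}. ennreal (real i/2^n) < s x}" by simp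
    then have "2^n * c \<le> real (card {i\<in>{1..n*2^n}. ennreal (real i/2^n) < s x})" using j1 by linarith
    then show "a \<le> staircase n s x"
      unfolding staircase_card c by (intro ennreal_leI) (simp add: field_simps)
  qed
qed

lemma SUP_sum_directed_ennreal:
  fixes f :: "'k \<Rightarrow> 'i \<Rightarrow> ennreal"
  assumes "finite N" and I: "I \<noteq> {}"
    and dir: "\<And>i j. i \<in> I \<Longrightarrow> j \<in> I \<Longrightarrow> \<exists>k\<in>I. \<forall>n. f n i \<le> f n k \<and> f n j \<le> f n k"
  shows "(\<Sum>n\<in>N. SUP i\<in>I. f n i) = (SUP i\<in>I. \<Sum>n\<in>N. f n i)"
  using \<open>finite N\<close>
proof (induction N rule: finite_induct)
  case empty
  then show ?case using I by simp
next
  case (insert n N)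
  have "(SUP i\<in>I. f n i + (\<Sum>m\<in>N. f m i)) = (SUP i\<in>I. f n i) + (SUP i\<in>I. \<Sum>m\<in>N. f m i)"
  proof (rule SUP_add_directed_ennreal)
    fix i j assume "i \<in> I" "j \<in> I"
    then obtain k where "k \<in> I" "\<forall>n. f n i \<le> f n k \<and> f n j \<le> f n k" using dir by blast
    then show "\<exists>k\<in>I. f n i + (\<Sum>m\<in>N. f m j) \<le> f n k + (\<Sum>m\<in>N. f m k)"
      by (intro bexI[of _ k] add_mono sum_mono) auto
  qed
  then show ?case using insert by simp
qed

text \<open>Monotone convergence for directed families of lower semicontinuous functions. The superlevel sets
  of the supremum are directed unions of open sets, so the claim holds for each staircase by the previous
  continuity on open sets, and the staircases of the supremum recover its integral by Fatou's lemma.\<close>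

lemma radon_nn_integral_directed_SUP:
  fixes f :: "'i \<Rightarrow> 'h::t2_space \<Rightarrow> ennreal"
  assumes M: "radon M" and I: "I \<noteq> {}"
    and lsc: "\<And>i t. i \<in> I \<Longrightarrow> open {x. t < f i x}"
    and dir: "\<And>i j. i \<in> I \<Longrightarrow> j \<in> I \<Longrightarrow> \<exists>k\<in>I. \<forall>x. f i x \<le> f k x \<and> f j x \<le> f k x"
  shows "(\<integral>\<^sup>+x. (SUP i\<in>I. f i x) \<partial>M) = (SUP i\<in>I. \<integral>\<^sup>+x. f i x \<partial>M)"
proof (rule antisym)
  define s where "s = (\<lambda>x. SUP i\<in>I. f i x)"
  have level: "{x. t < s x} = (\<Union>i\<in>I. {x. t < f i x})" for t
    by (auto simp: s_def less_SUP_iff)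
  have opens: "open {x. t < s x}" for t unfolding level using lsc by auto
  note S = radon_sets[OF M]
  have int_stair: "(\<integral>\<^sup>+x. staircase n g x \<partial>M)
      = (\<Sum>k\<in>{1..n*2^n}. ennreal (1/2^n) * emeasure M {x. ennreal (real k/2^n) < g x})"
    if "\<And>t. open {x. t < g x}" for g n
    unfolding staircase_def using that S
    by (subst nn_integral_sum) (auto intro!: sum.cong nn_integral_cmult_indicator borel_measurable_times_ennreal
        borel_measurable_indicator simp: S)
  have meas: "staircase n s \<in> borel_measurable M" for n
    unfolding staircase_def[abs_def] using opens
    by (intro borel_measurable_sum borel_measurable_times_ennreal borel_measurable_indicator) (auto simp: S)
  have bound: "(\<integral>\<^sup>+x. staircase n s x \<partial>M) \<le> (SUP i\<in>I. \<integral>\<^sup>+x. f i x \<partial>M)" for n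
  proof -
    have dirU: "\<exists>k\<in>I. {x. t < f i x} \<union> {x. t < f j x} \<subseteq> {x. t < f k x}" if ij: "i \<in> I" "j \<in> I" for i j t
    proof -
      obtain k where "k \<in> I" "\<forall>x. f i x \<le> f k x \<and> f j x \<le> f k x" using dir[OF ij] by blast
      then show ?thesis by (intro bexI[of _ k]) (auto intro: less_le_trans)
    qed
    have "(\<integral>\<^sup>+x. staircase n s x \<partial>M) =
        (\<Sum>k\<in>{1..n*2^n}. ennreal (1/2^n) * (SUP i\<in>I. emeasure M {x. ennreal (real k/2^n) < f i x}))"
      unfolding int_stair[OF opens] level
      by (intro sum.cong refl arg_cong2[where f="(*)"] radon_directed_Union[OF M I lsc dirU])
    also have "\<dots> = (\<Sum>k\<in>{1..n*2^n}. SUP i\<in>I. ennreal (1/2^n) * emeasure M {x. ennreal (real k/2^n) < f i x})"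
      by (simp add: SUP_mult_left_ennreal)
    also have "\<dots> = (SUP i\<in>I. \<Sum>k\<in>{1..n*2^n}. ennreal (1/2^n) * emeasure M {x. ennreal (real k/2^n) < f i x})"
    proof (rule SUP_sum_directed_ennreal[OF _ I])
      fix i j assume ij: "i \<in> I" "j \<in> I"
      then obtain l where l: "l \<in> I" "\<forall>x. f i x \<le> f l x \<and> f j x \<le> f l x" using dir by blast
      have "emeasure M {x. t < f i x} \<le> emeasure M {x. t < f l x}" "emeasure M {x. t < f j x} \<le> emeasure M {x. t < f l x}" for t
        using l lsc[OF l(1)] S by (auto intro!: emeasure_mono intro: less_le_trans)
      then show "\<exists>l\<in>I. \<forall>k. ennreal (1/2^n) * emeasure M {x. ennreal (real k/2^n) < f i x}
          \<le> ennreal (1/2^n) * emeasure M {x. ennreal (real k/2^n) < f l x} \<and>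
          ennreal (1/2^n) * emeasure M {x. ennreal (real k/2^n) < f j x}
          \<le> ennreal (1/2^n) * emeasure M {x. ennreal (real k/2^n) < f l x}"
        using l by (intro bexI[of _ l] allI conjI mult_left_mono) auto
    qed simp
    also have "\<dots> \<le> (SUP i\<in>I. \<integral>\<^sup>+x. f i x \<partial>M)"
    proof (rule SUP_mono, rule bexI)
      fix i assume i: "i \<in> I"
      show "(\<Sum>k\<in>{1..n*2^n}. ennreal (1/2^n) * emeasure M {x. ennreal (real k/2^n) < f i x}) \<le> (\<integral>\<^sup>+x. f i x \<partial>M)"
        unfolding int_stair[OF lsc[OF i], symmetric] by (intro nn_integral_mono staircase_le)
    qed
    finally show ?thesis .
  qed
  have "(\<integral>\<^sup>+x. s x \<partial>M) \<le> (\<integral>\<^sup>+x. liminf (\<lambda>n. staircase n s x) \<partial>M)"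
  proof (rule nn_integral_mono, rule ccontr)
    fix x assume "\<not> s x \<le> liminf (\<lambda>n. staircase n s x)"
    then have "liminf (\<lambda>n. staircase n s x) < s x" by simp
    then obtain a where a: "liminf (\<lambda>n. staircase n s x) < a" "a < s x" using dense by blast
    have "a \<le> liminf (\<lambda>n. staircase n s x)"
      by (rule Liminf_bounded, rule staircase_eventually_ge, rule a(2))
    with a show False by simp
  qed
  also have "\<dots> \<le> liminf (\<lambda>n. \<integral>\<^sup>+x. staircase n s x \<partial>M)"
    by (rule nn_integral_liminf) (rule meas)
  also have "\<dots> \<le> (SUP i\<in>I. \<integral>\<^sup>+x. f i x \<partial>M)"
    by (rule Liminf_le) (auto simp: bound)
  finally show "(\<integral>\<^sup>+x. (SUP i\<in>I. f i x) \<partial>M) \<le> (SUP i\<in>I. \<integral>\<^sup>+x. f i x \<partial>M)" by (simp add: s_def)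
  show "(SUP i\<in>I. \<integral>\<^sup>+x. f i x \<partial>M) \<le> (\<integral>\<^sup>+x. (SUP i\<in>I. f i x) \<partial>M)"
    by (intro SUP_least nn_integral_mono SUP_upper)
qed

lemma radon_outer_approx:
  assumes M: "radon M" and A: "A \<in> sets borel" "emeasure M A < \<infinity>" and d: "d > 0"
  obtains U where "open U" "A \<subseteq> U" "emeasure M U \<le> emeasure M A + ennreal d"
proof -
  have "(INF U\<in>{U. open U \<and> A \<subseteq> U}. emeasure M U) < emeasure M A + ennreal d"
    using M A d ennreal_add_left_cancel_less[of "emeasure M A" 0 "ennreal d"] unfolding radon_def
    by (metis (lifting) add.right_neutral ennreal_less_zero_iff infinity_ennreal_def top.not_eq_extremum)
  then obtain U where "open U" "A \<subseteq> U" "emeasure M U < emeasure M A + ennreal d"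
    unfolding INF_less_iff by auto
  then show thesis using that less_imp_le by blast
qed

text \<open>Outer regularity, in the form of a lower semicontinuous majorant of comparable integral: cut \<open>w\<close>
  into the layers \<open>2\<^sup>k < w \<le> 2\<^sup>k\<^sup>+\<^sup>1\<close> for integers \<open>k\<close> and enlarge each layer to an open set of nearly the
  same measure. The layers lose a factor \<open>2\<close> and the enlargements add at most \<open>2\<close>.\<close>

lemma radon_open_majorant:
  fixes w :: "'h::t2_space \<Rightarrow> real"
  assumes M: "radon M" and w: "w \<in> borel_measurable borel" "\<And>x. w x \<ge> 0"
    and fin: "(\<integral>\<^sup>+x. ennreal (w x) \<partial>M) < \<infinity>"
  obtains c :: "nat \<Rightarrow> real" and U where "\<And>n. open (U n)" "\<And>n. c n \<ge> 0"
    "\<And>x. ennreal (w x) \<le> (\<Sum>n. ennreal (c n) * indicator (U n) x)"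
    "(\<Sum>n. ennreal (c n) * emeasure M (U n)) \<le> 2 * (\<integral>\<^sup>+x. ennreal (w x) \<partial>M) + 2"
proof -
  \<comment> \<open>The layer with index \<open>n\<close> belongs to the integer \<open>k = int_decode n\<close>; \<open>c n\<close> is its upper edge.\<close>
  define c :: "nat \<Rightarrow> real" where "c n = 2 powi (int_decode n + 1)" for n
  define A where "A n = {x. c n / 2 < w x \<and> w x \<le> c n}" for n
  have c: "c n > 0" for n by (simp add: c_def)
  have S: "sets M = sets borel" by (rule radon_sets[OF M])
  have A: "A n \<in> sets borel" for n
    using w(1) unfolding A_def by measurable
  have cA: "ennreal (c n) * indicator (A n) x \<le> 2 * ennreal (w x)" for n x
    using c[of n] by (auto simp: A_def indicator_def ennreal_mult[symmetric] ennreal_numeral[symmetric] simp del: ennreal_numeral intro!: ennreal_leI)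
  have cAM: "ennreal (c n) * emeasure M (A n) \<le> 2 * (\<integral>\<^sup>+x. ennreal (w x) \<partial>M)" for n
  proof -
    have "ennreal (c n) * emeasure M (A n) = (\<integral>\<^sup>+x. ennreal (c n) * indicator (A n) x \<partial>M)"
      using A by (subst nn_integral_cmult_indicator) (auto simp: S)
    also have "\<dots> \<le> (\<integral>\<^sup>+x. 2 * ennreal (w x) \<partial>M)" by (intro nn_integral_mono cA)
    also have "\<dots> = 2 * (\<integral>\<^sup>+x. ennreal (w x) \<partial>M)"
      using w(1) by (intro nn_integral_cmult) (simp add: S measurable_cong_sets[OF S refl])
    finally show ?thesis .
  qed
  have Afin: "emeasure M (A n) < \<infinity>" for n
    using cAM[of n] c[of n] fin
    by (metis ennreal_eq_0_iff ennreal_mult_eq_top_iff ennreal_mult_less_top infinity_ennreal_def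
        ennreal_numeral_less_top linorder_not_le top.extremum_uniqueI top.not_eq_extremum)
  have "\<exists>U. open U \<and> A n \<subseteq> U \<and> emeasure M U \<le> emeasure M (A n) + ennreal ((1/2)^n / c n)" for n
    by (rule radon_outer_approx[OF M A Afin, of "(1/2)^n / c n"]) (use c in auto)
  then obtain U where U: "\<And>n. open (U n)" "\<And>n. A n \<subseteq> U n"
    "\<And>n. emeasure M (U n) \<le> emeasure M (A n) + ennreal ((1/2)^n / c n)" by metis
  have disj: "disjoint_family A"
    unfolding disjoint_family_on_def
  proof (intro ballI impI)
    fix i j :: nat assume ij: "i \<noteq> j"
    have aux: "A i \<inter> A j = {}" if "int_decode i < int_decode j" for i j
    proof -
      have "c i \<le> c j / 2"
      proof -
        have "c j / 2 = 2 powi int_decode j" by (simp add: c_def power_int_add)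
        moreover have "int_decode i + 1 \<le> int_decode j" using that by simp
        ultimately show ?thesis unfolding c_def by (metis power_int_increasing one_le_numeral)
      qed
      then show ?thesis by (auto simp: A_def)
    qed
    have "int_decode i \<noteq> int_decode j" using ij by (simp add: int_decode_eq)
    then show "A i \<inter> A j = {}" using aux[of i j] aux[of j i] by (metis Int_commute linorder_neqE)
  qed
  have cover: "\<exists>n. x \<in> A n" if x: "w x > 0" for x
  proof -
    define k where "k = \<lceil>log 2 (w x)\<rceil> - 1"
    have k: "real_of_int k < log 2 (w x)" "log 2 (w x) \<le> real_of_int (k + 1)" by (simp_all add: k_def) linarith+
    have "2 powr real_of_int k < w x" using k(1) x by (simp add: less_log_iff)
    moreover have "w x \<le> 2 powr real_of_int (k+1)" using k(2) x by (simp only: log_le_iff)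
    ultimately have "x \<in> A (int_encode k)"
      by (simp add: A_def c_def powr_real_of_int' power_int_add powr_add)
    then show ?thesis ..
  qed
  show thesis
  proof (rule that[of U c])
    show "open (U n)" "c n \<ge> 0" for n using U c[of n] by auto
    show "ennreal (w x) \<le> (\<Sum>n. ennreal (c n) * indicator (U n) x)" for x
    proof (cases "w x > 0")
      case True
      then obtain n where n: "x \<in> A n" using cover by blast
      define g :: "nat \<Rightarrow> ennreal" where "g k = ennreal (c k) * indicator (U k) x" for k
      have "ennreal (w x) \<le> g n"
        using n U(2)[of n] by (auto simp: A_def g_def intro!: ennreal_leI)
      also have "\<dots> = (\<Sum>k\<in>{n}. g k)" by simp
      also have "\<dots> \<le> (\<Sum>k. g k)" by (intro sum_le_suminf) auto
      finally show ?thesis by (simp add: g_def)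
    next
      case False
      then show ?thesis by (simp add: ennreal_neg)
    qed
    have "(\<Sum>n. ennreal (c n) * emeasure M (U n)) \<le> (\<Sum>n. ennreal (c n) * emeasure M (A n) + ennreal ((1/2)^n))"
    proof (rule suminf_le)
      fix n
      have "ennreal (c n) * emeasure M (U n) \<le> ennreal (c n) * (emeasure M (A n) + ennreal ((1/2)^n / c n))"
        by (intro mult_left_mono U) auto
      also have "\<dots> = ennreal (c n) * emeasure M (A n) + ennreal ((1/2)^n)"
        using c[of n] by (simp add: distrib_left ennreal_mult[symmetric])
      finally show "ennreal (c n) * emeasure M (U n) \<le> ennreal (c n) * emeasure M (A n) + ennreal ((1/2)^n)" .
    qed auto
    also have "\<dots> = (\<Sum>n. ennreal (c n) * emeasure M (A n)) + (\<Sum>n. ennreal ((1/2)^n))"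
      by (rule suminf_add[symmetric]) auto
    also have "(\<Sum>n. ennreal ((1/2)^n)) = ennreal (\<Sum>n. (1/2)^n)"
      by (intro suminf_ennreal2) (auto intro: summable_geometric)
    also have "\<dots> = 2" by (subst suminf_geometric) auto
    also have "(\<Sum>n. ennreal (c n) * emeasure M (A n)) = (\<integral>\<^sup>+x. (\<Sum>n. ennreal (c n) * indicator (A n) x) \<partial>M)"
      using A by (subst nn_integral_suminf) (auto simp: S nn_integral_cmult_indicator intro!: borel_measurable_times_ennreal borel_measurable_indicator)
    also have "\<dots> \<le> (\<integral>\<^sup>+x. 2 * ennreal (w x) \<partial>M)"
    proof (rule nn_integral_mono)
      fix x
      show "(\<Sum>n. ennreal (c n) * indicator (A n) x) \<le> 2 * ennreal (w x)"
      proof (cases "\<exists>n. x \<in> A n")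
        case True
        then obtain n where n: "x \<in> A n" by blast
        have "(\<Sum>n. ennreal (c n) * indicator (A n) x) = ennreal (c n)"
          by (rule suminf_cmult_indicator[OF disj n])
        also have "\<dots> \<le> 2 * ennreal (w x)" using cA[of n x] n by simp
        finally show ?thesis .
      qed simp
    qed
    also have "\<dots> = 2 * (\<integral>\<^sup>+x. ennreal (w x) \<partial>M)"
      using w(1) by (intro nn_integral_cmult) (simp add: S measurable_cong_sets[OF S refl])
    finally show "(\<Sum>n. ennreal (c n) * emeasure M (U n)) \<le> 2 * (\<integral>\<^sup>+x. ennreal (w x) \<partial>M) + 2"
      by (simp add: add_mono)
  qed
qed

text \<open>By compactness of \<open>K\<close>, the functions \<open>F (x, \<cdot>)\<close> depend on \<open>x\<close> continuously in the uniform norm on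
  \<open>K\<close>.\<close>

lemma radon_continuous_parameter_integral:
  fixes F :: "'a::topological_space \<times> 'h::t2_space \<Rightarrow> complex" and g :: "'h \<Rightarrow> complex"
  assumes M: "sets M = sets borel" and F: "continuous_on UNIV F" and K: "compact K"
    and g: "integrable M g" "\<And>y. y \<notin> K \<Longrightarrow> g y = 0"
  shows "continuous_on UNIV (\<lambda>x. \<integral>y. g y * F (x, y) \<partial>M)"
    and "integrable M (\<lambda>y. g y * F (x, y))"
proof -
  have contx: "continuous_on UNIV (\<lambda>y. F (x, y))" for x
    by (rule continuous_on_compose2[OF F]) (auto intro!: continuous_intros)
  have Fm: "(\<lambda>y. F (x, y)) \<in> borel_measurable M" for x
    unfolding measurable_cong_sets[OF M refl] by (rule borel_measurable_continuous_onI[OF contx])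
  have int: "integrable M (\<lambda>y. g y * F (x, y))" for x
  proof -
    have "compact ((\<lambda>y. F (x, y)) ` K)"
      by (rule compact_continuous_image[OF continuous_on_subset[OF contx] K]) auto
    then obtain B where B: "\<And>y. y \<in> K \<Longrightarrow> norm (F (x, y)) \<le> B"
      by (metis compact_imp_bounded bounded_iff imageI)
    show ?thesis
    proof (rule Bochner_Integration.integrable_bound)
      show "integrable M (\<lambda>y. of_real B * g y)" using g(1) by simp
      show "AE y in M. norm (g y * F (x, y)) \<le> norm (of_real B * g y)"
      proof (rule AE_I2)
        fix y
        show "norm (g y * F (x, y)) \<le> norm (of_real B * g y)"
        proof (cases "y \<in> K")
          case True
          have "norm (g y) * norm (F (x, y)) \<le> norm (g y) * \<bar>B\<bar>"
            using B[OF True] by (intro mult_left_mono) auto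
          then show ?thesis by (simp add: norm_mult mult.commute)
        qed (simp add: g(2))
      qed
    qed (intro borel_measurable_times Fm borel_measurable_integrable g)
  qed
  then show "integrable M (\<lambda>y. g y * F (x, y))" .
  show "continuous_on UNIV (\<lambda>x. \<integral>y. g y * F (x, y) \<partial>M)"
    unfolding continuous_on_def
  proof
    fix x0
    define G where "G = (\<integral>y. norm (g y) \<partial>M)"
    have G: "G \<ge> 0" by (simp add: G_def)
    show "((\<lambda>x. \<integral>y. g y * F (x, y) \<partial>M) \<longlongrightarrow> (\<integral>y. g y * F (x0, y) \<partial>M)) (at x0 within UNIV)"
    proof (rule tendstoI)
      fix e :: real assume e: "e > 0"
      define d where "d = e / (G + 1)"
      have d: "d > 0" using e G by (simp add: d_def)
      obtain X0 where X0: "x0 \<in> X0" "open X0" "\<forall>x\<in>X0 \<inter> UNIV. \<forall>t\<in>K. dist (F (x, t)) (F (x0, t)) \<le> d"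
        by (rule continuous_on_prod_compactE[OF continuous_on_subset[OF F] K _ d, of UNIV x0]) auto
      have "dist (\<integral>y. g y * F (x, y) \<partial>M) (\<integral>y. g y * F (x0, y) \<partial>M) < e" if x: "x \<in> X0" for x
      proof -
        have "dist (\<integral>y. g y * F (x, y) \<partial>M) (\<integral>y. g y * F (x0, y) \<partial>M) = norm (\<integral>y. g y * F (x, y) - g y * F (x0, y) \<partial>M)"
          by (simp add: dist_norm int)
        also have "\<dots> \<le> (\<integral>y. norm (g y * F (x, y) - g y * F (x0, y)) \<partial>M)" by (rule integral_norm_bound)
        also have "\<dots> \<le> (\<integral>y. d * norm (g y) \<partial>M)"
        proof (rule integral_mono)
          fix y
          show "norm (g y * F (x, y) - g y * F (x0, y)) \<le> d * norm (g y)"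
          proof (cases "y \<in> K")
            case True
            then have "norm (F (x, y) - F (x0, y)) \<le> d" using X0(3) x by (simp add: dist_norm)
            then show ?thesis
              by (metis mult.commute mult_left_mono norm_ge_zero norm_mult right_diff_distrib)
          qed (simp add: g(2))
        qed (use g(1) int in \<open>auto intro: integrable_norm\<close>)
        also have "\<dots> = d * G" by (simp add: G_def)
        also have "\<dots> < e" using e G by (simp add: d_def field_simps)
        finally show ?thesis .
      qed
      then show "\<forall>\<^sub>F x in at x0 within UNIV. dist (\<integral>y. g y * F (x, y) \<partial>M) (\<integral>y. g y * F (x0, y) \<partial>M) < e"
        using X0(1,2) eventually_at_topological by blast
    qed
  qed
qed

text \<open>A compact set is cut into finitely many Borel pieces, each contained in one of the given
  neighbourhoods; \<open>N x\<close> is the index of the piece of \<open>x\<close> and \<open>w i\<close> the centre of the \<open>i\<close>-th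
  neighbourhood.\<close>

lemma compact_step_map:
  fixes K :: "'h::t2_space set"
  assumes K: "compact K" and ne: "K \<noteq> {}" and V: "\<And>w. w \<in> K \<Longrightarrow> open (V w) \<and> w \<in> V w"
  obtains N :: "'h \<Rightarrow> nat" and w n where
    "N \<in> borel \<rightarrow>\<^sub>M count_space UNIV" "\<And>x. N x \<le> n" "\<And>i. w i \<in> K" "\<And>x. x \<in> K \<Longrightarrow> x \<in> V (w (N x))"
proof -
  obtain C where C: "C \<subseteq> K" "finite C" "K \<subseteq> (\<Union>c\<in>C. V c)"
    by (rule compactE_image[OF K, of K V]) (use V in auto)
  obtain xs where xs: "set xs = C" using finite_list[OF C(2)] by blast
  obtain k where k: "k \<in> K" using ne by blast
  define n where "n = length xs"
  define w where "w i = (if i < n then xs ! i else k)" for i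
  have wK: "w i \<in> K" for i using C xs k by (auto simp: w_def n_def)
  \<comment> \<open>Off the union of the neighbourhoods the index is the dummy value \<open>n\<close>, with centre \<open>k\<close>.\<close>
  define N where "N x = (LEAST i. x \<in> V (w i) \<or> i = n)" for x
  have N: "N \<in> borel \<rightarrow>\<^sub>M count_space UNIV"
    unfolding N_def[abs_def]
  proof (rule measurable_Least)
    fix i
    have "V (w i) \<in> sets borel" using V[OF wK] by auto
    then show "(\<lambda>x. x \<in> V (w i) \<or> i = n) \<in> borel \<rightarrow>\<^sub>M count_space UNIV" by measurable
  qed
  have Nn: "N x \<le> n" for x unfolding N_def by (rule Least_le) simp
  have NV: "x \<in> V (w (N x))" if x: "x \<in> K" for x
  proof -
    obtain c where "c \<in> C" "x \<in> V c" using C x by blast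
    then obtain i where i: "i < n" "x \<in> V (w i)" using xs by (metis in_set_conv_nth n_def w_def)
    have "N x \<le> i" unfolding N_def by (rule Least_le) (use i in simp)
    moreover have "x \<in> V (w (N x)) \<or> N x = n"
      unfolding N_def by (rule LeastI[of _ i]) (use i in simp)
    ultimately show ?thesis using i by auto
  qed
  show thesis by (rule that[OF N Nn wK NV])
qed

text \<open>The Borel sets of a product can be strictly more than the product of the Borel sets, so that
  continuous functions on a product space need not be measurable for the product. On a compact rectangle
  they are: there \<open>F\<close> is a uniform limit of functions that are constant in the first variable on finitely
  many Borel pieces.\<close>

lemma continuous_rectangle_measurable:
  fixes F :: "'h::t2_space \<times> 'k::t2_space \<Rightarrow> complex"
  assumes F: "continuous_on UNIV F" and Q: "compact Q" and K: "compact K"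
  shows "(\<lambda>p. indicator (Q \<times> K) p * F p) \<in> borel_measurable (borel \<Otimes>\<^sub>M borel)"
proof (cases "Q = {}")
  case False
  have "\<exists>T. T \<in> borel_measurable (borel \<Otimes>\<^sub>M borel) \<and> (\<forall>p. norm (T p - indicator (Q \<times> K) p * F p) \<le> 1 / real (Suc n))" for n
  proof -
    have "\<exists>X0. x0 \<in> X0 \<and> open X0 \<and> (\<forall>x\<in>X0. \<forall>t\<in>K. dist (F (x, t)) (F (x0, t)) \<le> 1 / real (Suc n))" for x0
      by (rule continuous_on_prod_compactE[OF continuous_on_subset[OF F] K, of UNIV x0 "1 / real (Suc n)"]) auto
    then obtain V where V: "\<And>x0. x0 \<in> V x0 \<and> open (V x0)"
      "\<And>x0 x t. x \<in> V x0 \<Longrightarrow> t \<in> K \<Longrightarrow> dist (F (x, t)) (F (x0, t)) \<le> 1 / real (Suc n)" by metis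
    obtain N :: "'h \<Rightarrow> nat" and w k where N: "N \<in> borel \<rightarrow>\<^sub>M count_space UNIV" "\<And>x. N x \<le> k" "\<And>i. w i \<in> Q"
      "\<And>x. x \<in> Q \<Longrightarrow> x \<in> V (w (N x))"
      by (rule compact_step_map[OF Q False, of V]) (use V in auto)
    define T where "T p = indicator (Q \<times> K) p * F (w (N (fst p)), snd p)" for p
    have meas: "T \<in> borel_measurable (borel \<Otimes>\<^sub>M borel)"
    proof -
      have "(\<lambda>p. F (w (N (fst p)), snd p)) \<in> borel_measurable (borel \<Otimes>\<^sub>M borel)"
      proof (rule measurable_compose_countable[where g = "\<lambda>p. N (fst p)" and f = "\<lambda>i p. F (w i, snd p)"])
        fix i
        have "continuous_on UNIV (\<lambda>y. F (w i, y))"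
          by (rule continuous_on_compose2[OF F]) (auto intro!: continuous_intros)
        then show "(\<lambda>p. F (w i, snd p)) \<in> borel_measurable (borel \<Otimes>\<^sub>M borel)"
          using borel_measurable_continuous_onI measurable_compose[OF measurable_snd] by blast
      qed (rule measurable_compose[OF measurable_fst N(1)])
      moreover have "Q \<times> K \<in> sets (borel \<Otimes>\<^sub>M borel)"
        using compact_imp_closed[OF Q] compact_imp_closed[OF K] by (intro pair_measureI) auto
      ultimately show ?thesis unfolding T_def[abs_def]
        by (intro borel_measurable_times borel_measurable_indicator)
    qed
    have "norm (T p - indicator (Q \<times> K) p * F p) \<le> 1 / real (Suc n)" for p
    proof (cases "p \<in> Q \<times> K")
      case True
      then obtain x y where p: "p = (x, y)" "x \<in> Q" "y \<in> K" by auto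
      show ?thesis using V(2)[OF N(4)[OF p(2)] p(3)] p by (simp add: T_def dist_norm norm_minus_commute)
    qed (simp add: T_def)
    with meas show ?thesis by blast
  qed
  then obtain T where T: "\<And>n. T n \<in> borel_measurable (borel \<Otimes>\<^sub>M borel)"
    "\<And>n p. norm (T n p - indicator (Q \<times> K) p * F p) \<le> 1 / real (Suc n)" by metis
  show ?thesis
  proof (rule borel_measurable_LIMSEQ_metric[where f = T])
    show "T n \<in> borel_measurable (borel \<Otimes>\<^sub>M borel)" for n by (rule T)
    show "(\<lambda>n. T n p) \<longlonglongrightarrow> indicator (Q \<times> K) p * F p" for p
    proof (rule LIM_zero_cancel, rule Lim_null_comparison)
      show "(\<lambda>n. 1 / real (Suc n)) \<longlonglongrightarrow> 0" using LIMSEQ_inverse_real_of_nat by (simp add: inverse_eq_divide)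
      show "\<forall>\<^sub>F n in sequentially. norm (T n p - indicator (Q \<times> K) p * F p) \<le> 1 / real (Suc n)" using T(2) by auto
    qed
  qed
qed simp

lemma radon_restrict_compact:
  fixes h :: "'h::t2_space \<Rightarrow> 'b::{banach, second_countable_topology}"
  assumes M: "radon M" and K: "compact K"
  shows "K \<in> sets M" and "sets (density M (indicator K)) = sets borel"
    and "finite_measure (density M (indicator K))"
    and "h \<in> borel_measurable M \<Longrightarrow> (\<And>x. x \<notin> K \<Longrightarrow> h x = 0) \<Longrightarrow>
      (\<integral>x. h x \<partial>density M (indicator K)) = (\<integral>x. h x \<partial>M)"
    and "integrable M h \<Longrightarrow> integrable (density M (indicator K)) h"
proof -
  note S = radon_sets[OF M]
  show Km: "K \<in> sets M" unfolding S by (rule borel_closed[OF compact_imp_closed[OF K]])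
  show "sets (density M (indicator K)) = sets borel" by (simp add: S)
  show "finite_measure (density M (indicator K))"
  proof (rule finite_measureI)
    have "emeasure (density M (indicator K)) (space M) = emeasure M (K \<inter> space M)"
      by (rule emeasure_restricted[OF Km]) simp
    also have "K \<inter> space M = K" using radon_space[OF M] by simp
    also have "emeasure M K < \<infinity>" by (rule radon_compact_finite[OF M K])
    finally show "emeasure (density M (indicator K)) (space (density M (indicator K))) \<noteq> \<infinity>" by simp
  qed
  have dens: "density M (indicator K) = density M (\<lambda>x. ennreal (indicator K x))"
    by (simp add: ennreal_indicator)
  show "(\<integral>x. h x \<partial>density M (indicator K)) = (\<integral>x. h x \<partial>M)"
    if "h \<in> borel_measurable M" and 0: "\<And>x. x \<notin> K \<Longrightarrow> h x = 0"
  proof -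
    have "(\<integral>x. h x \<partial>density M (indicator K)) = (\<integral>x. indicator K x *\<^sub>R h x \<partial>M)"
      unfolding dens using that(1) Km by (intro integral_density) auto
    also have "(\<lambda>x. indicator K x *\<^sub>R h x) = h" using 0 by (auto simp: indicator_def)
    finally show ?thesis .
  qed
  show "integrable (density M (indicator K)) h" if "integrable M h"
    unfolding dens using that Km integrable_mult_indicator[OF Km that]
    by (subst integrable_density) auto
qed

lemma fubini_compact:
  fixes F :: "'h::t2_space \<times> 'k::t2_space \<Rightarrow> complex" and f :: "'k \<Rightarrow> complex" and g :: "'h \<Rightarrow> complex"
  assumes M1: "radon M1" and M2: "radon M2"
    and F: "continuous_on UNIV F" and Q: "compact Q" and K: "compact K"
    and g: "integrable M1 g" "\<And>x. x \<notin> Q \<Longrightarrow> g x = 0"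
    and f: "integrable M2 f" "\<And>y. y \<notin> K \<Longrightarrow> f y = 0"
  shows "(\<integral>y. f y * (\<integral>x. g x * F (x, y) \<partial>M1) \<partial>M2) = (\<integral>x. g x * (\<integral>y. f y * F (x, y) \<partial>M2) \<partial>M1)"
proof -
  \<comment> \<open>Restricted to compact sets the measures are finite, so Fubini's theorem for product measures applies.\<close>
  define N1 where "N1 = density M1 (indicator Q)"
  define N2 where "N2 = density M2 (indicator K)"
  note r1 = radon_restrict_compact[OF M1 Q, folded N1_def] and r2 = radon_restrict_compact[OF M2 K, folded N2_def]
  note S1 = radon_sets[OF M1] and S2 = radon_sets[OF M2]
  interpret N1: finite_measure N1 by (rule r1)
  interpret N2: finite_measure N2 by (rule r2)
  interpret P: pair_sigma_finite N1 N2 ..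
  have P: "sets (N1 \<Otimes>\<^sub>M N2) = sets (borel \<Otimes>\<^sub>M borel)" by (rule sets_pair_measure_cong[OF r1(2) r2(2)])
  have Fswap: "continuous_on UNIV (\<lambda>p. F (snd p, fst p))"
    by (rule continuous_on_compose2[OF F]) (auto intro!: continuous_intros)
  note c1 = radon_continuous_parameter_integral[OF S1 Fswap Q g, simplified]
  note c2 = radon_continuous_parameter_integral[OF S2 F K f]
  define h where "h x y = g x * (f y * F (x, y))" for x y
  have h0: "h x y = g x * f y * (indicator (Q \<times> K) (x, y) * F (x, y))" for x y
    using g(2) f(2) by (auto simp: h_def indicator_def)
  have meas: "case_prod h \<in> borel_measurable (N1 \<Otimes>\<^sub>M N2)"
  proof -
    have gm: "g \<in> borel_measurable borel" and fm: "f \<in> borel_measurable borel"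
      using borel_measurable_integrable[OF g(1)] borel_measurable_integrable[OF f(1)]
      by (simp_all add: measurable_cong_sets[OF S1 refl] measurable_cong_sets[OF S2 refl])
    have "(\<lambda>p. g (fst p) * f (snd p) * (indicator (Q \<times> K) p * F p)) \<in> borel_measurable (borel \<Otimes>\<^sub>M borel)"
      by (intro borel_measurable_times continuous_rectangle_measurable[OF F Q K]
          measurable_compose[OF measurable_fst gm] measurable_compose[OF measurable_snd fm])
    then show ?thesis
      unfolding measurable_cong_sets[OF P refl] by (simp add: case_prod_beta' h0)
  qed
  have "compact (F ` (Q \<times> K))"
    by (intro compact_continuous_image continuous_on_subset[OF F] compact_Times Q K) auto
  then obtain B where "\<forall>z\<in>F ` (Q \<times> K). norm z \<le> B" using compact_imp_bounded bounded_iff by blast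
  then have B: "norm (F (x, y)) \<le> \<bar>B\<bar>" if "x \<in> Q" "y \<in> K" for x y using that by fastforce
  have bnd: "norm (h x y) \<le> \<bar>B\<bar> * norm (g x) * norm (f y)" for x y
  proof (cases "x \<in> Q \<and> y \<in> K")
    case True
    then have "norm (g x) * norm (f y) * norm (F (x, y)) \<le> norm (g x) * norm (f y) * \<bar>B\<bar>"
      using B by (intro mult_left_mono) auto
    then show ?thesis by (simp add: h_def norm_mult mult_ac)
  qed (auto simp: h_def g f)
  have hy: "integrable N2 (h x)" for x
    unfolding h_def[abs_def] by (intro integrable_mult_right r2(5) c2)
  have "integrable (N1 \<Otimes>\<^sub>M N2) (case_prod h)"
  proof (rule P.Fubini_integrable[OF meas])
    show "integrable N1 (\<lambda>x. \<integral>y. norm (case_prod h (x, y)) \<partial>N2)"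
    proof (rule Bochner_Integration.integrable_bound)
      show "integrable N1 (\<lambda>x. (\<bar>B\<bar> * (\<integral>y. norm (f y) \<partial>N2)) * norm (g x))"
        by (intro integrable_mult_right integrable_norm r1(5) g)
      show "(\<lambda>x. \<integral>y. norm (case_prod h (x, y)) \<partial>N2) \<in> borel_measurable N1"
        using meas by (intro N2.borel_measurable_lebesgue_integral) (simp add: case_prod_beta')
      show "AE x in N1. norm (\<integral>y. norm (case_prod h (x, y)) \<partial>N2) \<le> norm ((\<bar>B\<bar> * (\<integral>y. norm (f y) \<partial>N2)) * norm (g x))"
      proof (rule AE_I2)
        fix x
        have "(\<integral>y. norm (h x y) \<partial>N2) \<le> (\<integral>y. \<bar>B\<bar> * norm (g x) * norm (f y) \<partial>N2)"
          by (intro integral_mono integrable_norm integrable_mult_right r2(5) f(1) hy bnd)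
        then show "norm (\<integral>y. norm (case_prod h (x, y)) \<partial>N2) \<le> norm ((\<bar>B\<bar> * (\<integral>y. norm (f y) \<partial>N2)) * norm (g x))"
          by (simp add: abs_mult mult_ac)
      qed
    qed
  qed (use hy in simp)
  from P.Fubini_integral[OF this]
  have eq: "(\<integral>y. (\<integral>x. h x y \<partial>N1) \<partial>N2) = (\<integral>x. (\<integral>y. h x y \<partial>N2) \<partial>N1)" .
  have "(\<integral>y. (\<integral>x. h x y \<partial>N1) \<partial>N2) = (\<integral>y. f y * (\<integral>x. g x * F (x, y) \<partial>M1) \<partial>N2)"
  proof (rule Bochner_Integration.integral_cong[OF refl])
    fix y
    have "(\<integral>x. h x y \<partial>N1) = (\<integral>x. f y * (g x * F (x, y)) \<partial>N1)" by (simp add: h_def mult_ac)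
    also have "\<dots> = f y * (\<integral>x. g x * F (x, y) \<partial>N1)" by simp
    also have "(\<integral>x. g x * F (x, y) \<partial>N1) = (\<integral>x. g x * F (x, y) \<partial>M1)"
      using c1(2) g(2) by (intro r1(4)) auto
    finally show "(\<integral>x. h x y \<partial>N1) = f y * (\<integral>x. g x * F (x, y) \<partial>M1)" .
  qed
  also have "\<dots> = (\<integral>y. f y * (\<integral>x. g x * F (x, y) \<partial>M1) \<partial>M2)"
    using borel_measurable_integrable[OF f(1)] borel_measurable_continuous_onI[OF c1(1)] f(2)
    by (intro r2(4)) (auto simp: measurable_cong_sets[OF S2 refl])
  finally have l: "(\<integral>y. (\<integral>x. h x y \<partial>N1) \<partial>N2) = (\<integral>y. f y * (\<integral>x. g x * F (x, y) \<partial>M1) \<partial>M2)" .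
  have "(\<integral>x. (\<integral>y. h x y \<partial>N2) \<partial>N1) = (\<integral>x. g x * (\<integral>y. f y * F (x, y) \<partial>M2) \<partial>N1)"
  proof (rule Bochner_Integration.integral_cong[OF refl])
    fix x
    have "(\<integral>y. f y * F (x, y) \<partial>N2) = (\<integral>y. f y * F (x, y) \<partial>M2)"
      using c2(2) f(2) by (intro r2(4)) auto
    then show "(\<integral>y. h x y \<partial>N2) = g x * (\<integral>y. f y * F (x, y) \<partial>M2)" by (simp add: h_def)
  qed
  also have "\<dots> = (\<integral>x. g x * (\<integral>y. f y * F (x, y) \<partial>M2) \<partial>M1)"
    using borel_measurable_integrable[OF g(1)] borel_measurable_continuous_onI[OF c2(1)] g(2)
    by (intro r1(4)) (auto simp: measurable_cong_sets[OF S1 refl])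
  finally show ?thesis using eq l by simp
qed

text \<open>Dominate \<open>g\<close> by a series of indicators of open sets. The open sets with compact closure are directed
  and exhaust the space, so by continuity along directed families one of them carries all but \<open>\<epsilon>\<close> of the
  integral of the majorant.\<close>

lemma radon_integrable_tight:
  fixes g :: "'h::t2_space \<Rightarrow> complex"
  assumes lc: "locally_compact_space (euclidean :: 'h topology)"
    and M: "radon M" and g: "integrable M g" and e: "\<epsilon> > 0"
  obtains Q where "compact Q" "(\<integral>x. norm (g x - indicator Q x * g x) \<partial>M) \<le> \<epsilon>"
proof -
  note S = radon_sets[OF M]
  have gm: "(\<lambda>x. norm (g x)) \<in> borel_measurable borel"
    using borel_measurable_integrable[OF g] by (simp add: measurable_cong_sets[OF S refl])
  have gfin: "(\<integral>\<^sup>+x. ennreal (norm (g x)) \<partial>M) < \<infinity>" using g by (simp add: integrable_iff_bounded)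
  obtain c :: "nat \<Rightarrow> real" and U where U: "\<And>n. open (U n)" and c: "\<And>n. c n \<ge> 0"
    and maj: "\<And>x. ennreal (norm (g x)) \<le> (\<Sum>n. ennreal (c n) * indicator (U n) x)"
    and sum: "(\<Sum>n. ennreal (c n) * emeasure M (U n)) \<le> 2 * (\<integral>\<^sup>+x. ennreal (norm (g x)) \<partial>M) + 2"
    by (rule radon_open_majorant[OF M gm norm_ge_zero gfin]) (rule that)
  define I where "I = (bump UNIV :: ('h \<Rightarrow> real) set)"
  define W where "W \<phi> = {x. \<phi> x \<noteq> 0}" for \<phi> :: "'h \<Rightarrow> real"
  have I: "I \<noteq> {}" by (auto simp: I_def bump_def intro!: exI[of _ "\<lambda>_. 0"])
  have W: "open (W \<phi>)" "compact (closure (W \<phi>))" if "\<phi> \<in> I" for \<phi>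
  proof -
    have \<phi>: "\<phi> \<in> bump UNIV" using that by (simp add: I_def)
    show "open (W \<phi>)" unfolding W_def by (intro open_Collect_neq continuous_on_const bumpD(1)[OF \<phi>])
    show "compact (closure (W \<phi>))" unfolding W_def by (rule bumpD(4)[OF \<phi>])
  qed
  have dir: "\<exists>\<theta>\<in>I. W \<phi> \<union> W \<psi> \<subseteq> W \<theta>" if "\<phi> \<in> I" "\<psi> \<in> I" for \<phi> \<psi>
  proof -
    have "W \<phi> \<union> W \<psi> \<subseteq> W (\<lambda>x. max (\<phi> x) (\<psi> x))"
      using bumpD(2)[of \<phi>] bumpD(2)[of \<psi>] that by (auto simp: W_def I_def max_def order.antisym)
    then show ?thesis using bump_max that unfolding I_def by blast
  qed
  have cover: "(\<Union>\<phi>\<in>I. U n \<inter> W \<phi>) = U n" for n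
  proof -
    have "\<exists>\<phi>\<in>I. x \<in> W \<phi>" for x
    proof -
      obtain \<phi> where "\<phi> \<in> bump UNIV" "\<phi> x = 1" using urysohn_bump[OF lc, of "{x}" UNIV] by auto
      then show ?thesis unfolding I_def W_def by (intro bexI[of _ \<phi>]) simp_all
    qed
    then show ?thesis by blast
  qed
  define T where "T = (\<Sum>n. ennreal (c n) * emeasure M (U n))"
  have T: "T < \<infinity>" unfolding T_def
    by (rule le_less_trans[OF sum]) (use gfin in \<open>simp add: ennreal_mult_less_top\<close>)
  have "T = (\<Sum>n. SUP \<phi>\<in>I. ennreal (c n) * emeasure M (U n \<inter> W \<phi>))"
    unfolding T_def SUP_mult_left_ennreal[symmetric]
  proof (intro suminf_cong arg_cong2[where f = "(*)"] refl)
    fix n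
    have "emeasure M (\<Union>\<phi>\<in>I. U n \<inter> W \<phi>) = (SUP \<phi>\<in>I. emeasure M (U n \<inter> W \<phi>))"
      by (rule radon_directed_Union[OF M I]) (use W(1) U dir in blast)+
    then show "emeasure M (U n) = (SUP \<phi>\<in>I. emeasure M (U n \<inter> W \<phi>))" by (simp only: cover)
  qed
  also have "\<dots> = (SUP \<phi>\<in>I. \<Sum>n. ennreal (c n) * emeasure M (U n \<inter> W \<phi>))"
  proof (rule ennreal_suminf_SUP_eq_directed)
    fix N :: "nat set" and \<phi> \<psi> assume "\<phi> \<in> I" "\<psi> \<in> I"
    then obtain \<theta> where "\<theta> \<in> I" "W \<phi> \<union> W \<psi> \<subseteq> W \<theta>" using dir by blast
    then show "\<exists>\<theta>\<in>I. \<forall>n\<in>N. ennreal (c n) * emeasure M (U n \<inter> W \<phi>) \<le> ennreal (c n) * emeasure M (U n \<inter> W \<theta>) \<and>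
        ennreal (c n) * emeasure M (U n \<inter> W \<psi>) \<le> ennreal (c n) * emeasure M (U n \<inter> W \<theta>)"
      using U W(1) by (intro bexI[of _ \<theta>] ballI conjI mult_left_mono emeasure_mono) (auto simp: S)
  qed
  finally have Teq: "T = (SUP \<phi>\<in>I. \<Sum>n. ennreal (c n) * emeasure M (U n \<inter> W \<phi>))" .
  have "\<exists>\<phi>\<in>I. T < (\<Sum>n. ennreal (c n) * emeasure M (U n \<inter> W \<phi>)) + ennreal \<epsilon>"
    by (rule SUP_approx_ennreal[OF e I Teq]) (use T in simp)
  then obtain \<phi> where \<phi>: "\<phi> \<in> I" and close: "T < (\<Sum>n. ennreal (c n) * emeasure M (U n \<inter> W \<phi>)) + ennreal \<epsilon>"
    by blast
  define A where "A = (\<Sum>n. ennreal (c n) * emeasure M (U n \<inter> W \<phi>))"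
  define B where "B = (\<Sum>n. ennreal (c n) * emeasure M (U n - W \<phi>))"
  define Q where "Q = closure (W \<phi>)"
  have Um: "U n \<in> sets M" "W \<phi> \<in> sets M" "Q \<in> sets M" for n
    using U W(1)[OF \<phi>] by (auto simp: S Q_def)
  have "A + B = (\<Sum>n. ennreal (c n) * emeasure M (U n \<inter> W \<phi>) + ennreal (c n) * emeasure M (U n - W \<phi>))"
    unfolding A_def B_def by (rule suminf_add) auto
  also have "\<dots> = T"
    unfolding T_def distrib_left[symmetric]
    by (intro suminf_cong arg_cong2[where f = "(*)"] refl, subst plus_emeasure) (use Um in \<open>auto intro!: arg_cong[where f = "emeasure M"]\<close>)
  finally have AB: "A + B = T" .
  then have "A \<noteq> \<infinity>" using T by auto
  moreover have "A + B \<le> A + ennreal \<epsilon>" using close AB by (simp add: A_def)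
  ultimately have "B \<le> ennreal \<epsilon>" by (simp add: ennreal_add_left_cancel_le)
  moreover have "(\<integral>\<^sup>+x. ennreal (norm (g x - indicator Q x * g x)) \<partial>M) \<le> (\<integral>\<^sup>+x. (\<Sum>n. ennreal (c n) * indicator (U n - W \<phi>) x) \<partial>M)"
  proof (rule nn_integral_mono)
    fix x
    show "ennreal (norm (g x - indicator Q x * g x)) \<le> (\<Sum>n. ennreal (c n) * indicator (U n - W \<phi>) x)"
    proof (cases "x \<in> Q")
      case False
      then have "x \<notin> W \<phi>" using closure_subset[of "W \<phi>"] by (auto simp: Q_def)
      then have "(\<lambda>n. ennreal (c n) * indicator (U n - W \<phi>) x) = (\<lambda>n. ennreal (c n) * indicator (U n) x)"
        by (auto simp: indicator_def)
      then show ?thesis using maj[of x] False by simp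
    qed simp
  qed
  moreover have "\<dots> = B"
    unfolding B_def using Um
    by (subst nn_integral_suminf) (auto simp: nn_integral_cmult_indicator intro!: borel_measurable_times_ennreal borel_measurable_indicator)
  moreover have "integrable M (\<lambda>x. norm (g x - indicator Q x * g x))"
  proof -
    have "(\<lambda>x. indicator Q x *\<^sub>R g x) = (\<lambda>x. indicator Q x * g x)" by (auto simp: indicator_def)
    then show ?thesis using integrable_mult_indicator[OF Um(3) g] g by simp
  qed
  ultimately have "ennreal (\<integral>x. norm (g x - indicator Q x * g x) \<partial>M) \<le> ennreal \<epsilon>"
    by (subst (asm) nn_integral_eq_integral) auto
  then have "(\<integral>x. norm (g x - indicator Q x * g x) \<partial>M) \<le> \<epsilon>"
    using e by (simp add: ennreal_le_iff)
  then show thesis using that[of Q] W(2)[OF \<phi>] by (simp add: Q_def)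
qed

lemma lsc_borel_measurable:
  fixes f :: "'h::topological_space \<Rightarrow> ennreal"
  assumes "\<And>t. open {x. t < f x}"
  shows "f \<in> borel_measurable borel"
  by (rule borel_measurableI_greater) (use assms in simp)

section \<open>Set functions as measures and the weak topology\<close>

lemma nonneg_radonD:
  assumes "\<mu> \<in> nonneg_radon_measures"
  shows nonneg_radon_radon: "\<mu> \<in> radon_measures"
    and nonneg_radon_real: "\<mu> A = complex_of_real (Re (\<mu> A))"
    and nonneg_radon_Re_nonneg: "Re (\<mu> A) \<ge> 0"
proof -
  have \<mu>: "\<mu> \<in> radon_measures" "\<And>A. \<mu> A \<in> \<real>\<^sub>\<ge>\<^sub>0" using assms unfolding nonneg_radon_measures_def by blast+
  show "\<mu> \<in> radon_measures" by (rule \<mu>)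
  show "\<mu> A = complex_of_real (Re (\<mu> A))" "Re (\<mu> A) \<ge> 0"
    using \<mu>(2)[of A] unfolding complex_nonneg_Reals_iff by (simp_all add: complex_eq_iff)
qed

lemma to_measure_space [simp]: "space (to_measure \<mu>) = UNIV"
  unfolding to_measure_def by (rule space_measure_of) simp

lemma to_measure_sets [simp, measurable_cong]: "sets (to_measure \<mu>) = sets borel"
proof -
  have "sets (to_measure \<mu>) = sigma_sets (space borel) (sets borel)"
    unfolding to_measure_def space_borel by (rule sets_measure_of) simp
  then show ?thesis using sets.sigma_sets_eq by metis
qed

lemma emeasure_to_measure:
  assumes \<mu>: "\<mu> \<in> nonneg_radon_measures" and A: "A \<in> sets borel"
  shows "emeasure (to_measure \<mu>) A = ennreal (Re (\<mu> A))"
proof (rule emeasure_measure_of[OF to_measure_def])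
  show "sets borel \<subseteq> Pow (UNIV :: 'a set)" by simp
  have sums: "(\<lambda>n. \<mu> (F n)) sums \<mu> (\<Union>n. F n)" if "range F \<subseteq> sets borel" "disjoint_family F" for F :: "nat \<Rightarrow> 'a set"
    using nonneg_radon_radon[OF \<mu>] that by (simp add: radon_measures_def)
  have "(\<lambda>n::nat. \<mu> {}) sums \<mu> {}" using sums[of "\<lambda>_. {}"] by (simp add: disjoint_family_on_def)
  then have "\<mu> {} = 0" using summable_LIMSEQ_zero[OF sums_summable, of "\<lambda>_. \<mu> {}"] by (simp add: LIMSEQ_const_iff)
  then show "positive (sets (to_measure \<mu>)) (\<lambda>A. ennreal (Re (\<mu> A)))" by (simp add: positive_def)
  show "countably_additive (sets (to_measure \<mu>)) (\<lambda>A. ennreal (Re (\<mu> A)))"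
    unfolding countably_additive_def
  proof (intro allI impI)
    fix F :: "nat \<Rightarrow> 'a set" assume "range F \<subseteq> sets (to_measure \<mu>)" "disjoint_family F"
    then have "(\<lambda>n. Re (\<mu> (F n))) sums Re (\<mu> (\<Union>n. F n))" using sums_Re[OF sums] by simp
    then show "(\<Sum>n. ennreal (Re (\<mu> (F n)))) = ennreal (Re (\<mu> (\<Union>n. F n)))"
      using nonneg_radon_Re_nonneg[OF \<mu>] by (simp add: suminf_ennreal2 sums_iff)
  qed
qed (use A in simp)

lemma finite_measure_to_measure:
  "\<mu> \<in> nonneg_radon_measures \<Longrightarrow> finite_measure (to_measure \<mu>)"
  by (rule finite_measureI) (simp add: emeasure_to_measure)

lemma measure_to_measure:
  "\<mu> \<in> nonneg_radon_measures \<Longrightarrow> A \<in> sets borel \<Longrightarrow> measure (to_measure \<mu>) A = Re (\<mu> A)"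
  by (simp add: measure_def emeasure_to_measure nonneg_radon_Re_nonneg)

lemma to_measure_bounded_integrable:
  fixes f :: "'h::t2_space \<Rightarrow> 'b::{banach, second_countable_topology}"
  assumes \<mu>: "\<mu> \<in> nonneg_radon_measures" and f: "f \<in> borel_measurable borel" "\<And>x. norm (f x) \<le> B"
  shows "integrable (to_measure \<mu>) f"
proof -
  interpret finite_measure "to_measure \<mu>" by (rule finite_measure_to_measure[OF \<mu>])
  show ?thesis using f by (intro integrable_const_bound[of _ B]) auto
qed

lemma radon_measures_add:
  assumes \<mu>: "\<mu> \<in> radon_measures" and \<nu>: "\<nu> \<in> radon_measures"
  shows "(\<lambda>A. \<mu> A + \<nu> A) \<in> radon_measures"
  unfolding radon_measures_def
proof (intro CollectI conjI allI impI ballI)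
  fix A :: "'a set" and \<epsilon> :: real assume A: "A \<in> sets borel" and e: "\<epsilon> > 0"
  then have e2: "\<epsilon>/2 > 0" by simp
  obtain K where K: "compact K" "K \<subseteq> A" "\<forall>B\<in>sets borel. B \<subseteq> A - K \<longrightarrow> norm (\<mu> B) < \<epsilon>/2"
    using \<mu> A e2 unfolding radon_measures_def by blast
  obtain L where L: "compact L" "L \<subseteq> A" "\<forall>B\<in>sets borel. B \<subseteq> A - L \<longrightarrow> norm (\<nu> B) < \<epsilon>/2"
    using \<nu> A e2 unfolding radon_measures_def by blast
  show "\<exists>K. compact K \<and> K \<subseteq> A \<and> (\<forall>B\<in>sets borel. B \<subseteq> A - K \<longrightarrow> norm (\<mu> B + \<nu> B) < \<epsilon>)"
  proof (intro exI[of _ "K \<union> L"] conjI ballI impI)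
    fix B :: "'a set" assume B: "B \<in> sets borel" "B \<subseteq> A - (K \<union> L)"
    have "norm (\<mu> B) < \<epsilon>/2" "norm (\<nu> B) < \<epsilon>/2" using K(3) L(3) B by auto
    then show "norm (\<mu> B + \<nu> B) < \<epsilon>" using norm_triangle_ineq[of "\<mu> B" "\<nu> B"] by simp
  qed (use K L in auto)
qed (use assms in \<open>auto simp: radon_measures_def intro: sums_add\<close>)

lemma radon_measures_scale:
  assumes \<mu>: "\<mu> \<in> radon_measures"
  shows "(\<lambda>A. c * \<mu> A) \<in> radon_measures"
  unfolding radon_measures_def
proof (intro CollectI conjI allI impI ballI)
  fix A :: "'a set" and \<epsilon> :: real assume A: "A \<in> sets borel" and e: "\<epsilon> > 0"
  then have e2: "\<epsilon>/(norm c + 1) > 0" by (simp add: add_nonneg_pos)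
  obtain K where K: "compact K" "K \<subseteq> A" "\<forall>B\<in>sets borel. B \<subseteq> A - K \<longrightarrow> norm (\<mu> B) < \<epsilon>/(norm c + 1)"
    using \<mu> A e2 unfolding radon_measures_def by blast
  show "\<exists>K. compact K \<and> K \<subseteq> A \<and> (\<forall>B\<in>sets borel. B \<subseteq> A - K \<longrightarrow> norm (c * \<mu> B) < \<epsilon>)"
  proof (intro exI[of _ K] conjI ballI impI K(1,2))
    fix B :: "'a set" assume B: "B \<in> sets borel" "B \<subseteq> A - K"
    have "norm (c * \<mu> B) \<le> (norm c + 1) * norm (\<mu> B)" by (simp add: norm_mult mult_right_mono)
    also have "norm (\<mu> B) < \<epsilon>/(norm c + 1)" using K(3) B by blast
    then have "(norm c + 1) * norm (\<mu> B) < \<epsilon>"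
      using norm_ge_zero[of c] by (subst (asm) pos_less_divide_eq) (auto simp: mult.commute intro: add_nonneg_pos)
    finally show "norm (c * \<mu> B) < \<epsilon>" .
  qed
qed (use assms in \<open>auto simp: radon_measures_def intro: sums_mult\<close>)

lemma nonneg_radon_add:
  "\<mu> \<in> nonneg_radon_measures \<Longrightarrow> \<nu> \<in> nonneg_radon_measures \<Longrightarrow> (\<lambda>A. \<mu> A + \<nu> A) \<in> nonneg_radon_measures"
  by (auto simp: nonneg_radon_measures_def radon_measures_add intro: nonneg_Reals_add_I)

lemma nonneg_radon_scale:
  "\<mu> \<in> nonneg_radon_measures \<Longrightarrow> c \<ge> 0 \<Longrightarrow> (\<lambda>A. complex_of_real c * \<mu> A) \<in> nonneg_radon_measures"
  by (auto simp: nonneg_radon_measures_def radon_measures_scale intro: nonneg_Reals_mult_I)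

lemma nonneg_radon_point_mass: "point_mass x \<in> nonneg_radon_measures"
proof -
  have "point_mass x \<in> radon_measures"
    unfolding radon_measures_def
  proof (intro CollectI conjI allI impI ballI)
    fix F :: "nat \<Rightarrow> 'a set" assume F: "range F \<subseteq> sets borel" "disjoint_family F"
    show "(\<lambda>n. point_mass x (F n)) sums point_mass x (\<Union>n. F n)"
    proof (cases "\<exists>n. x \<in> F n")
      case True
      then obtain n where n: "x \<in> F n" by blast
      have "(\<lambda>k. point_mass x (F k)) = (\<lambda>k. if k = n then 1 else 0)"
        using F n unfolding disjoint_family_on_def by (auto simp: point_mass_def fun_eq_iff)
      moreover have "point_mass x (\<Union>n. F n) = 1" using n F by (auto simp: point_mass_def)
      ultimately show ?thesis using sums_single[of n "\<lambda>_. 1::complex"] by simp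
    qed (auto simp: point_mass_def)
  next
    fix A :: "'a set" and \<epsilon> :: real assume "A \<in> sets borel" "\<epsilon> > 0"
    then show "\<exists>K. compact K \<and> K \<subseteq> A \<and> (\<forall>B\<in>sets borel. B \<subseteq> A - K \<longrightarrow> norm (point_mass x B) < \<epsilon>)"
      by (intro exI[of _ "if x \<in> A then {x} else {}"]) (auto simp: point_mass_def)
  qed (simp add: point_mass_def)
  then show ?thesis by (simp add: nonneg_radon_measures_def point_mass_def)
qed

lemma integral_point_mass:
  fixes f :: "'h::t2_space \<Rightarrow> 'b::{banach, second_countable_topology}"
  assumes f: "f \<in> borel_measurable borel"
  shows "(\<integral>t. f t \<partial>to_measure (point_mass x)) = f x"
proof -
  note e = emeasure_to_measure[OF nonneg_radon_point_mass]
  have m: "- {x} \<in> sets borel" by (intro borel_open) auto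
  have "AE t in to_measure (point_mass x). t = x"
    by (rule AE_I[of _ _ "- {x}"]) (use m in \<open>auto simp: e point_mass_def\<close>)
  then have "(\<integral>t. f t \<partial>to_measure (point_mass x)) = (\<integral>t. f x \<partial>to_measure (point_mass x))"
    using f by (intro integral_cong_AE) auto
  also have "\<dots> = f x"
    using measure_to_measure[OF nonneg_radon_point_mass[of x], of UNIV] by (simp add: point_mass_def)
  finally show ?thesis .
qed

lemma nn_integral_to_measure_add:
  assumes \<mu>: "\<mu> \<in> nonneg_radon_measures" and \<nu>: "\<nu> \<in> nonneg_radon_measures"
    and f: "f \<in> borel_measurable borel"
  shows "(\<integral>\<^sup>+x. f x \<partial>to_measure (\<lambda>A. \<mu> A + \<nu> A)) = (\<integral>\<^sup>+x. f x \<partial>to_measure \<mu>) + (\<integral>\<^sup>+x. f x \<partial>to_measure \<nu>)"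
  using f
proof (induction rule: borel_measurable_induct)
  case (cong f g)
  then show ?case by (simp cong: nn_integral_cong)
next
  case (set A)
  then show ?case
    using nonneg_radon_Re_nonneg[OF \<mu>] nonneg_radon_Re_nonneg[OF \<nu>]
    by (simp add: emeasure_to_measure \<mu> \<nu> nonneg_radon_add)
next
  case (mult u c)
  then show ?case by (simp add: nn_integral_cmult distrib_left)
next
  case (add u v)
  then show ?case by (simp add: nn_integral_add add_ac)
next
  case (seq U)
  have "incseq U" by fact
  have [measurable]: "\<And>i. U i \<in> borel_measurable borel" by fact
  have "(\<integral>\<^sup>+x. (SUP i. U i) x \<partial>to_measure \<rho>) = (SUP i. \<integral>\<^sup>+x. U i x \<partial>to_measure \<rho>)" for \<rho> :: "'a set \<Rightarrow> complex"
    unfolding SUP_apply by (rule nn_integral_monotone_convergence_SUP[OF \<open>incseq U\<close>]) simp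
  moreover have "incseq (\<lambda>i. \<integral>\<^sup>+x. U i x \<partial>to_measure \<rho>)" for \<rho> :: "'a set \<Rightarrow> complex"
    using \<open>incseq U\<close> by (auto simp: incseq_def le_fun_def intro!: nn_integral_mono)
  ultimately show ?case using seq by (simp add: ennreal_SUP_add image_comp)
qed

lemma nn_integral_to_measure_scale:
  assumes \<mu>: "\<mu> \<in> nonneg_radon_measures" and c: "c \<ge> 0"
    and f: "f \<in> borel_measurable borel"
  shows "(\<integral>\<^sup>+x. f x \<partial>to_measure (\<lambda>A. complex_of_real c * \<mu> A)) = ennreal c * (\<integral>\<^sup>+x. f x \<partial>to_measure \<mu>)"
proof -
  have "to_measure (\<lambda>A. complex_of_real c * \<mu> A) = scale_measure (ennreal c) (to_measure \<mu>)"
    by (rule measure_eqI) (use nonneg_radon_Re_nonneg[OF \<mu>] c in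
      \<open>auto simp: emeasure_to_measure \<mu> nonneg_radon_scale ennreal_mult\<close>)
  then show ?thesis using f by (simp add: nn_integral_scale_measure)
qed

lemma integral_to_measure_linear:
  fixes f :: "'h::t2_space \<Rightarrow> real"
  assumes \<mu>: "\<mu> \<in> nonneg_radon_measures" and \<nu>: "\<nu> \<in> nonneg_radon_measures"
    and f: "f \<in> borel_measurable borel" "\<And>x. 0 \<le> f x" "\<And>x. f x \<le> B"
  shows "(\<integral>x. f x \<partial>to_measure (\<lambda>A. \<mu> A + \<nu> A)) = (\<integral>x. f x \<partial>to_measure \<mu>) + (\<integral>x. f x \<partial>to_measure \<nu>)"
    and "c \<ge> 0 \<Longrightarrow> (\<integral>x. f x \<partial>to_measure (\<lambda>A. complex_of_real c * \<mu> A)) = c * (\<integral>x. f x \<partial>to_measure \<mu>)"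
proof -
  have int: "integrable (to_measure \<rho>) f" if "\<rho> \<in> nonneg_radon_measures" for \<rho>
    by (rule to_measure_bounded_integrable[OF that f(1), of B]) (use f in simp)
  have nn: "(\<integral>\<^sup>+x. ennreal (f x) \<partial>to_measure \<rho>) = ennreal (\<integral>x. f x \<partial>to_measure \<rho>)" if "\<rho> \<in> nonneg_radon_measures" for \<rho>
    by (rule nn_integral_eq_integral[OF int[OF that]]) (use f in simp)
  have pos: "(\<integral>x. f x \<partial>to_measure \<rho>) \<ge> 0" for \<rho> by (rule integral_nonneg_AE) (use f in simp)
  have "ennreal (\<integral>x. f x \<partial>to_measure (\<lambda>A. \<mu> A + \<nu> A)) = ennreal ((\<integral>x. f x \<partial>to_measure \<mu>) + (\<integral>x. f x \<partial>to_measure \<nu>))"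
    using nn_integral_to_measure_add[OF \<mu> \<nu>, of "\<lambda>x. ennreal (f x)"] f
    by (simp add: nn \<mu> \<nu> nonneg_radon_add pos)
  then show "(\<integral>x. f x \<partial>to_measure (\<lambda>A. \<mu> A + \<nu> A)) = (\<integral>x. f x \<partial>to_measure \<mu>) + (\<integral>x. f x \<partial>to_measure \<nu>)"
    by (subst (asm) ennreal_inj) (simp_all add: pos)
  assume c: "c \<ge> 0"
  have "ennreal (\<integral>x. f x \<partial>to_measure (\<lambda>A. complex_of_real c * \<mu> A)) = ennreal (c * (\<integral>x. f x \<partial>to_measure \<mu>))"
    using nn_integral_to_measure_scale[OF \<mu> c, of "\<lambda>x. ennreal (f x)"] f
    by (simp add: nn \<mu> nonneg_radon_scale c ennreal_mult pos)
  then show "(\<integral>x. f x \<partial>to_measure (\<lambda>A. complex_of_real c * \<mu> A)) = c * (\<integral>x. f x \<partial>to_measure \<mu>)"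
    by (subst (asm) ennreal_inj) (simp_all add: pos c)
qed

lemma topspace_weak_topology: "topspace weak_topology = nonneg_radon_measures"
  unfolding weak_topology_def topspace_pullback_topology topspace_product_topology
  by (simp add: vimage_def PiE_UNIV_domain)

lemma continuous_map_weak_integral:
  assumes f: "f \<in> Cc"
  shows "continuous_map weak_topology euclidean (\<lambda>\<mu>. \<integral>x. f x \<partial>to_measure \<mu>)"
proof -
  let ?\<Phi> = "\<lambda>\<mu>. \<lambda>f\<in>Cc \<union> {\<lambda>_. 1}. \<integral>x. f x \<partial>to_measure \<mu>"
  have "continuous_map weak_topology euclidean ((\<lambda>x. x f) \<circ> ?\<Phi>)"
    unfolding weak_topology_def
    by (rule continuous_map_pullback) (use f in \<open>auto intro: continuous_map_product_projection\<close>)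
  then show ?thesis using f by (simp add: comp_def)
qed

lemma continuous_map_point_mass: "continuous_map euclidean weak_topology (point_mass :: 'h::t2_space \<Rightarrow> _)"
  unfolding weak_topology_def
proof (rule continuous_map_pullback')
  have "(\<integral>t. f t \<partial>to_measure (point_mass x)) = f x" if "f \<in> Cc \<union> {\<lambda>_. 1}" for f and x :: 'h
    using that by (intro integral_point_mass) (auto simp: Cc_def intro: borel_measurable_continuous_onI)
  then show "continuous_map euclidean (product_topology (\<lambda>_. euclidean) (Cc \<union> {\<lambda>_. 1}))
      ((\<lambda>\<mu>. \<lambda>f\<in>Cc \<union> {\<lambda>_. 1}. \<integral>x. f x \<partial>to_measure \<mu>) \<circ> (point_mass :: 'h \<Rightarrow> _))"
    unfolding continuous_map_componentwise by (auto simp: Cc_def)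
  show "topspace euclidean \<subseteq> point_mass -` nonneg_radon_measures"
    using nonneg_radon_point_mass by auto
qed

lemma weak_neighbourhood_finite:
  assumes W: "openin weak_topology W" and \<nu>: "\<nu> \<in> W"
  obtains J \<delta> where "finite J" "J \<subseteq> Cc \<union> {\<lambda>_. 1}" "\<delta> > 0"
    "\<And>\<mu>. \<mu> \<in> nonneg_radon_measures \<Longrightarrow>
      (\<And>f. f \<in> J \<Longrightarrow> dist (\<integral>x. f x \<partial>to_measure \<mu>) (\<integral>x. f x \<partial>to_measure \<nu>) < \<delta>) \<Longrightarrow> \<mu> \<in> W"
proof -
  define I :: "('a \<Rightarrow> complex) set" where "I = Cc \<union> {\<lambda>_. 1}"
  define \<Phi> where "\<Phi> = (\<lambda>\<mu>. \<lambda>f\<in>I. \<integral>x. f x \<partial>to_measure (\<mu> :: 'a set \<Rightarrow> complex))"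
  obtain U where U: "openin (product_topology (\<lambda>_. euclidean) I) U" "W = \<Phi> -` U \<inter> nonneg_radon_measures"
    using W unfolding weak_topology_def openin_pullback_topology I_def[symmetric] \<Phi>_def[symmetric] by blast
  have "\<Phi> \<nu> \<in> U" using U \<nu> by auto
  then obtain V where V: "finite {i \<in> I. V i \<noteq> UNIV}" "\<And>i. i \<in> I \<Longrightarrow> open (V i)"
    "\<Phi> \<nu> \<in> Pi\<^sub>E I V" "Pi\<^sub>E I V \<subseteq> U"
    using U(1) unfolding openin_product_topology_alt by auto
  define J where "J = {i \<in> I. V i \<noteq> UNIV}"
  have "\<exists>d>0. ball (\<integral>x. f x \<partial>to_measure \<nu>) d \<subseteq> V f" if "f \<in> J" for f
  proof -
    have f: "f \<in> I" using that by (simp add: J_def)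
    have "(\<integral>x. f x \<partial>to_measure \<nu>) \<in> V f" using PiE_mem[OF V(3) f] f by (simp add: \<Phi>_def)
    then show ?thesis by (rule openE[OF V(2)[OF f]]) blast
  qed
  then obtain d where d: "\<And>f. f \<in> J \<Longrightarrow> d f > 0 \<and> ball (\<integral>x. f x \<partial>to_measure \<nu>) (d f) \<subseteq> V f" by metis
  define \<delta> where "\<delta> = Min (insert 1 (d ` J))"
  have fin: "finite J" using V(1) by (simp add: J_def)
  show thesis
  proof (rule that[of J \<delta>])
    show "finite J" by fact
    show "J \<subseteq> Cc \<union> {\<lambda>_. 1}" by (auto simp: J_def I_def)
    show "\<delta> > 0" using fin d by (simp add: \<delta>_def)
    fix \<mu> :: "'a set \<Rightarrow> complex" assume \<mu>: "\<mu> \<in> nonneg_radon_measures"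
      and close: "\<And>f. f \<in> J \<Longrightarrow> dist (\<integral>x. f x \<partial>to_measure \<mu>) (\<integral>x. f x \<partial>to_measure \<nu>) < \<delta>"
    have "\<Phi> \<mu> \<in> Pi\<^sub>E I V"
    proof (rule PiE_I)
      fix f assume f: "f \<in> I"
      show "\<Phi> \<mu> f \<in> V f"
      proof (cases "f \<in> J")
        case True
        have "\<delta> \<le> d f" using True fin by (simp add: \<delta>_def)
        then have "(\<integral>x. f x \<partial>to_measure \<mu>) \<in> ball (\<integral>x. f x \<partial>to_measure \<nu>) (d f)"
          using close[OF True] by (simp add: dist_commute)
        then show ?thesis using d[OF True] f by (auto simp: \<Phi>_def)
      next
        case False
        then show ?thesis using f by (simp add: J_def)
      qed
    qed (simp add: \<Phi>_def)
    then show "\<mu> \<in> W" using V(4) U(2) \<mu> by auto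
  qed
qed

text \<open>An additive and homogeneous function on nonnegative measures that is weakly continuous is given by
  integrating its values at point masses. The measure \<open>\<nu>\<close> is a weak limit of finitely supported measures,
  for which this is linearity; these are the images of \<open>\<nu>\<close> under step maps \<open>s\<close> that move the points of \<open>K\<close>
  so little that the finitely many test functions of a given neighbourhood, and \<open>T\<close> on point masses,
  hardly change.\<close>

lemma weakly_continuous_linear_integral:
  fixes T :: "('h::t2_space set \<Rightarrow> complex) \<Rightarrow> real"
  assumes T: "continuous_map weak_topology euclideanreal T"
    and add: "\<And>\<mu> \<mu>'. \<mu> \<in> nonneg_radon_measures \<Longrightarrow> \<mu>' \<in> nonneg_radon_measures \<Longrightarrow> T (\<lambda>A. \<mu> A + \<mu>' A) = T \<mu> + T \<mu>'"
    and scale: "\<And>c \<mu>. c \<ge> 0 \<Longrightarrow> \<mu> \<in> nonneg_radon_measures \<Longrightarrow> T (\<lambda>A. complex_of_real c * \<mu> A) = c * T \<mu>"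
    and \<nu>: "\<nu> \<in> nonneg_radon_measures" and K: "compact K" and null: "AE x in to_measure \<nu>. x \<in> K"
  shows "T \<nu> = (\<integral>w. T (point_mass w) \<partial>to_measure \<nu>)"
proof -
  define \<tau> where "\<tau> w = T (point_mass w)" for w
  have \<tau>: "continuous_on UNIV \<tau>"
    using continuous_map_compose[OF continuous_map_point_mass T] by (simp add: \<tau>_def[abs_def] comp_def)
  interpret finite_measure "to_measure \<nu>" by (rule finite_measure_to_measure[OF \<nu>])
  define m0 where "m0 = measure (to_measure \<nu>) UNIV"
  have m0: "m0 \<ge> 0" by (simp add: m0_def)
  \<comment> \<open>Step maps need a centre even if \<open>K\<close> is empty.\<close>
  define K' where "K' = insert undefined K"
  have K': "compact K'" "K' \<noteq> {}" using K by (auto simp: K'_def)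
  have step: "dist (\<integral>x. u (s x) \<partial>to_measure \<nu>) (\<integral>x. u x \<partial>to_measure \<nu>) \<le> d * m0"
    if u: "continuous_on UNIV u" and s: "s \<in> borel \<rightarrow>\<^sub>M borel" "range s \<subseteq> K'" and d: "\<And>x. x \<in> K' \<Longrightarrow> dist (u (s x)) (u x) \<le> d"
    for u :: "'h \<Rightarrow> 'b::{banach, second_countable_topology}" and s d
  proof -
    have um: "u \<in> borel_measurable borel" by (rule borel_measurable_continuous_onI[OF u])
    have "compact (u ` K')" by (rule compact_continuous_image[OF continuous_on_subset[OF u] K'(1)]) simp
    then obtain B where "\<forall>z\<in>u ` K'. norm z \<le> B" using compact_imp_bounded bounded_iff by blast
    then have B: "norm (u x) \<le> B" if "x \<in> K'" for x using that by simp
    have i1: "integrable (to_measure \<nu>) u"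
      using null by (intro integrable_const_bound[of _ B]) (auto simp: um K'_def B measurable_cong_sets[OF to_measure_sets refl] elim!: eventually_mono)
    have usm: "(\<lambda>x. u (s x)) \<in> borel_measurable borel" by (rule measurable_compose[OF s(1) um])
    have "norm (u (s x)) \<le> B" for x using s(2) by (intro B) auto
    then have i2: "integrable (to_measure \<nu>) (\<lambda>x. u (s x))"
      by (intro integrable_const_bound[of _ B]) (simp_all add: usm measurable_cong_sets[OF to_measure_sets refl])
    have "dist (\<integral>x. u (s x) \<partial>to_measure \<nu>) (\<integral>x. u x \<partial>to_measure \<nu>) = norm (\<integral>x. u (s x) - u x \<partial>to_measure \<nu>)"
      by (simp add: dist_norm i1 i2)
    also have "\<dots> \<le> (\<integral>x. norm (u (s x) - u x) \<partial>to_measure \<nu>)" by (rule integral_norm_bound)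
    also have "\<dots> \<le> (\<integral>x. d \<partial>to_measure \<nu>)"
    proof (rule integral_mono_AE)
      show "AE x in to_measure \<nu>. norm (u (s x) - u x) \<le> d"
        using null by eventually_elim (use d in \<open>auto simp: dist_norm K'_def\<close>)
    qed (simp_all add: i1 i2)
    also have "\<dots> = d * m0" by (simp add: m0_def)
    finally show ?thesis .
  qed
  have close: "dist (T \<nu>) (\<integral>w. \<tau> w \<partial>to_measure \<nu>) \<le> \<epsilon>" if \<epsilon>: "\<epsilon> > 0" for \<epsilon>
  proof -
    define W where "W = {\<mu> \<in> nonneg_radon_measures. dist (T \<mu>) (T \<nu>) < \<epsilon>/2}"
    have "W = {\<mu> \<in> topspace weak_topology. T \<mu> \<in> ball (T \<nu>) (\<epsilon>/2)}"
      by (auto simp: W_def topspace_weak_topology dist_commute)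
    then have W: "openin weak_topology W"
      using openin_continuous_map_preimage[OF T, of "ball (T \<nu>) (\<epsilon>/2)"] by simp
    have "\<nu> \<in> W" using \<nu> \<epsilon> by (simp add: W_def)
    from weak_neighbourhood_finite[OF W this] obtain J \<delta> where J: "finite J" "J \<subseteq> Cc \<union> {\<lambda>_. 1}" and \<delta>: "\<delta> > 0"
      and JW: "\<And>\<mu>. \<mu> \<in> nonneg_radon_measures \<Longrightarrow>
        (\<And>f. f \<in> J \<Longrightarrow> dist (\<integral>x. f x \<partial>to_measure \<mu>) (\<integral>x. f x \<partial>to_measure \<nu>) < \<delta>) \<Longrightarrow> \<mu> \<in> W" by blast
    have Jc: "continuous_on UNIV f" if "f \<in> J" for f using J(2) that by (auto simp: Cc_def)
    \<comment> \<open>An oscillation below \<open>d\<close> changes integrals by at most \<open>d m0\<close>, which is less than \<open>\<delta>\<close> and \<open>\<epsilon>/2\<close>.\<close>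
    define d where "d = min \<delta> (\<epsilon>/2) / (m0 + 1)"
    have d: "d > 0" using \<delta> \<epsilon> m0 by (simp add: d_def)
    have "d * (m0 + 1) = min \<delta> (\<epsilon>/2)" using m0 by (simp add: d_def)
    then have "d * m0 < min \<delta> (\<epsilon>/2)" using d unfolding distrib_left mult_1_right by linarith
    then have dm: "d * m0 < \<delta>" "d * m0 < \<epsilon>/2" by auto
    define V where "V w = (\<Inter>f\<in>J. {x. dist (f w) (f x) < d}) \<inter> {x. dist (\<tau> w) (\<tau> x) < d}" for w
    have near: "open {x. dist (u w) (u x) < d}" if "continuous_on UNIV u"
      for u :: "'h \<Rightarrow> 'z::metric_space" and w
      by (rule open_Collect_less[OF continuous_on_dist[OF continuous_on_const that] continuous_on_const])
    have V: "open (V w) \<and> w \<in> V w" for w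
    proof
      show "open (V w)" unfolding V_def by (intro open_Int open_INT J(1) ballI near Jc \<tau>)
      show "w \<in> V w" using d by (simp add: V_def)
    qed
    obtain N :: "'h \<Rightarrow> nat" and w n where N: "N \<in> borel \<rightarrow>\<^sub>M count_space UNIV" "\<And>x. N x \<le> n" "\<And>i. w i \<in> K'"
      "\<And>x. x \<in> K' \<Longrightarrow> x \<in> V (w (N x))"
      by (rule compact_step_map[OF K', of V]) (use V in auto)
    define s where "s x = w (N x)" for x
    have s1: "s \<in> borel \<rightarrow>\<^sub>M borel"
      unfolding s_def[abs_def] by (rule measurable_compose[OF N(1)]) simp
    have s2: "range s \<subseteq> K'" using N(3) by (auto simp: s_def)
    note s = s1 s2
    have lev: "{x. N x = i} \<in> sets borel" for i
    proof -
      have "N -` {i} \<inter> space borel \<in> sets borel" by (rule measurable_sets[OF N(1)]) simp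
      moreover have "N -` {i} \<inter> space borel = {x. N x = i}" by auto
      ultimately show ?thesis by simp
    qed
    \<comment> \<open>The image of \<open>\<nu>\<close> under \<open>s\<close> as a combination of point masses, built up term by term.\<close>
    define c where "c i = measure (to_measure \<nu>) {x. N x = i}" for i
    define \<nu>n where "\<nu>n k = (\<lambda>A. \<Sum>i<k. complex_of_real (c i) * point_mass (w i) A)" for k
    have \<nu>n: "\<nu>n k \<in> nonneg_radon_measures \<and> T (\<nu>n k) = (\<Sum>i<k. c i * \<tau> (w i))" for k
    proof (induction k)
      case 0
      have "\<nu>n 0 = (\<lambda>A. complex_of_real 0 * point_mass (w 0) A)" by (simp add: \<nu>n_def)
      then show ?case using nonneg_radon_scale[OF nonneg_radon_point_mass, of 0 "w 0"]
          scale[OF _ nonneg_radon_point_mass, of 0 "w 0"] by simp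
    next
      case (Suc k)
      have sc: "(\<lambda>A. complex_of_real (c k) * point_mass (w k) A) \<in> nonneg_radon_measures"
        by (intro nonneg_radon_scale nonneg_radon_point_mass) (simp add: c_def)
      have "\<nu>n (Suc k) = (\<lambda>A. \<nu>n k A + complex_of_real (c k) * point_mass (w k) A)" by (simp add: \<nu>n_def)
      then show ?case
        using Suc sc nonneg_radon_add[of "\<nu>n k", OF _ sc] add[of "\<nu>n k", OF _ sc]
          scale[OF _ nonneg_radon_point_mass, of "c k" "w k"] by (simp add: c_def \<tau>_def)
    qed
    define \<nu>' where "\<nu>' = \<nu>n (Suc n)"
    have \<nu>': "\<nu>' \<in> nonneg_radon_measures" using \<nu>n by (simp add: \<nu>'_def)
    have split: "u (s x) = (\<Sum>i<Suc n. u (w i) * indicator {x. N x = i} x)" for u :: "'h \<Rightarrow> 'b::semiring_1" and x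
    proof -
      have "(\<Sum>i<Suc n. u (w i) * indicator {x. N x = i} x) = (\<Sum>i<Suc n. if i = N x then u (w i) else 0)"
        by (intro sum.cong) (auto simp: indicator_def)
      also have "\<dots> = u (s x)" using N(2)[of x] by (simp add: s_def)
      finally show ?thesis by simp
    qed
    have distr: "to_measure \<nu>' = distr (to_measure \<nu>) borel s"
    proof (rule measure_eqI)
      fix A assume "A \<in> sets (to_measure \<nu>')"
      then have A: "A \<in> sets borel" by simp
      have "emeasure (distr (to_measure \<nu>) borel s) A = emeasure (to_measure \<nu>) (s -` A)"
        using s A by (subst emeasure_distr) auto
      also have "\<dots> = (\<integral>\<^sup>+x. indicator A (s x) \<partial>to_measure \<nu>)"
      proof -
        have "s -` A \<inter> space borel \<in> sets borel" by (rule measurable_sets[OF s1 A])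
        then have "emeasure (to_measure \<nu>) (s -` A) = (\<integral>\<^sup>+x. indicator (s -` A) x \<partial>to_measure \<nu>)" by simp
        also have "(indicator (s -` A) :: 'h \<Rightarrow> ennreal) = (\<lambda>x. indicator A (s x))"
          by (simp add: indicator_def fun_eq_iff)
        finally show ?thesis .
      qed
      also have "\<dots> = (\<integral>\<^sup>+x. (\<Sum>i<Suc n. indicator A (w i) * indicator {x. N x = i} x) \<partial>to_measure \<nu>)"
        unfolding split[of "indicator A :: 'h \<Rightarrow> ennreal"] ..
      also have "\<dots> = (\<Sum>i<Suc n. indicator A (w i) * ennreal (c i))"
      proof (subst nn_integral_sum)
        show "(\<lambda>x. indicator A (w i) * indicator {x. N x = i} x :: ennreal) \<in> borel_measurable (to_measure \<nu>)" for i
          by (intro borel_measurable_times_ennreal borel_measurable_const borel_measurable_indicator) (simp add: lev)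
        show "(\<Sum>i<Suc n. \<integral>\<^sup>+x. indicator A (w i) * indicator {x. N x = i} x \<partial>to_measure \<nu>) = (\<Sum>i<Suc n. indicator A (w i) * ennreal (c i))"
        proof (rule sum.cong[OF refl])
          fix i
          have "(\<integral>\<^sup>+x. indicator A (w i) * indicator {x. N x = i} x \<partial>to_measure \<nu>)
              = indicator A (w i) * emeasure (to_measure \<nu>) {x. N x = i}"
            by (rule nn_integral_cmult_indicator) (simp add: lev)
          then show "(\<integral>\<^sup>+x. indicator A (w i) * indicator {x. N x = i} x \<partial>to_measure \<nu>) = indicator A (w i) * ennreal (c i)"
            by (simp only: c_def emeasure_eq_measure)
        qed
      qed
      also have "\<dots> = (\<Sum>i<Suc n. ennreal (c i * indicator A (w i)))"
        by (intro sum.cong) (auto simp: indicator_def)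
      also have "\<dots> = ennreal (\<Sum>i<Suc n. c i * indicator A (w i))"
        by (rule sum_ennreal) (simp add: c_def)
      also have "(\<Sum>i<Suc n. c i * indicator A (w i)) = Re (\<nu>' A)"
      proof -
        have "Re (complex_of_real (c i) * point_mass (w i) A) = c i * indicator A (w i)" for i
          using A by (simp add: point_mass_def indicator_def)
        then show ?thesis by (simp only: \<nu>'_def \<nu>n_def Re_sum)
      qed
      finally show "emeasure (to_measure \<nu>') A = emeasure (distr (to_measure \<nu>) borel s) A"
        by (simp only: emeasure_to_measure[OF \<nu>' A])
    qed simp
    have "\<nu>' \<in> W"
    proof (rule JW[OF \<nu>'])
      fix f assume f: "f \<in> J"
      have "(\<integral>x. f x \<partial>to_measure \<nu>') = (\<integral>x. f (s x) \<partial>to_measure \<nu>)"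
        unfolding distr
        by (rule integral_distr) (simp_all add: s1 measurable_cong_sets[OF to_measure_sets refl]
            borel_measurable_continuous_onI[OF Jc[OF f]])
      moreover have "dist (\<integral>x. f (s x) \<partial>to_measure \<nu>) (\<integral>x. f x \<partial>to_measure \<nu>) \<le> d * m0"
      proof (rule step[OF Jc[OF f] s])
        fix x assume "x \<in> K'"
        then have "dist (f (s x)) (f x) < d" using N(4)[of x] f by (simp add: V_def s_def)
        then show "dist (f (s x)) (f x) \<le> d" by simp
      qed
      ultimately show "dist (\<integral>x. f x \<partial>to_measure \<nu>') (\<integral>x. f x \<partial>to_measure \<nu>) < \<delta>" using dm by simp
    qed
    then have 1: "dist (T \<nu>') (T \<nu>) < \<epsilon>/2" by (simp add: W_def)
    have "T \<nu>' = (\<Sum>i<Suc n. c i * \<tau> (w i))" using \<nu>n by (simp add: \<nu>'_def)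
    also have "\<dots> = (\<Sum>i<Suc n. \<tau> (w i) * c i)" by (simp add: mult.commute)
    also have "\<dots> = (\<integral>x. (\<Sum>i<Suc n. \<tau> (w i) * indicator {x. N x = i} x) \<partial>to_measure \<nu>)"
    proof (subst Bochner_Integration.integral_sum)
      show "integrable (to_measure \<nu>) (\<lambda>x. \<tau> (w i) * indicator {x. N x = i} x)" for i
        by (intro integrable_mult_right integrable_real_indicator) (simp_all add: lev less_top[symmetric])
      show "(\<Sum>i<Suc n. \<tau> (w i) * c i) = (\<Sum>i<Suc n. \<integral>x. \<tau> (w i) * indicator {x. N x = i} x \<partial>to_measure \<nu>)"
        by (simp add: c_def)
    qed
    also have "\<dots> = (\<integral>x. \<tau> (s x) \<partial>to_measure \<nu>)" unfolding split[of \<tau>] ..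
    finally have "T \<nu>' = (\<integral>x. \<tau> (s x) \<partial>to_measure \<nu>)" .
    moreover have "dist (\<integral>x. \<tau> (s x) \<partial>to_measure \<nu>) (\<integral>x. \<tau> x \<partial>to_measure \<nu>) \<le> d * m0"
    proof (rule step[OF \<tau> s])
      fix x assume "x \<in> K'"
      then have "dist (\<tau> (s x)) (\<tau> x) < d" using N(4)[of x] by (simp add: V_def s_def)
      then show "dist (\<tau> (s x)) (\<tau> x) \<le> d" by simp
    qed
    ultimately have 2: "dist (T \<nu>') (\<integral>x. \<tau> x \<partial>to_measure \<nu>) < \<epsilon>/2" using dm by simp
    show ?thesis using 1 2 dist_triangle_half_r less_imp_le by blast
  qed
  have "dist (T \<nu>) (\<integral>w. \<tau> w \<partial>to_measure \<nu>) \<le> 0" by (rule field_le_epsilon) (use close in simp)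
  then show ?thesis by (simp add: \<tau>_def)
qed

section \<open>Supports of convolutions of point masses\<close>

context hypergroup
begin

definition pt :: "'h \<Rightarrow> 'h \<Rightarrow> 'h measure" where
  "pt x y = to_measure (point_conv H x y)"

text \<open>The number \<open>\<phi>(xy)\<close>, for real \<open>\<phi>\<close>.\<close>

definition mean :: "('h \<Rightarrow> real) \<Rightarrow> 'h \<Rightarrow> 'h \<Rightarrow> real" where
  "mean \<phi> x y = (\<integral>t. \<phi> t \<partial>pt x y)"

definition supp :: "'h \<Rightarrow> 'h \<Rightarrow> 'h set" where
  "supp x y = msupp (point_conv H x y)"

lemma pt_sets [simp, measurable_cong]: "sets (pt x y) = sets borel" and pt_space [simp]: "space (pt x y) = UNIV"
  by (simp_all add: pt_def)

lemma emeasure_pt: "A \<in> sets borel \<Longrightarrow> emeasure (pt x y) A = ennreal (Re (point_conv H x y A))"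
  unfolding pt_def by (rule emeasure_to_measure[OF point_conv_nonneg])

lemma pt_measurable_iff: "borel_measurable (pt x y) = borel_measurable borel"
  by (rule measurable_cong_sets) simp_all

lemma emeasure_pt_UNIV [simp]: "emeasure (pt x y) UNIV = 1"
  by (simp add: emeasure_pt point_conv_prob)

lemma finite_measure_pt: "finite_measure (pt x y)"
  by (rule finite_measureI) simp

lemma measure_pt_UNIV [simp]: "measure (pt x y) UNIV = 1"
  by (simp add: measure_def)

lemma pt_integrable:
  fixes f :: "'h \<Rightarrow> 'b::{banach, second_countable_topology}"
  assumes "f \<in> borel_measurable borel" "\<And>x. norm (f x) \<le> B"
  shows "integrable (pt x y) f"
  unfolding pt_def by (rule to_measure_bounded_integrable[OF point_conv_nonneg assms])

lemma bump_pt_integrable: "\<phi> \<in> bump U \<Longrightarrow> integrable (pt x y) \<phi>"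
  using bumpD(2,3)[of \<phi> U]
  by (intro pt_integrable[of _ 1] borel_measurable_continuous_onI bumpD(1)) auto

lemma mean_bounds:
  assumes "\<phi> \<in> bump U" shows "0 \<le> mean \<phi> x y" "mean \<phi> x y \<le> 1"
proof -
  interpret finite_measure "pt x y" by (rule finite_measure_pt)
  show "0 \<le> mean \<phi> x y" unfolding mean_def by (rule integral_nonneg_AE) (simp add: bumpD(2)[OF assms])
  have "mean \<phi> x y \<le> (\<integral>t. 1 \<partial>pt x y)"
    unfolding mean_def using bumpD(3)[OF assms] bump_pt_integrable[OF assms] by (intro integral_mono) auto
  then show "mean \<phi> x y \<le> 1" by simp
qed

lemma hval_of_real: "hval H (\<lambda>t. complex_of_real (\<phi> t)) x y = complex_of_real (mean \<phi> x y)"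
  by (simp add: hval_def mean_def pt_def)

lemma hval_continuous:
  assumes f: "f \<in> Cc"
  shows "continuous_on UNIV (\<lambda>p. hval H f (fst p) (snd p))"
proof -
  have "continuous_map (prod_topology euclidean euclidean) (prod_topology weak_topology weak_topology)
      (\<lambda>p::'h \<times> 'h. (point_mass (fst p), point_mass (snd p)))"
    unfolding continuous_map_pairwise comp_def fst_conv snd_conv
    by (intro conjI continuous_map_compose[OF continuous_map_fst continuous_map_point_mass, unfolded comp_def]
      continuous_map_compose[OF continuous_map_snd continuous_map_point_mass, unfolded comp_def])
  from continuous_map_compose[OF continuous_map_compose[OF this convol_continuous] continuous_map_weak_integral[OF f]]
  show ?thesis by (simp add: comp_def hval_def euclidean_product_topology)
qed

lemma mean_continuous:
  assumes "\<phi> \<in> bump U"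
  shows "continuous_on UNIV (\<lambda>p. mean \<phi> (fst p) (snd p))"
  using continuous_on_Re[OF hval_continuous[OF bump_of_real_Cc[OF assms]]] by (simp add: hval_of_real)

lemma mean_continuous_right:
  assumes "\<phi> \<in> bump U" shows "continuous_on UNIV (mean \<phi> x)"
proof -
  have "continuous_on UNIV (\<lambda>y::'h. (x, y))" by (intro continuous_intros)
  from continuous_on_compose2[OF mean_continuous[OF assms] this] show ?thesis by simp
qed

lemma mean_continuous_left:
  assumes "\<phi> \<in> bump U" shows "continuous_on UNIV (\<lambda>x. mean \<phi> x y)"
proof -
  have "continuous_on UNIV (\<lambda>x::'h. (x, y))" by (intro continuous_intros)
  from continuous_on_compose2[OF mean_continuous[OF assms] this] show ?thesis by simp
qed

lemma compact_supp: "compact (supp x y)"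
  unfolding supp_def by (rule point_conv_compact_supp)

text \<open>Points off the support have null neighbourhoods; finitely many of them cover a compact set, and
  compact sets exhaust the complement of the support up to small measure.\<close>

lemma AE_supp: "AE t in pt x y. t \<in> supp x y"
proof -
  define \<mu> where "\<mu> = point_conv H x y"
  define S where "S = supp x y"
  have \<mu>: "\<mu> \<in> nonneg_radon_measures" unfolding \<mu>_def by (rule point_conv_nonneg)
  have Sb: "- S \<in> sets borel"
    unfolding S_def by (intro borel_open open_Compl compact_imp_closed compact_supp)
  interpret finite_measure "pt x y" by (rule finite_measure_pt)
  have null: "\<exists>U. open U \<and> t \<in> U \<and> U \<in> null_sets (pt x y)" if t: "t \<notin> S" for t
  proof -
    obtain U where U: "open U" "t \<in> U" "\<forall>B\<in>sets borel. B \<subseteq> U \<longrightarrow> \<mu> B = 0"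
      using t unfolding S_def supp_def msupp_def \<mu>_def by auto
    then have "\<mu> U = 0" by auto
    then show ?thesis using U(1,2) emeasure_pt[of U x y] by (auto simp: null_sets_def \<mu>_def)
  qed
  have small: "emeasure (pt x y) (- S) \<le> ennreal \<epsilon>" if e: "\<epsilon> > 0" for \<epsilon>
  proof -
    obtain K where K: "compact K" "K \<subseteq> - S" "\<forall>B\<in>sets borel. B \<subseteq> - S - K \<longrightarrow> norm (\<mu> B) < \<epsilon>"
      using nonneg_radon_radon[OF \<mu>] Sb e unfolding radon_measures_def by blast
    have "\<forall>t\<in>K. \<exists>U. open U \<and> t \<in> U \<and> U \<in> null_sets (pt x y)" using null K(2) by blast
    then obtain U where U: "\<And>t. t \<in> K \<Longrightarrow> open (U t) \<and> t \<in> U t \<and> U t \<in> null_sets (pt x y)" by metis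
    obtain C where C: "C \<subseteq> K" "finite C" "K \<subseteq> (\<Union>t\<in>C. U t)"
      by (rule compactE_image[OF K(1), of K U]) (use U in auto)
    have "(\<Union>t\<in>C. U t) \<in> null_sets (pt x y)" using C U by (intro null_sets_UN' countable_finite) auto
    then have Kn: "K \<in> null_sets (pt x y)"
      by (rule null_sets_subset) (use C(3) borel_closed[OF compact_imp_closed[OF K(1)]] in auto)
    have Kb: "K \<in> sets borel" by (rule borel_closed[OF compact_imp_closed[OF K(1)]])
    have "emeasure (pt x y) (- S) \<le> emeasure (pt x y) (- S - K) + emeasure (pt x y) K"
      using Sb Kb by (intro order_trans[OF emeasure_mono[of _ "(- S - K) \<union> K"] emeasure_subadditive]) auto
    also have "\<dots> = ennreal (Re (\<mu> (- S - K)))" using Kn Sb Kb by (simp add: emeasure_pt null_sets_def \<mu>_def)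
    also have "\<dots> \<le> ennreal \<epsilon>"
    proof (rule ennreal_leI)
      have "norm (\<mu> (- S - K)) < \<epsilon>" using K(3) Sb Kb by blast
      then show "Re (\<mu> (- S - K)) \<le> \<epsilon>" using complex_Re_le_cmod[of "\<mu> (- S - K)"] by simp
    qed
    finally show ?thesis .
  qed
  have "emeasure (pt x y) (- S) \<le> 0" by (rule ennreal_le_epsilon) (use small in simp)
  then have "emeasure (pt x y) (- S) = 0" by simp
  then show ?thesis using Sb by (intro AE_I[of _ _ "- S"]) (auto simp: S_def)
qed

lemma supp_nonempty: "supp x y \<noteq> {}"
proof
  assume "supp x y = {}"
  then have "AE t in pt x y. False" using AE_supp[of x y] by simp
  then have "emeasure (pt x y) UNIV = 0" by (subst (asm) AE_iff_measurable[of UNIV]) auto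
  then show False by simp
qed

lemma mean_pos_supp:
  assumes z: "z \<in> supp x y" and \<phi>: "continuous_on UNIV \<phi>" "\<And>t. \<phi> t \<ge> (0::real)" "\<phi> z > 0"
    and int: "integrable (pt x y) \<phi>"
  shows "(\<integral>t. \<phi> t \<partial>pt x y) > 0"
proof (rule ccontr)
  assume "\<not> ?thesis"
  moreover have "(\<integral>t. \<phi> t \<partial>pt x y) \<ge> 0" by (rule integral_nonneg_AE) (simp add: \<phi>(2))
  ultimately have "(\<integral>t. \<phi> t \<partial>pt x y) = 0" by simp
  then have ae: "AE t in pt x y. \<phi> t = 0" using integral_nonneg_eq_0_iff_AE[OF int] \<phi>(2) by simp
  define U where "U = {t. \<phi> t > 0}"
  have U: "open U" "z \<in> U" unfolding U_def using open_Collect_less[OF continuous_on_const \<phi>(1)] \<phi>(3) by auto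
  obtain B where B: "B \<in> sets borel" "B \<subseteq> U" "point_conv H x y B \<noteq> 0"
    using z U unfolding supp_def msupp_def by auto
  have "AE t in pt x y. t \<notin> B" using ae by eventually_elim (use B in \<open>auto simp: U_def\<close>)
  then have "emeasure (pt x y) B = 0" using B(1) by (subst (asm) AE_iff_measurable[of B]) auto
  then have "Re (point_conv H x y B) \<le> 0" using B(1) by (simp add: emeasure_pt ennreal_eq_0_iff)
  then have "Re (point_conv H x y B) = 0" using nonneg_radon_Re_nonneg[OF point_conv_nonneg[of x y], of B] by simp
  then show False using B(3) nonneg_radon_real[OF point_conv_nonneg[of x y], of B] by simp
qed

lemma mean_zero_off_supp:
  assumes "\<And>t. t \<in> supp x y \<Longrightarrow> \<phi> t = (0::real)" and "\<phi> \<in> borel_measurable borel"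
  shows "(\<integral>t. \<phi> t \<partial>pt x y) = 0"
proof -
  have "AE t in pt x y. \<phi> t = 0" using AE_supp[of x y] by eventually_elim (use assms in auto)
  then have "(\<integral>t. \<phi> t \<partial>pt x y) = (\<integral>t. 0 \<partial>pt x y)"
    using assms(2) by (intro integral_cong_AE) (auto simp: pt_measurable_iff)
  then show ?thesis by simp
qed

lemma mean_nonzero_witness:
  assumes "\<phi> \<in> bump U" "mean \<phi> x y \<noteq> 0"
  obtains t where "t \<in> supp x y" "\<phi> t \<noteq> 0"
  using mean_zero_off_supp[of x y \<phi>] assms borel_measurable_continuous_onI[OF bumpD(1)[OF assms(1)]]
  unfolding mean_def by blast

lemma pt_invol: "pt (invol H y) (invol H x) = distr (pt x y) borel (invol H)"
proof (rule measure_eqI)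
  fix A assume "A \<in> sets (pt (invol H y) (invol H x))"
  then have A: "A \<in> sets borel" by simp
  have meas: "invol H \<in> borel \<rightarrow>\<^sub>M borel" by (rule borel_measurable_continuous_onI[OF invol_continuous])
  have img: "invol H ` A = invol H -` A" using invol_invol by (auto simp: image_iff) metis
  have "invol H -` A \<inter> space borel \<in> sets borel" by (rule measurable_sets[OF meas A])
  then have Ai: "invol H -` A \<in> sets borel" by simp
  have "emeasure (pt (invol H y) (invol H x)) A = ennreal (Re (point_conv H x y (invol H ` A)))"
    using A by (simp add: emeasure_pt invol_point_conv[symmetric])
  also have "\<dots> = emeasure (pt x y) (invol H -` A)" using Ai by (simp add: emeasure_pt img)
  also have "\<dots> = emeasure (distr (pt x y) borel (invol H)) A"
    using A meas by (subst emeasure_distr) (auto simp: measurable_cong_sets[OF pt_sets refl])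
  finally show "emeasure (pt (invol H y) (invol H x)) A = emeasure (distr (pt x y) borel (invol H)) A" .
qed simp

lemma supp_invol:
  assumes t: "t \<in> supp x y"
  shows "invol H t \<in> supp (invol H y) (invol H x)"
  unfolding supp_def msupp_def
proof (intro CollectI allI impI)
  fix U assume U: "open U" "invol H t \<in> U"
  have meas: "invol H \<in> borel \<rightarrow>\<^sub>M borel" by (rule borel_measurable_continuous_onI[OF invol_continuous])
  have "open (invol H -` U)" by (rule open_vimage[OF U(1) invol_continuous])
  then obtain B where B: "B \<in> sets borel" "B \<subseteq> invol H -` U" "point_conv H x y B \<noteq> 0"
    using t U(2) unfolding supp_def msupp_def by auto
  have "invol H -` B \<inter> space borel \<in> sets borel" by (rule measurable_sets[OF meas B(1)])
  then have "invol H -` B \<in> sets borel" by simp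
  moreover have "invol H -` B \<subseteq> U" using B(2) invol_invol by (metis subsetI subsetD vimageE vimageI2)
  moreover have "point_conv H (invol H y) (invol H x) (invol H -` B) \<noteq> 0"
  proof -
    have "invol H ` (invol H -` B) = B" using invol_invol by (metis image_vimage_eq surjI surj_def Int_UNIV_right)
    then show ?thesis using B(3) unfolding invol_point_conv[symmetric] by simp
  qed
  ultimately show "\<exists>B\<in>sets borel. B \<subseteq> U \<and> point_conv H (invol H y) (invol H x) B \<noteq> 0" by blast
qed

lemma convol_nonneg:
  assumes "\<mu> \<in> nonneg_radon_measures" "\<nu> \<in> nonneg_radon_measures"
  shows "convol H \<mu> \<nu> \<in> nonneg_radon_measures"
  using continuous_map_image_subset_topspace[OF convol_continuous] assms
  by (auto simp: topspace_weak_topology image_subset_iff)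

text \<open>Convolution with a point mass is weakly continuous and linear, hence an integral of convolutions of
  point masses. This is how the values of the convolution on general measures are determined.\<close>

lemma integral_convol_point:
  assumes \<phi>: "\<phi> \<in> bump U"
  shows "(\<integral>t. \<phi> t \<partial>to_measure (convol H (point_mass x) (point_conv H y z))) = (\<integral>w. mean \<phi> x w \<partial>pt y z)"
    and "(\<integral>t. \<phi> t \<partial>to_measure (convol H (point_conv H y z) (point_mass x))) = (\<integral>w. mean \<phi> w x \<partial>pt y z)"
proof -
  note nn = nonneg_radon_point_mass point_conv_nonneg convol_nonneg
  have Tc: "continuous_map weak_topology euclideanreal (\<lambda>\<nu>. \<integral>t. \<phi> t \<partial>to_measure (g \<nu>))"
    if g: "continuous_map weak_topology weak_topology g" for g
  proof -
    have "continuous_map weak_topology euclidean (\<lambda>\<nu>. \<integral>t. complex_of_real (\<phi> t) \<partial>to_measure (g \<nu>))"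
      using continuous_map_compose[OF g continuous_map_weak_integral[OF bump_of_real_Cc[OF \<phi>]]] by (simp add: comp_def)
    then have "continuous_map weak_topology euclidean (Re \<circ> (\<lambda>\<nu>. \<integral>t. complex_of_real (\<phi> t) \<partial>to_measure (g \<nu>)))"
      by (rule continuous_map_compose) (simp add: continuous_on_Re)
    then show ?thesis by (simp add: comp_def)
  qed
  have \<phi>m: "\<phi> \<in> borel_measurable borel" by (rule borel_measurable_continuous_onI[OF bumpD(1)[OF \<phi>]])
  note lin = integral_to_measure_linear[OF _ _ \<phi>m bumpD(2,3)[OF \<phi>]]
  have cl: "continuous_map weak_topology weak_topology (\<lambda>\<nu>. convol H (point_mass x) \<nu>)"
  proof -
    have "continuous_map weak_topology (prod_topology weak_topology weak_topology) (\<lambda>\<nu>. (point_mass x, \<nu>))"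
      by (simp add: continuous_map_pairwise comp_def topspace_weak_topology nonneg_radon_point_mass)
    from continuous_map_compose[OF this convol_continuous] show ?thesis by (simp add: comp_def)
  qed
  have cr: "continuous_map weak_topology weak_topology (\<lambda>\<nu>. convol H \<nu> (point_mass x))"
  proof -
    have "continuous_map weak_topology (prod_topology weak_topology weak_topology) (\<lambda>\<nu>. (\<nu>, point_mass x))"
      by (simp add: continuous_map_pairwise comp_def topspace_weak_topology nonneg_radon_point_mass)
    from continuous_map_compose[OF this convol_continuous] show ?thesis by (simp add: comp_def)
  qed
  note R = nonneg_radon_radon
  show "(\<integral>t. \<phi> t \<partial>to_measure (convol H (point_mass x) (point_conv H y z))) = (\<integral>w. mean \<phi> x w \<partial>pt y z)"
    unfolding mean_def pt_def
  proof (rule weakly_continuous_linear_integral[OF Tc[OF cl] _ _ point_conv_nonneg compact_supp AE_supp[unfolded pt_def]])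
    fix \<mu> \<mu>' :: "'h set \<Rightarrow> complex" assume m: "\<mu> \<in> nonneg_radon_measures" "\<mu>' \<in> nonneg_radon_measures"
    show "(\<integral>t. \<phi> t \<partial>to_measure (convol H (point_mass x) (\<lambda>A. \<mu> A + \<mu>' A))) =
        (\<integral>t. \<phi> t \<partial>to_measure (convol H (point_mass x) \<mu>)) + (\<integral>t. \<phi> t \<partial>to_measure (convol H (point_mass x) \<mu>'))"
      using m by (simp add: convol_add_right R nn lin(1))
  next
    fix c and \<mu> :: "'h set \<Rightarrow> complex" assume m: "0 \<le> (c::real)" "\<mu> \<in> nonneg_radon_measures"
    show "(\<integral>t. \<phi> t \<partial>to_measure (convol H (point_mass x) (\<lambda>A. complex_of_real c * \<mu> A))) =
        c * (\<integral>t. \<phi> t \<partial>to_measure (convol H (point_mass x) \<mu>))"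
      using m by (simp add: convol_scale_right R nn lin(2)[OF nn(3) nn(3)])
  qed
  show "(\<integral>t. \<phi> t \<partial>to_measure (convol H (point_conv H y z) (point_mass x))) = (\<integral>w. mean \<phi> w x \<partial>pt y z)"
    unfolding mean_def pt_def
  proof (rule weakly_continuous_linear_integral[OF Tc[OF cr] _ _ point_conv_nonneg compact_supp AE_supp[unfolded pt_def]])
    fix \<mu> \<mu>' :: "'h set \<Rightarrow> complex" assume m: "\<mu> \<in> nonneg_radon_measures" "\<mu>' \<in> nonneg_radon_measures"
    show "(\<integral>t. \<phi> t \<partial>to_measure (convol H (\<lambda>A. \<mu> A + \<mu>' A) (point_mass x))) =
        (\<integral>t. \<phi> t \<partial>to_measure (convol H \<mu> (point_mass x))) + (\<integral>t. \<phi> t \<partial>to_measure (convol H \<mu>' (point_mass x)))"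
      using m by (simp add: convol_add_left R nn lin(1))
  next
    fix c and \<mu> :: "'h set \<Rightarrow> complex" assume m: "0 \<le> (c::real)" "\<mu> \<in> nonneg_radon_measures"
    show "(\<integral>t. \<phi> t \<partial>to_measure (convol H (\<lambda>A. complex_of_real c * \<mu> A) (point_mass x))) =
        c * (\<integral>t. \<phi> t \<partial>to_measure (convol H \<mu> (point_mass x)))"
      using m by (simp add: convol_scale_left R nn lin(2)[OF nn(3) nn(3)])
  qed
qed

lemma mean_assoc:
  assumes \<phi>: "\<phi> \<in> bump U"
  shows "(\<integral>w. mean \<phi> x w \<partial>pt y z) = (\<integral>w. mean \<phi> w z \<partial>pt x y)"
proof -
  note R = nonneg_radon_radon[OF nonneg_radon_point_mass]
  show ?thesis
    unfolding integral_convol_point[OF \<phi>, symmetric] convol_assoc[OF R R R] ..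
qed

lemma open_supp_subset:
  assumes "open V"
  shows "open {p. supp (fst p) (snd p) \<subseteq> V}"
proof -
  let ?G = "{C. compact C \<and> C \<noteq> {} \<and> C \<inter> UNIV \<noteq> {} \<and> C \<subseteq> V}"
  have "openin michael_topology ?G"
    unfolding michael_topology_def using assms by (intro topology_generated_by_Basis) blast
  from openin_continuous_map_preimage[OF supp_continuous this]
  have "open {p. (\<lambda>(x, y). msupp (point_conv H x y)) p \<in> ?G}" by simp
  also have "{p. (\<lambda>(x, y). msupp (point_conv H x y)) p \<in> ?G} = {p. supp (fst p) (snd p) \<subseteq> V}"
    using compact_supp supp_nonempty by (auto simp: supp_def)
  finally show ?thesis .
qed

definition set_conv :: "'h set \<Rightarrow> 'h set \<Rightarrow> 'h set" where
  "set_conv K L = (\<Union>p\<in>K \<times> L. supp (fst p) (snd p))"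

text \<open>If \<open>supp x y\<close> is covered by finitely many open sets, then so are all \<open>supp x' y'\<close> with \<open>(x', y')\<close>
  close to \<open>(x, y)\<close>, by continuity of the support in the Michael topology.\<close>

lemma compact_set_conv:
  assumes "compact K" "compact L"
  shows "compact (set_conv K L)"
proof (rule compactI)
  fix \<C> :: "'h set set" assume op: "\<forall>B\<in>\<C>. open B" and cov: "set_conv K L \<subseteq> \<Union>\<C>"
  have "\<exists>D. finite D \<and> D \<subseteq> \<C> \<and> supp (fst p) (snd p) \<subseteq> \<Union>D" if p: "p \<in> K \<times> L" for p
  proof -
    have "supp (fst p) (snd p) \<subseteq> \<Union>\<C>" using cov p by (auto simp: set_conv_def)
    then show ?thesis using compactE[OF compact_supp, of "fst p" "snd p" \<C>] op by metis
  qed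
  then obtain D where D: "\<And>p. p \<in> K \<times> L \<Longrightarrow> finite (D p) \<and> D p \<subseteq> \<C> \<and> supp (fst p) (snd p) \<subseteq> \<Union>(D p)" by metis
  define G where "G p = {q. supp (fst q) (snd q) \<subseteq> \<Union>(D p)}" for p
  have G: "open (G p)" "p \<in> G p" if "p \<in> K \<times> L" for p
  proof -
    have "open (\<Union>(D p))" using D[OF that] op by (intro open_Union) blast
    then show "open (G p)" unfolding G_def by (rule open_supp_subset)
    show "p \<in> G p" using D[OF that] by (simp add: G_def)
  qed
  obtain P where P: "P \<subseteq> K \<times> L" "finite P" "K \<times> L \<subseteq> (\<Union>p\<in>P. G p)"
    by (rule compactE_image[OF compact_Times[OF assms], of "K \<times> L" G]) (use G in auto)
  have "set_conv K L \<subseteq> \<Union>(\<Union>(D ` P))"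
  proof
    fix t assume "t \<in> set_conv K L"
    then obtain q where q: "q \<in> K \<times> L" "t \<in> supp (fst q) (snd q)" unfolding set_conv_def by blast
    then obtain p where p: "p \<in> P" "q \<in> G p" using P(3) by blast
    then have "t \<in> \<Union>(D p)" using q(2) by (auto simp: G_def)
    then show "t \<in> \<Union>(\<Union>(D ` P))" using p(1) by blast
  qed
  moreover have "finite (\<Union>(D ` P))" "\<Union>(D ` P) \<subseteq> \<C>"
  proof -
    have "finite (D p) \<and> D p \<subseteq> \<C>" if "p \<in> P" for p using D P(1) that by blast
    then show "finite (\<Union>(D ` P))" "\<Union>(D ` P) \<subseteq> \<C>" using P(2) by blast+
  qed
  ultimately show "\<exists>\<C>'\<subseteq>\<C>. finite \<C>' \<and> set_conv K L \<subseteq> \<Union>\<C>'"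
    by (intro exI[of _ "\<Union>(D ` P)"] conjI)
qed

lemma set_convI: "x \<in> K \<Longrightarrow> y \<in> L \<Longrightarrow> t \<in> supp x y \<Longrightarrow> t \<in> set_conv K L"
  by (auto simp: set_conv_def)

text \<open>In a group this says that \<open>z = xy\<close> gives \<open>x = zy\<^sup>-\<^sup>1\<close>. Compare the two bracketings of \<open>x y z\<^sup>-\<^sup>1\<close>, with
  inverses standing for involutions. The identity lies in the support of \<open>(x y) z\<^sup>-\<^sup>1\<close> because \<open>z\<close> lies in
  that of \<open>x y\<close>. Hence it lies in the support of \<open>x w\<close> for some \<open>w\<close> in the support of \<open>y z\<^sup>-\<^sup>1\<close>, which means
  that \<open>w\<close> is the involution of \<open>x\<close>.\<close>

lemma supp_exchange:
  assumes z: "z \<in> supp x y"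
  shows "x \<in> supp z (invol H y)"
proof -
  define e where "e = ident H"
  have "\<exists>w\<in>supp y (invol H z). e \<in> supp x w"
  proof (rule ccontr)
    assume none: "\<not> ?thesis"
    define C where "C = supp y (invol H z)"
    have "\<exists>\<phi> N. \<phi> \<in> bump UNIV \<and> \<phi> e = 1 \<and> open N \<and> w \<in> N \<and> (\<forall>v\<in>N. \<forall>t\<in>supp x v. \<phi> t < 1/2)" if w: "w \<in> C" for w
    proof -
      have op: "open (- supp x w)" by (intro open_Compl compact_imp_closed compact_supp)
      have "{e} \<subseteq> - supp x w" using none w by (auto simp: C_def)
      then obtain \<phi> where \<phi>: "\<phi> \<in> bump (- supp x w)" "\<And>t. t \<in> {e} \<Longrightarrow> \<phi> t = 1"
        using urysohn_bump[OF locally_compact, of "{e}" "- supp x w"] op by auto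
      have \<phi>': "\<phi> \<in> bump UNIV" using \<phi>(1) by (simp add: bump_def)
      define V where "V = {t. \<phi> t < 1/2}"
      have "open V" unfolding V_def by (rule open_Collect_less[OF bumpD(1)[OF \<phi>(1)] continuous_on_const])
      then have "open ((\<lambda>v. (x, v)) -` {p. supp (fst p) (snd p) \<subseteq> V})"
        by (intro open_vimage open_supp_subset) (auto intro!: continuous_intros)
      moreover have "supp x w \<subseteq> V" using bumpD(5)[OF \<phi>(1)] by (auto simp: V_def)
      ultimately show ?thesis
        using \<phi>(2) \<phi>' by (intro exI[of _ \<phi>] exI[of _ "(\<lambda>v. (x, v)) -` {p. supp (fst p) (snd p) \<subseteq> V}"])
          (auto simp: V_def)
    qed
    then obtain f N where fN: "\<And>w. w \<in> C \<Longrightarrow> f w \<in> bump UNIV \<and> f w e = 1 \<and> open (N w) \<and> w \<in> N w \<and> (\<forall>v\<in>N w. \<forall>t\<in>supp x v. f w t < 1/2)"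
      by metis
    have "compact C" unfolding C_def by (rule compact_supp)
    then obtain D where D: "D \<subseteq> C" "finite D" "C \<subseteq> (\<Union>w\<in>D. N w)"
      by (rule compactE_image[of C C N]) (use fN in auto)
    \<comment> \<open>A neighbourhood of the identity that misses the support of \<open>x v\<close> for every \<open>v\<close> in \<open>C\<close>.\<close>
    define U where "U = (\<Inter>w\<in>D. {t. 1/2 < f w t})"
    have "open U" unfolding U_def
      using D fN by (intro open_INT ballI open_Collect_less continuous_on_const bumpD(1)[of _ UNIV]) auto
    moreover have "e \<in> U" using D fN by (auto simp: U_def)
    ultimately obtain \<phi> where \<phi>: "\<phi> \<in> bump U" "\<phi> e = 1"
      using urysohn_bump[OF locally_compact, of "{e}" U] by auto
    have zero: "mean \<phi> x v = 0" if v: "v \<in> C" for v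
    proof (rule ccontr)
      assume "mean \<phi> x v \<noteq> 0"
      then obtain t where t: "t \<in> supp x v" "\<phi> t \<noteq> 0" using mean_nonzero_witness[OF \<phi>(1)] by blast
      have "t \<in> U" using t(2) bumpD(5)[OF \<phi>(1), of t] by blast
      obtain w where w: "w \<in> D" "v \<in> N w" using D v by auto
      have "f w t < 1/2" using fN[of w] w D t by auto
      moreover have "1/2 < f w t" using \<open>t \<in> U\<close> w by (auto simp: U_def)
      ultimately show False by simp
    qed
    have "(\<integral>v. mean \<phi> x v \<partial>pt y (invol H z)) = 0"
      by (rule mean_zero_off_supp) (auto simp: zero C_def intro: borel_measurable_continuous_onI mean_continuous_right[OF \<phi>(1)])
    moreover have "(\<integral>w. mean \<phi> w (invol H z) \<partial>pt x y) > 0"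
    proof (rule mean_pos_supp[OF z mean_continuous_left[OF \<phi>(1)] mean_bounds(1)[OF \<phi>(1)]])
      have "e \<in> supp z (invol H z)" unfolding e_def supp_def ident_in_supp invol_invol ..
      then show "mean \<phi> z (invol H z) > 0"
        unfolding mean_def using \<phi> by (intro mean_pos_supp bump_pt_integrable[OF \<phi>(1)]) (auto dest: bumpD)
      show "integrable (pt x y) (\<lambda>w. mean \<phi> w (invol H z))"
        using mean_bounds[OF \<phi>(1)]
        by (intro pt_integrable[of _ 1] borel_measurable_continuous_onI mean_continuous_left[OF \<phi>(1)]) auto
    qed
    ultimately show False using mean_assoc[OF \<phi>(1), where x = x and y = y and z = "invol H z"] by simp
  qed
  then obtain w where w: "w \<in> supp y (invol H z)" "e \<in> supp x w" by blast
  have "x = invol H w" using w(2) ident_in_supp[of x w] by (simp add: e_def supp_def)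
  moreover have "invol H w \<in> supp (invol H (invol H z)) (invol H y)" by (rule supp_invol[OF w(1)])
  ultimately show ?thesis by (simp add: invol_invol)
qed

lemma supp_exchange_right:
  assumes "z \<in> supp x y"
  shows "y \<in> supp (invol H x) z"
proof -
  have "invol H y \<in> supp (invol H z) (invol H (invol H x))" by (rule supp_exchange[OF supp_invol[OF assms]])
  from supp_invol[OF this] show ?thesis by (simp add: invol_invol)
qed

lemma mean_mono:
  assumes "\<phi> \<in> bump U" "\<psi> \<in> bump V" "\<And>t. \<phi> t \<le> \<psi> t"
  shows "mean \<phi> x y \<le> mean \<psi> x y"
  unfolding mean_def by (rule integral_mono[OF bump_pt_integrable[OF assms(1)] bump_pt_integrable[OF assms(2)] assms(3)])

lemma emeasure_pt_open:
  assumes U: "open U"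
  shows "emeasure (pt x y) U = (SUP \<phi>\<in>bump U. ennreal (mean \<phi> x y))"
proof (rule antisym)
  define \<mu> where "\<mu> = point_conv H x y"
  have \<mu>: "\<mu> \<in> nonneg_radon_measures" unfolding \<mu>_def by (rule point_conv_nonneg)
  have Ub: "U \<in> sets borel" using U by simp
  have nnm: "(\<integral>\<^sup>+t. ennreal (\<phi> t) \<partial>pt x y) = ennreal (mean \<phi> x y)" if "\<phi> \<in> bump U" for \<phi>
    unfolding mean_def using bumpD(2)[OF that] by (intro nn_integral_eq_integral bump_pt_integrable[OF that]) simp
  show "(SUP \<phi>\<in>bump U. ennreal (mean \<phi> x y)) \<le> emeasure (pt x y) U"
  proof (rule SUP_least)
    fix \<phi> assume \<phi>: "\<phi> \<in> bump U"
    have "(\<integral>\<^sup>+t. ennreal (\<phi> t) \<partial>pt x y) \<le> (\<integral>\<^sup>+t. indicator U t \<partial>pt x y)"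
      using bumpD(3,5)[OF \<phi>] by (intro nn_integral_mono) (auto simp: indicator_def)
    then show "ennreal (mean \<phi> x y) \<le> emeasure (pt x y) U" using Ub by (simp add: nnm[OF \<phi>])
  qed
  show "emeasure (pt x y) U \<le> (SUP \<phi>\<in>bump U. ennreal (mean \<phi> x y))"
  proof (rule ennreal_le_epsilon)
    fix e :: real assume e: "e > 0"
    obtain K where K: "compact K" "K \<subseteq> U" "\<forall>B\<in>sets borel. B \<subseteq> U - K \<longrightarrow> norm (\<mu> B) < e"
      using nonneg_radon_radon[OF \<mu>] Ub e unfolding radon_measures_def by blast
    have Kb: "K \<in> sets borel" by (rule borel_closed[OF compact_imp_closed[OF K(1)]])
    obtain \<phi> where \<phi>: "\<phi> \<in> bump U" "\<And>t. t \<in> K \<Longrightarrow> \<phi> t = 1"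
      using urysohn_bump[OF locally_compact K(1) U K(2)] by blast
    have "emeasure (pt x y) U \<le> emeasure (pt x y) K + emeasure (pt x y) (U - K)"
      using Ub Kb by (intro order_trans[OF emeasure_mono[of _ "K \<union> (U - K)"] emeasure_subadditive]) auto
    also have "emeasure (pt x y) (U - K) \<le> ennreal e"
    proof -
      have "norm (\<mu> (U - K)) < e" using K(3) Ub Kb by blast
      then have "Re (\<mu> (U - K)) \<le> e" using complex_Re_le_cmod[of "\<mu> (U - K)"] by simp
      then show ?thesis using Ub Kb by (simp add: emeasure_pt \<mu>_def ennreal_leI)
    qed
    also have "emeasure (pt x y) K \<le> ennreal (mean \<phi> x y)"
    proof -
      have "(\<integral>\<^sup>+t. indicator K t \<partial>pt x y) \<le> (\<integral>\<^sup>+t. ennreal (\<phi> t) \<partial>pt x y)"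
        using \<phi>(2) by (intro nn_integral_mono) (auto simp: indicator_def)
      then show ?thesis using Kb by (simp add: nnm[OF \<phi>(1)])
    qed
    also have "ennreal (mean \<phi> x y) \<le> (SUP \<phi>\<in>bump U. ennreal (mean \<phi> x y))" by (rule SUP_upper[OF \<phi>(1)])
    finally show "emeasure (pt x y) U \<le> (SUP \<phi>\<in>bump U. ennreal (mean \<phi> x y)) + ennreal e"
      by (simp add: add_mono)
  qed
qed

end

section \<open>Haar measure and the regular representation\<close>

locale haar_hypergroup = hypergroup H for H :: "'h::t2_space hypergroup_data" +
  fixes m :: "'h measure"
  assumes haar: "left_haar_measure H m"
begin

lemma radon_haar: "radon m"
  using haar unfolding left_haar_measure_def radon_def by (elim conjE) (intro conjI)

lemmas sets_haar = radon_sets[OF radon_haar]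

lemma space_haar [simp]: "space m = UNIV"
  by (rule radon_space[OF radon_haar])

lemma haar_measurable_iff: "borel_measurable m = borel_measurable borel"
  by (rule measurable_cong_sets) (simp_all add: sets_haar)

lemma integrable_compact_support:
  fixes f :: "'h \<Rightarrow> real"
  assumes f: "continuous_on UNIV f" and K: "compact K" "\<And>x. x \<notin> K \<Longrightarrow> f x = 0"
  shows "integrable m f"
proof -
  have "compact (f ` K)" by (rule compact_continuous_image[OF continuous_on_subset[OF f] K(1)]) simp
  then obtain B where "\<forall>z\<in>f ` K. norm z \<le> B" using compact_imp_bounded bounded_iff by blast
  then have B: "\<bar>f x\<bar> \<le> \<bar>B\<bar>" if "x \<in> K" for x using that by fastforce
  show ?thesis
  proof (rule Bochner_Integration.integrable_bound)
    show "integrable m (\<lambda>x. \<bar>B\<bar> * indicator K x)"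
      using radon_compact_finite[OF radon_haar K(1)] borel_closed[OF compact_imp_closed[OF K(1)]]
      by (intro integrable_mult_right integrable_real_indicator) (auto simp: sets_haar)
    show "AE x in m. norm (f x) \<le> norm (\<bar>B\<bar> * indicator K x)"
      using B K(2) by (intro AE_I2) (auto simp: indicator_def)
  qed (simp add: haar_measurable_iff borel_measurable_continuous_onI[OF f])
qed

lemma bump_integrable: "\<phi> \<in> bump U \<Longrightarrow> integrable m \<phi>"
  by (rule integrable_compact_support[OF bumpD(1) bumpD(4) bump_outside_closure])

lemma mean_support:
  assumes "\<phi> \<in> bump U" "mean \<phi> x y \<noteq> 0"
  shows "y \<in> set_conv {invol H x} (closure {t. \<phi> t \<noteq> 0})"
    and "x \<in> set_conv (closure {t. \<phi> t \<noteq> 0}) {invol H y}"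
proof -
  obtain t where t: "t \<in> supp x y" "\<phi> t \<noteq> 0" using mean_nonzero_witness[OF assms] by blast
  have c: "t \<in> closure {t. \<phi> t \<noteq> 0}" by (rule nonzero_in_closure[of \<phi>, OF t(2)])
  show "y \<in> set_conv {invol H x} (closure {t. \<phi> t \<noteq> 0})"
    by (rule set_convI[OF _ c supp_exchange_right[OF t(1)]]) simp
  show "x \<in> set_conv (closure {t. \<phi> t \<noteq> 0}) {invol H y}"
    by (rule set_convI[OF c _ supp_exchange[OF t(1)]]) simp
qed

lemma mean_integrable:
  assumes \<phi>: "\<phi> \<in> bump U" shows "integrable m (mean \<phi> x)"
  by (rule integrable_compact_support[OF mean_continuous_right[OF \<phi>]
      compact_set_conv[OF compact_sing bumpD(4)[OF \<phi>]]]) (use mean_support(1)[OF \<phi>] in blast)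

lemma haar_mean:
  assumes \<phi>: "\<phi> \<in> bump U"
  shows "(\<integral>y. mean \<phi> x y \<partial>m) = (\<integral>y. \<phi> y \<partial>m)"
proof -
  have "(\<integral>y. hval H (\<lambda>t. complex_of_real (\<phi> t)) x y \<partial>m) = (\<integral>y. complex_of_real (\<phi> y) \<partial>m)"
    using haar bump_of_real_Cc[OF \<phi>] unfolding left_haar_measure_def by blast
  then have "complex_of_real (\<integral>y. mean \<phi> x y \<partial>m) = complex_of_real (\<integral>y. \<phi> y \<partial>m)"
    unfolding hval_of_real by simp
  then show ?thesis by (simp only: of_real_eq_iff)
qed

lemma bump_nn_integral: "\<phi> \<in> bump U \<Longrightarrow> (\<integral>\<^sup>+x. ennreal (\<phi> x) \<partial>m) = ennreal (\<integral>x. \<phi> x \<partial>m)"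
  by (rule nn_integral_eq_integral[OF bump_integrable]) (simp_all add: bumpD(2))

lemma bump_nn_integral_le:
  assumes \<phi>: "\<phi> \<in> bump U" and U: "open U"
  shows "(\<integral>\<^sup>+x. ennreal (\<phi> x) \<partial>m) \<le> emeasure m U"
proof -
  have "(\<integral>\<^sup>+x. ennreal (\<phi> x) \<partial>m) \<le> (\<integral>\<^sup>+x. indicator U x \<partial>m)"
    using bumpD(3,5)[OF \<phi>] by (intro nn_integral_mono) (auto simp: indicator_def)
  then show ?thesis using U by (simp add: sets_haar)
qed

lemma open_ennreal_continuous:
  fixes f :: "'h \<Rightarrow> real"
  assumes "continuous_on UNIV f" shows "open {x. t < ennreal (f x)}"
  by (rule open_Collect_less[OF continuous_on_const continuous_on_ennreal[OF assms]])

lemma mean_invol_continuous: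
  assumes "\<phi> \<in> bump U"
  shows "continuous_on UNIV (\<lambda>p. mean \<phi> (invol H (fst p)) (snd p))"
proof -
  have "continuous_on UNIV (\<lambda>p::'h \<times> 'h. (invol H (fst p), snd p))"
    by (intro continuous_on_Pair continuous_on_compose2[OF invol_continuous] continuous_on_fst continuous_on_snd continuous_on_id) auto
  from continuous_on_compose2[OF mean_continuous[OF assms] this] show ?thesis by simp
qed

lemma indicator_pt_eq_SUP:
  fixes x a b :: 'h
  assumes V: "open V" and U: "open U"
  shows "indicator V x * emeasure (pt a b) U = (SUP i\<in>bump V \<times> bump U. ennreal (fst i x * mean (snd i) a b))"
proof (rule antisym)
  show "indicator V x * emeasure (pt a b) U \<le> (SUP i\<in>bump V \<times> bump U. ennreal (fst i x * mean (snd i) a b))"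
  proof (cases "x \<in> V")
    case True
    obtain \<psi> where \<psi>: "\<psi> \<in> bump V" "\<psi> x = 1"
      using urysohn_bump[OF locally_compact, of "{x}" V] V True by auto
    have "(SUP \<phi>\<in>bump U. ennreal (mean \<phi> a b)) \<le> (SUP i\<in>bump V \<times> bump U. ennreal (fst i x * mean (snd i) a b))"
    proof (rule SUP_mono)
      fix \<phi> assume "\<phi> \<in> bump U"
      then show "\<exists>i\<in>bump V \<times> bump U. ennreal (mean \<phi> a b) \<le> ennreal (fst i x * mean (snd i) a b)"
        using \<psi> by (intro bexI[of _ "(\<psi>, \<phi>)"]) auto
    qed
    then show ?thesis using True by (simp add: emeasure_pt_open[OF U])
  qed simp
  show "(SUP i\<in>bump V \<times> bump U. ennreal (fst i x * mean (snd i) a b)) \<le> indicator V x * emeasure (pt a b) U"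
  proof (rule SUP_least, clarify)
    fix \<psi> \<phi> assume \<psi>: "\<psi> \<in> bump V" and \<phi>: "\<phi> \<in> bump U"
    have "ennreal (\<psi> x * mean \<phi> a b) = ennreal (\<psi> x) * ennreal (mean \<phi> a b)"
      using bumpD(2)[OF \<psi>] mean_bounds[OF \<phi>] by (intro ennreal_mult) auto
    also have "\<dots> \<le> indicator V x * emeasure (pt a b) U"
      using bumpD(3,5)[OF \<psi>] \<phi> unfolding emeasure_pt_open[OF U]
      by (intro mult_mono SUP_upper) (auto simp: indicator_def)
    finally show "ennreal (fst (\<psi>, \<phi>) x * mean (snd (\<psi>, \<phi>)) a b) \<le> indicator V x * emeasure (pt a b) U" by simp
  qed
qed

lemma zero_in_bump: "(\<lambda>_. 0) \<in> bump U"
  by (simp add: bump_def)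

lemma bump_pairs_directed:
  assumes "i \<in> bump V \<times> bump U" "j \<in> bump V \<times> bump U"
  shows "\<exists>k\<in>bump V \<times> bump U. \<forall>x a b. ennreal (fst i x * mean (snd i) a b) \<le> ennreal (fst k x * mean (snd k) a b)
      \<and> ennreal (fst j x * mean (snd j) a b) \<le> ennreal (fst k x * mean (snd k) a b)"
proof -
  define k where "k = ((\<lambda>x. max (fst i x) (fst j x)), (\<lambda>x. max (snd i x) (snd j x)))"
  have ij: "fst i \<in> bump V" "fst j \<in> bump V" "snd i \<in> bump U" "snd j \<in> bump U" using assms by auto
  have k: "fst k \<in> bump V" "snd k \<in> bump U" using bump_max ij by (auto simp: k_def)
  have "fst l x * mean (snd l) a b \<le> fst k x * mean (snd k) a b" if "l = i \<or> l = j" for l x a b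
  proof (rule mult_mono)
    show "fst l x \<le> fst k x" using that by (auto simp: k_def)
    show "mean (snd l) a b \<le> mean (snd k) a b" using that ij k by (intro mean_mono) (auto simp: k_def)
    show "0 \<le> fst k x" "0 \<le> mean (snd l) a b" using bumpD(2)[OF k(1)] mean_bounds(1) that ij by auto
  qed
  then show ?thesis using k by (intro bexI[of _ k]) (auto simp: mem_Times_iff intro!: ennreal_leI)
qed

text \<open>Left invariance, integrated: the function \<open>(x, y) \<mapsto> 1\<^sub>V(x) (\<delta>\<^sub>x\<^sub>' * \<delta>\<^sub>y)(U)\<close>, where \<open>x'\<close> is the
  involution of \<open>x\<close>, has integral at most \<open>m(V) m(U)\<close>. It is a directed supremum of the continuous
  functions \<open>\<psi>(x) \<phi>(x'y)\<close> with \<open>\<psi>\<close> in \<open>bump V\<close> and \<open>\<phi>\<close> in \<open>bump U\<close>. These have compact support, so Fubini's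
  theorem and the invariance of \<open>m\<close> apply to them, and both iterated integrals commute with the directed
  supremum. The same description gives the lower semicontinuity that makes the function and its inner
  integral measurable.\<close>

lemma haar_kernel:
  assumes V: "open V" and U: "open U"
  shows haar_kernel_lsc: "open {x. t < indicator V x * emeasure (pt (invol H x) y) U}"
    and haar_kernel_integral_lsc: "open {y. t < (\<integral>\<^sup>+x. indicator V x * emeasure (pt (invol H x) y) U \<partial>m)}"
    and haar_kernel_bound: "(\<integral>\<^sup>+y. (\<integral>\<^sup>+x. indicator V x * emeasure (pt (invol H x) y) U \<partial>m) \<partial>m) \<le> emeasure m V * emeasure m U"
proof -
  define I where "I = bump V \<times> bump U"
  define F where "F i p = fst i (fst p) * mean (snd i) (invol H (fst p)) (snd p)" for i :: "('h \<Rightarrow> real) \<times> ('h \<Rightarrow> real)" and p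
  have I: "I \<noteq> {}" using zero_in_bump by (auto simp: I_def)
  have Ib: "fst i \<in> bump V" "snd i \<in> bump U" if "i \<in> I" for i using that by (auto simp: I_def)
  have Fc: "continuous_on UNIV (F i)" if "i \<in> I" for i
    unfolding F_def[abs_def]
    by (intro continuous_on_mult mean_invol_continuous[OF Ib(2)[OF that]] continuous_on_compose2[OF bumpD(1)[OF Ib(1)[OF that]]]
        continuous_on_fst continuous_on_id) auto
  have sec1: "continuous_on UNIV (\<lambda>x. F i (x, y))" and sec2: "continuous_on UNIV (\<lambda>z. F i (z', z))" if "i \<in> I" for i y z'
    by (rule continuous_on_compose2[OF Fc[OF that]], auto intro!: continuous_intros)+
  have Fpos: "F i p \<ge> 0" if "i \<in> I" for i p
    unfolding F_def using bumpD(2)[OF Ib(1)[OF that]] mean_bounds(1)[OF Ib(2)[OF that]] by simp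
  have eq: "indicator V x * emeasure (pt (invol H x) y) U = (SUP i\<in>I. ennreal (F i (x, y)))" for x y
    unfolding I_def F_def using indicator_pt_eq_SUP[OF V U] by simp
  have dir: "\<exists>k\<in>I. \<forall>p. ennreal (F i p) \<le> ennreal (F k p) \<and> ennreal (F j p) \<le> ennreal (F k p)" if "i \<in> I" "j \<in> I" for i j
    using bump_pairs_directed[of i V U j] that unfolding I_def F_def by meson
  show "open {x. t < indicator V x * emeasure (pt (invol H x) y) U}" for t y
  proof -
    have "{x. t < (SUP i\<in>I. ennreal (F i (x, y)))} = (\<Union>i\<in>I. {x. t < ennreal (F i (x, y))})" by (auto simp: less_SUP_iff)
    then show ?thesis unfolding eq using open_ennreal_continuous[OF sec1] by auto
  qed
  have inner: "(\<integral>\<^sup>+x. indicator V x * emeasure (pt (invol H x) y) U \<partial>m) = (SUP i\<in>I. \<integral>\<^sup>+x. ennreal (F i (x, y)) \<partial>m)" for y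
    unfolding eq
  proof (rule radon_nn_integral_directed_SUP[OF radon_haar I])
    show "open {x. t < ennreal (F i (x, y))}" if "i \<in> I" for i t by (rule open_ennreal_continuous[OF sec1[OF that]])
    show "\<exists>k\<in>I. \<forall>x. ennreal (F i (x, y)) \<le> ennreal (F k (x, y)) \<and> ennreal (F j (x, y)) \<le> ennreal (F k (x, y))"
      if "i \<in> I" "j \<in> I" for i j using dir[OF that] by blast
  qed
  define Q where "Q i = closure {x. fst i x \<noteq> 0}" for i :: "('h \<Rightarrow> real) \<times> ('h \<Rightarrow> real)"
  have Q: "compact (Q i)" if "i \<in> I" for i unfolding Q_def by (rule bumpD(4)[OF Ib(1)[OF that]])
  have Q0: "fst i x = 0" if "x \<notin> Q i" for x i using that unfolding Q_def by (rule bump_outside_closure)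
  have Fnn: "(\<integral>\<^sup>+x. ennreal (F i (x, y)) \<partial>m) = ennreal (\<integral>x. F i (x, y) \<partial>m)" if i: "i \<in> I" for i y
  proof (rule nn_integral_eq_integral[OF integrable_compact_support[OF sec1[OF i] Q[OF i]]])
    show "F i (x, y) = 0" if "x \<notin> Q i" for x using Q0[OF that] by (simp add: F_def)
  qed (simp add: Fpos[OF i])
  have kc: "continuous_on UNIV (\<lambda>p. complex_of_real (mean (snd i) (invol H (fst p)) (snd p)))" if i: "i \<in> I" for i
    by (intro continuous_on_of_real mean_invol_continuous[OF Ib(2)[OF i]])
  have \<psi>: "integrable m (\<lambda>x. complex_of_real (fst i x))" if i: "i \<in> I" for i
    using bump_integrable[OF Ib(1)[OF i]] by simp
  have \<psi>0: "complex_of_real (fst i x) = 0" if "x \<notin> Q i" for i x using Q0[OF that] by simp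
  have Fint_cont: "continuous_on UNIV (\<lambda>y. \<integral>x. F i (x, y) \<partial>m)" if i: "i \<in> I" for i
  proof -
    have "continuous_on UNIV (\<lambda>p::'h \<times> 'h. (snd p, fst p))" by (intro continuous_intros)
    from continuous_on_compose2[OF kc[OF i] this]
    have "continuous_on UNIV (\<lambda>p. complex_of_real (mean (snd i) (invol H (snd p)) (fst p)))" by simp
    from radon_continuous_parameter_integral(1)[OF sets_haar this Q[OF i] \<psi>[OF i] \<psi>0]
    have "continuous_on UNIV (\<lambda>y. complex_of_real (\<integral>x. F i (x, y) \<partial>m))"
      by (simp add: F_def flip: of_real_mult)
    from continuous_on_Re[OF this] show ?thesis by simp
  qed
  have innerc: "open {y. t < (\<integral>\<^sup>+x. ennreal (F i (x, y)) \<partial>m)}" if i: "i \<in> I" for i t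
  proof -
    have "{y. t < ennreal (\<integral>x. F i (x, y) \<partial>m)} = {y. t < (\<integral>\<^sup>+x. ennreal (F i (x, y)) \<partial>m)}" by (simp add: Fnn[OF i])
    then show ?thesis using open_ennreal_continuous[OF Fint_cont[OF i]] by metis
  qed
  show "open {y. t < (\<integral>\<^sup>+x. indicator V x * emeasure (pt (invol H x) y) U \<partial>m)}" for t
  proof -
    have "{y. t < (SUP i\<in>I. \<integral>\<^sup>+x. ennreal (F i (x, y)) \<partial>m)} = (\<Union>i\<in>I. {y. t < (\<integral>\<^sup>+x. ennreal (F i (x, y)) \<partial>m)})" by (auto simp: less_SUP_iff)
    then show ?thesis unfolding inner using innerc by auto
  qed
  have "(\<integral>\<^sup>+y. (\<integral>\<^sup>+x. indicator V x * emeasure (pt (invol H x) y) U \<partial>m) \<partial>m) = (SUP i\<in>I. \<integral>\<^sup>+y. (\<integral>\<^sup>+x. ennreal (F i (x, y)) \<partial>m) \<partial>m)"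
    unfolding inner
  proof (rule radon_nn_integral_directed_SUP[OF radon_haar I innerc])
    show "\<exists>k\<in>I. \<forall>y. (\<integral>\<^sup>+x. ennreal (F i (x, y)) \<partial>m) \<le> (\<integral>\<^sup>+x. ennreal (F k (x, y)) \<partial>m) \<and>
        (\<integral>\<^sup>+x. ennreal (F j (x, y)) \<partial>m) \<le> (\<integral>\<^sup>+x. ennreal (F k (x, y)) \<partial>m)" if ij: "i \<in> I" "j \<in> I" for i j
    proof -
      obtain k where "k \<in> I" "\<forall>p. ennreal (F i p) \<le> ennreal (F k p) \<and> ennreal (F j p) \<le> ennreal (F k p)"
        using dir[OF ij] by blast
      then show ?thesis by (intro bexI[of _ k] allI conjI nn_integral_mono) auto
    qed
  qed
  also have "\<dots> \<le> emeasure m V * emeasure m U"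
  proof (rule SUP_least)
    fix i assume i: "i \<in> I"
    \<comment> \<open>For \<open>x\<close> in \<open>Q i\<close>, the function \<open>y \<mapsto> \<phi>(x'y)\<close> vanishes off \<open>K\<close>.\<close>
    define K where "K = set_conv (Q i) (closure {t. snd i t \<noteq> 0})"
    have K: "compact K" unfolding K_def by (rule compact_set_conv[OF Q[OF i] bumpD(4)[OF Ib(2)[OF i]]])
    have supp: "x \<notin> Q i \<or> mean (snd i) (invol H x) y = 0" if "y \<notin> K" for x y
      using that mean_support(1)[OF Ib(2)[OF i], of "invol H x" y] unfolding K_def set_conv_def invol_invol by blast
    define J where "J y = (\<integral>x. F i (x, y) \<partial>m)" for y
    have J0: "J y = 0" if "y \<notin> K" for y
    proof -
      have "F i (x, y) = 0" for x using supp[OF that, of x] Q0[of x i] by (auto simp: F_def)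
      then show ?thesis by (simp add: J_def)
    qed
    have Jpos: "J y \<ge> 0" for y unfolding J_def by (rule integral_nonneg_AE) (simp add: Fpos[OF i])
    have Ji: "integrable m J" unfolding J_def[abs_def]
      by (rule integrable_compact_support[OF Fint_cont[OF i] K]) (use J0 in \<open>simp add: J_def\<close>)
    have "integrable m (indicator K :: 'h \<Rightarrow> real)"
      using radon_restrict_compact(1)[OF radon_haar K] radon_compact_finite[OF radon_haar K]
      by (intro integrable_real_indicator) auto
    then have "integrable m (\<lambda>y. complex_of_real (indicator K y))" by simp
    from fubini_compact[OF radon_haar radon_haar kc[OF i] Q[OF i] K \<psi>[OF i] \<psi>0 this]
    have "complex_of_real (\<integral>y. indicator K y * J y \<partial>m) =
        complex_of_real (\<integral>x. fst i x * (\<integral>y. indicator K y * mean (snd i) (invol H x) y \<partial>m) \<partial>m)"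
      by (simp add: J_def F_def flip: of_real_mult)
    then have "(\<integral>y. indicator K y * J y \<partial>m) = (\<integral>x. fst i x * (\<integral>y. indicator K y * mean (snd i) (invol H x) y \<partial>m) \<partial>m)"
      by (simp only: of_real_eq_iff)
    moreover have "(\<lambda>y. indicator K y * J y) = J"
    proof
      show "indicator K y * J y = J y" for y using J0[of y] by (cases "y \<in> K") simp_all
    qed
    moreover have "fst i x * (\<integral>y. indicator K y * mean (snd i) (invol H x) y \<partial>m) = fst i x * (\<integral>y. snd i y \<partial>m)" for x
    proof (cases "x \<in> Q i")
      case True
      then have "(\<lambda>y. indicator K y * mean (snd i) (invol H x) y) = mean (snd i) (invol H x)"
        using supp[of _ x] by (auto simp: indicator_def fun_eq_iff)
      then show ?thesis by (simp add: haar_mean[OF Ib(2)[OF i]])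
    qed (simp add: Q0)
    ultimately have "(\<integral>y. J y \<partial>m) = (\<integral>x. fst i x \<partial>m) * (\<integral>y. snd i y \<partial>m)" by simp
    moreover have "(\<integral>x. fst i x \<partial>m) \<ge> 0" "(\<integral>y. snd i y \<partial>m) \<ge> 0"
      by (rule integral_nonneg_AE, simp add: bumpD(2)[OF Ib(1)[OF i]] bumpD(2)[OF Ib(2)[OF i]])+
    ultimately have "(\<integral>\<^sup>+y. ennreal (J y) \<partial>m) = (\<integral>\<^sup>+x. ennreal (fst i x) \<partial>m) * (\<integral>\<^sup>+y. ennreal (snd i y) \<partial>m)"
      using nn_integral_eq_integral[OF Ji] Jpos
      by (simp add: bump_nn_integral[OF Ib(1)[OF i]] bump_nn_integral[OF Ib(2)[OF i]] ennreal_mult)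
    also have "\<dots> \<le> emeasure m V * emeasure m U"
      by (intro mult_mono bump_nn_integral_le Ib i V U) auto
    finally show "(\<integral>\<^sup>+y. (\<integral>\<^sup>+x. ennreal (F i (x, y)) \<partial>m) \<partial>m) \<le> emeasure m V * emeasure m U"
      by (simp add: Fnn[OF i] J_def)
  qed
  finally show "(\<integral>\<^sup>+y. (\<integral>\<^sup>+x. indicator V x * emeasure (pt (invol H x) y) U \<partial>m) \<partial>m) \<le> emeasure m V * emeasure m U" .
qed

text \<open>If \<open>W\<close> is a null set and \<open>\<phi>\<close> is supported in \<open>W\<close>, then all translates of \<open>\<phi>\<close> have integral \<open>0\<close>. Some
  translate is positive at any given point, so every point has a null neighbourhood and \<open>m\<close> vanishes on
  compact sets, contrary to \<open>m \<noteq> 0\<close>.\<close>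

lemma haar_open_pos:
  assumes W: "open W" "W \<noteq> {}"
  shows "emeasure m W \<noteq> 0"
proof
  assume null: "emeasure m W = 0"
  obtain z where z: "z \<in> W" using W(2) by blast
  obtain \<phi> where \<phi>: "\<phi> \<in> bump W" "\<phi> z = 1"
    using urysohn_bump[OF locally_compact, of "{z}" W] W z by auto
  have "(\<integral>\<^sup>+x. ennreal (\<phi> x) \<partial>m) = 0" using bump_nn_integral_le[OF \<phi>(1) W(1)] null by simp
  then have int0: "(\<integral>x. \<phi> x \<partial>m) = 0"
  proof -
    have "(\<integral>x. \<phi> x \<partial>m) \<ge> 0" by (rule integral_nonneg_AE) (simp add: bumpD(2)[OF \<phi>(1)])
    then show ?thesis using \<open>(\<integral>\<^sup>+x. ennreal (\<phi> x) \<partial>m) = 0\<close> bump_nn_integral[OF \<phi>(1)] by (simp add: ennreal_eq_0_iff)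
  qed
  \<comment> \<open>A translate of \<open>\<phi>\<close> that is positive at \<open>y\<close> is positive on a neighbourhood of \<open>y\<close>.\<close>
  have nbhd: "\<exists>N. open N \<and> y \<in> N \<and> emeasure m N = 0" for y
  proof -
    \<comment> \<open>The translation by this \<open>x\<close> moves \<open>y\<close> to \<open>z\<close>.\<close>
    obtain x where x: "x \<in> supp z (invol H y)" using supp_nonempty by blast
    then have zs: "z \<in> supp x y" using supp_exchange[OF x] by (simp add: invol_invol)
    define N where "N = {v. 0 < mean \<phi> x v}"
    have N: "open N" unfolding N_def by (rule open_Collect_less[OF continuous_on_const mean_continuous_right[OF \<phi>(1)]])
    have "0 < mean \<phi> x y" unfolding mean_def
      using \<phi> bumpD(2)[OF \<phi>(1)] by (intro mean_pos_supp[OF zs bumpD(1)[OF \<phi>(1)]] bump_pt_integrable[OF \<phi>(1)]) auto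
    moreover have "emeasure m N = 0"
    proof -
      have "(\<integral>v. mean \<phi> x v \<partial>m) = 0" using haar_mean[OF \<phi>(1)] int0 by simp
      then have "AE v in m. mean \<phi> x v = 0"
        using integral_nonneg_eq_0_iff_AE[OF mean_integrable[OF \<phi>(1)]] mean_bounds(1)[OF \<phi>(1)] by simp
      then have "AE v in m. v \<notin> N" by eventually_elim (simp add: N_def)
      then show ?thesis using N by (subst (asm) AE_iff_measurable[of N]) (auto simp: sets_haar)
    qed
    ultimately show ?thesis using N by (auto simp: N_def)
  qed
  then obtain N where N: "\<And>y. open (N y) \<and> y \<in> N y \<and> emeasure m (N y) = 0" by metis
  have "emeasure m K = 0" if K: "compact K" for K
  proof -
    obtain D where D: "D \<subseteq> K" "finite D" "K \<subseteq> (\<Union>y\<in>D. N y)"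
      by (rule compactE_image[OF K, of K N]) (use N in auto)
    have "emeasure m K \<le> emeasure m (\<Union>y\<in>D. N y)" using D N by (intro emeasure_mono) (auto simp: sets_haar)
    also have "\<dots> \<le> (\<Sum>y\<in>D. emeasure m (N y))" using D N by (intro emeasure_subadditive_finite) (auto simp: sets_haar)
    also have "\<dots> = 0" using N by simp
    finally show ?thesis by simp
  qed
  then have "(SUP K\<in>{K. compact K \<and> K \<subseteq> UNIV}. emeasure m K) \<le> 0" by (intro SUP_least) auto
  moreover have "emeasure m UNIV = (SUP K\<in>{K. compact K \<and> K \<subseteq> UNIV}. emeasure m K)"
    using radon_haar unfolding radon_def by (elim conjE) (drule spec[of _ UNIV], simp)
  moreover have "emeasure m UNIV \<noteq> 0" using haar unfolding left_haar_measure_def by blast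
  ultimately show False by simp
qed

text \<open>Take \<open>\<phi>\<close> with values in \<open>[0, 1]\<close> and compact support \<open>C\<close> whose integral exceeds half of the total mass.
  A translate has the same integral, so the product of the two cannot vanish everywhere: their sum would be at
  most \<open>1\<close>, yet have an integral above the total mass. So every
  \<open>x\<close> moves some point of \<open>C\<close> into \<open>C\<close>, and the space is the compact product of \<open>C\<close> and its involution.\<close>

lemma finite_haar_imp_compact:
  assumes fin: "emeasure m UNIV < \<infinity>"
  shows "compact (UNIV :: 'h set)"
proof -
  have "emeasure m UNIV \<noteq> 0" using haar unfolding left_haar_measure_def by blast
  define M where "M = measure m UNIV"
  have M: "emeasure m UNIV = ennreal M" using fin by (simp add: M_def emeasure_eq_ennreal_measure)
  have Mpos: "M > 0" using \<open>emeasure m UNIV \<noteq> 0\<close> unfolding M by (metis ennreal_neg linorder_not_le)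
  have "emeasure m UNIV = (SUP K\<in>{K. compact K \<and> K \<subseteq> UNIV}. emeasure m K)"
    using radon_haar unfolding radon_def by (elim conjE) (drule spec[of _ UNIV], simp)
  moreover have "ennreal (M/2) < emeasure m UNIV" using Mpos unfolding M by (simp add: ennreal_less_iff)
  ultimately obtain K where K: "compact K" "ennreal (M/2) < emeasure m K" by (auto simp: less_SUP_iff)
  obtain \<phi> where \<phi>: "\<phi> \<in> bump UNIV" "\<And>x. x \<in> K \<Longrightarrow> \<phi> x = 1"
    using urysohn_bump[OF locally_compact K(1), of UNIV] by auto
  have "emeasure m K = (\<integral>\<^sup>+x. indicator K x \<partial>m)"
    using borel_closed[OF compact_imp_closed[OF K(1)]] by (simp add: sets_haar)
  also have "\<dots> \<le> (\<integral>\<^sup>+x. ennreal (\<phi> x) \<partial>m)" using \<phi>(2) by (intro nn_integral_mono) (auto simp: indicator_def)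
  finally have "ennreal (M/2) < ennreal (\<integral>x. \<phi> x \<partial>m)" using K(2) bump_nn_integral[OF \<phi>(1)] by simp
  then have half: "M/2 < (\<integral>x. \<phi> x \<partial>m)" using Mpos by (simp add: ennreal_less_iff)
  define C where "C = closure {x. \<phi> x \<noteq> 0}"
  have C: "compact C" unfolding C_def by (rule bumpD(4)[OF \<phi>(1)])
  have "x \<in> set_conv C (invol H ` C)" for x
  proof -
    have "\<exists>y. \<phi> y \<noteq> 0 \<and> mean \<phi> x y \<noteq> 0"
    proof (rule ccontr)
      assume no: "\<nexists>y. \<phi> y \<noteq> 0 \<and> mean \<phi> x y \<noteq> 0"
      have le1: "\<phi> y + mean \<phi> x y \<le> 1" for y
        using no bumpD(3)[OF \<phi>(1), of y] mean_bounds(2)[OF \<phi>(1), of x y] by (cases "\<phi> y = 0") auto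
      have "(\<integral>y. \<phi> y + mean \<phi> x y \<partial>m) \<le> (\<integral>y. 1 \<partial>m)"
        using le1 fin by (intro integral_mono Bochner_Integration.integrable_add bump_integrable[OF \<phi>(1)] mean_integrable[OF \<phi>(1)])
          (auto simp: finite_measure.emeasure_finite intro!: finite_measure.integrable_const finite_measureI)
      also have "\<dots> = M" by (simp add: M_def)
      also have "(\<integral>y. \<phi> y + mean \<phi> x y \<partial>m) = 2 * (\<integral>y. \<phi> y \<partial>m)"
        by (simp add: Bochner_Integration.integral_add[OF bump_integrable[OF \<phi>(1)] mean_integrable[OF \<phi>(1)]] haar_mean[OF \<phi>(1)])
      finally show False using half by simp
    qed
    then obtain y where y: "\<phi> y \<noteq> 0" "mean \<phi> x y \<noteq> 0" by blast
    have "y \<in> C" unfolding C_def by (rule nonzero_in_closure[of \<phi>, OF y(1)])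
    then show ?thesis using mean_support(2)[OF \<phi>(1) y(2)] unfolding C_def[symmetric] set_conv_def by blast
  qed
  then have "UNIV = set_conv C (invol H ` C)" by auto
  moreover have "compact (set_conv C (invol H ` C))"
    by (intro compact_set_conv C compact_continuous_image continuous_on_subset[OF invol_continuous]) simp
  ultimately show ?thesis by simp
qed

text \<open>Jensen's inequality for a probability measure. If \<open>k\<close> is not integrable, the value \<open>k(xy)\<close> is the
  default \<open>0\<close>.\<close>

lemma hval_norm_square:
  assumes k: "k \<in> borel_measurable borel"
  shows "ennreal ((norm (hval H k x y))\<^sup>2) \<le> (\<integral>\<^sup>+t. ennreal ((norm (k t))\<^sup>2) \<partial>pt x y)"
proof (cases "integrable (pt x y) k")
  case True
  have nm: "(\<lambda>t. ennreal (norm (k t))) \<in> borel_measurable (pt x y)"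
    using k by (simp add: pt_measurable_iff)
  have "ennreal (norm (hval H k x y)) \<le> (\<integral>\<^sup>+t. ennreal (norm (k t)) \<partial>pt x y)"
    unfolding hval_def pt_def[symmetric] by (rule integral_norm_bound_ennreal[OF True])
  then have "(ennreal (norm (hval H k x y)))\<^sup>2 \<le> (\<integral>\<^sup>+t. ennreal (norm (k t)) * 1 \<partial>pt x y)\<^sup>2"
    by (intro power_mono) auto
  also have "\<dots> \<le> (\<integral>\<^sup>+t. (ennreal (norm (k t)))\<^sup>2 \<partial>pt x y) * (\<integral>\<^sup>+t. 1\<^sup>2 \<partial>pt x y)"
    by (rule Cauchy_Schwarz_nn_integral[OF nm]) simp
  also have "\<dots> = (\<integral>\<^sup>+t. ennreal ((norm (k t))\<^sup>2) \<partial>pt x y)" by (simp add: ennreal_power)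
  finally show ?thesis by (simp add: ennreal_power)
next
  case False
  then show ?thesis by (simp add: hval_def pt_def[symmetric] not_integrable_integral_eq)
qed

lemma suminf_prod_ennreal:
  fixes a b :: "nat \<Rightarrow> ennreal"
  shows "(\<Sum>j. a j) * (\<Sum>i. b i) = (\<Sum>j. \<Sum>i. a j * b i)"
  unfolding ennreal_suminf_multc[of a "\<Sum>i. b i", symmetric]
  by (rule suminf_cong) (rule ennreal_suminf_cmult[symmetric])

text \<open>Boundedness of \<open>\<lambda>(g)\<close> on \<open>L\<^sup>2\<close>, in a quantitative form. By the Cauchy-Schwarz inequality
  \<open>\<bar>\<lambda>(g)k(y)\<bar>\<^sup>2\<close> is at most \<open>\<parallel>g\<parallel>\<^sub>1\<close> times the integral of \<open>\<bar>g(x)\<bar> \<bar>k\<bar>\<^sup>2(x'y)\<close> over \<open>x\<close>, where \<open>x'\<close> is the involution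
  of \<open>x\<close>. The latter function of \<open>(x, y)\<close> need not be jointly measurable, so \<open>\<bar>g\<bar>\<close> and \<open>\<bar>k\<bar>\<^sup>2\<close> are replaced by
  series of indicators of open sets, to which the integrated invariance applies term by term.
  The bound is independent of \<open>k\<close> in the unit ball because \<open>\<parallel>k\<parallel>\<^sub>2\<^sup>2 \<le> 1\<close> bounds the series for \<open>\<bar>k\<bar>\<^sup>2\<close> by \<open>4\<close>.\<close>

lemma left_reg_square_bound:
  assumes g: "integrable m g"
  obtains B where "B \<ge> 0" "\<And>k. k \<in> L2 m \<Longrightarrow> L2_norm m k \<le> 1 \<Longrightarrow>
    (\<integral>\<^sup>+y. ennreal ((norm (left_reg_L1 H m g k y))\<^sup>2) \<partial>m) \<le> ennreal B"
proof -
  have gm: "g \<in> borel_measurable borel" using borel_measurable_integrable[OF g] by (simp add: haar_measurable_iff)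
  define N where "N = (\<integral>\<^sup>+x. ennreal (norm (g x)) \<partial>m)"
  have N: "N < \<infinity>" using g unfolding N_def integrable_iff_bounded by simp
  have ngm: "(\<lambda>x. norm (g x)) \<in> borel_measurable borel" using gm by measurable
  obtain d :: "nat \<Rightarrow> real" and V where V: "\<And>n. open (V n)" and d: "\<And>n. d n \<ge> 0"
    and dV: "\<And>x. ennreal (norm (g x)) \<le> (\<Sum>n. ennreal (d n) * indicator (V n) x)"
    and dVm': "(\<Sum>n. ennreal (d n) * emeasure m (V n)) \<le> 2 * (\<integral>\<^sup>+x. ennreal (norm (g x)) \<partial>m) + 2"
    by (rule radon_open_majorant[OF radon_haar ngm norm_ge_zero N[unfolded N_def]]) (rule that)
  note dVm = dVm'[folded N_def]
  define \<Gamma> where "\<Gamma> = (\<Sum>n. ennreal (d n) * emeasure m (V n))"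
  have "2 * N + 2 < \<infinity>" using N by (simp add: ennreal_mult_less_top)
  then have \<Gamma>: "\<Gamma> < \<infinity>" using dVm unfolding \<Gamma>_def by (rule le_less_trans[rotated])
  define C where "C = N * (\<Gamma> * 4)"
  have C: "C < \<infinity>" using N \<Gamma> by (simp add: C_def ennreal_mult_less_top)
  show thesis
  proof (rule that[of "enn2real C"])
    show "enn2real C \<ge> 0" by simp
    fix k assume k: "k \<in> L2 m" "L2_norm m k \<le> 1"
    have km: "k \<in> borel_measurable borel" using k by (simp add: L2_def haar_measurable_iff)
    define w where "w t = (norm (k t))\<^sup>2" for t
    have wm: "w \<in> borel_measurable borel" unfolding w_def[abs_def] using km by measurable
    have w0: "w t \<ge> 0" for t by (simp add: w_def)
    have wint: "integrable m w" using k by (simp add: L2_def w_def[abs_def])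
    have "(\<integral>\<^sup>+t. ennreal (w t) \<partial>m) = ennreal (\<integral>t. w t \<partial>m)"
      by (rule nn_integral_eq_integral[OF wint]) (simp add: w0)
    also have "\<dots> \<le> 1" using k(2) by (simp add: L2_norm_def w_def real_sqrt_le_1_iff)
    finally have w1: "(\<integral>\<^sup>+t. ennreal (w t) \<partial>m) \<le> 1" .
    then have wfin: "(\<integral>\<^sup>+t. ennreal (w t) \<partial>m) < \<infinity>" by (auto intro: le_less_trans)
    obtain c :: "nat \<Rightarrow> real" and U where U: "\<And>n. open (U n)" and c: "\<And>n. c n \<ge> 0"
      and cU: "\<And>x. ennreal (w x) \<le> (\<Sum>n. ennreal (c n) * indicator (U n) x)"
      and cUm: "(\<Sum>n. ennreal (c n) * emeasure m (U n)) \<le> 2 * (\<integral>\<^sup>+t. ennreal (w t) \<partial>m) + 2"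
      by (rule radon_open_majorant[OF radon_haar wm w0 wfin]) (rule that)
    have "2 * (\<integral>\<^sup>+t. ennreal (w t) \<partial>m) + 2 \<le> 2 * 1 + 2" using w1 by (intro add_mono mult_left_mono) auto
    then have cU4: "(\<Sum>n. ennreal (c n) * emeasure m (U n)) \<le> 4" using cUm by simp
    define \<kappa> where "\<kappa> j i x y = indicator (V j) x * emeasure (pt (invol H x) y) (U i)" for j i x y
    have \<kappa>x: "(\<lambda>x. \<kappa> j i x y) \<in> borel_measurable m" for j i y
      unfolding haar_measurable_iff \<kappa>_def by (rule lsc_borel_measurable) (rule haar_kernel_lsc[OF V U])
    have \<kappa>y: "(\<lambda>y. \<integral>\<^sup>+x. \<kappa> j i x y \<partial>m) \<in> borel_measurable m" for j i
      unfolding haar_measurable_iff \<kappa>_def by (rule lsc_borel_measurable) (rule haar_kernel_integral_lsc[OF V U])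
    define \<Psi> where "\<Psi> x y = (\<Sum>j. \<Sum>i. ennreal (d j) * ennreal (c i) * \<kappa> j i x y)" for x y
    have pointwise: "ennreal (norm (g x) * (norm (hval H k (invol H x) y))\<^sup>2) \<le> \<Psi> x y" for x y
    proof -
      have "ennreal ((norm (hval H k (invol H x) y))\<^sup>2) \<le> (\<integral>\<^sup>+t. ennreal (w t) \<partial>pt (invol H x) y)"
        unfolding w_def by (rule hval_norm_square[OF km])
      also have "\<dots> \<le> (\<integral>\<^sup>+t. (\<Sum>n. ennreal (c n) * indicator (U n) t) \<partial>pt (invol H x) y)"
        by (intro nn_integral_mono cU)
      also have "\<dots> = (\<Sum>n. \<integral>\<^sup>+t. ennreal (c n) * indicator (U n) t \<partial>pt (invol H x) y)"
        using U by (intro nn_integral_suminf borel_measurable_times_ennreal borel_measurable_const borel_measurable_indicator) simp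
      also have "\<dots> = (\<Sum>n. ennreal (c n) * emeasure (pt (invol H x) y) (U n))"
        using U by (intro suminf_cong nn_integral_cmult_indicator) simp
      finally have b: "ennreal ((norm (hval H k (invol H x) y))\<^sup>2) \<le> (\<Sum>n. ennreal (c n) * emeasure (pt (invol H x) y) (U n))" .
      have "ennreal (norm (g x) * (norm (hval H k (invol H x) y))\<^sup>2) = ennreal (norm (g x)) * ennreal ((norm (hval H k (invol H x) y))\<^sup>2)"
        by (simp add: ennreal_mult)
      also have "\<dots> \<le> (\<Sum>n. ennreal (d n) * indicator (V n) x) * (\<Sum>n. ennreal (c n) * emeasure (pt (invol H x) y) (U n))"
        by (intro mult_mono dV b) auto
      also have "\<dots> = \<Psi> x y"
        unfolding suminf_prod_ennreal \<Psi>_def \<kappa>_def by (simp add: mult_ac)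
      finally show ?thesis .
    qed
    have hb: "ennreal ((norm (left_reg_L1 H m g k y))\<^sup>2) \<le> N * (\<integral>\<^sup>+x. \<Psi> x y \<partial>m)" for y
    proof (cases "integrable m (\<lambda>x. g x * hval H k (invol H x) y)")
      case True
      define F where "F x = norm (g x * hval H k (invol H x) y)" for x
      define a where "a x = sqrt (norm (g x))" for x
      \<comment> \<open>This is \<open>sqrt \<bar>g(x)\<bar> \<bar>k(x'y)\<bar>\<close>, written as a quotient of functions known to be measurable; where \<open>g(x) = 0\<close> both sides are \<open>0\<close>.\<close>
      define b where "b x = F x / a x" for x
      have Fm: "F \<in> borel_measurable m" unfolding F_def[abs_def] using borel_measurable_integrable[OF True] by measurable
      have am: "a \<in> borel_measurable m" unfolding a_def[abs_def] haar_measurable_iff using gm by measurable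
      have bm: "b \<in> borel_measurable m" unfolding b_def[abs_def] using Fm am by measurable
      have ab: "F x = a x * b x" for x by (simp add: b_def a_def F_def)
      have a0: "a x \<ge> 0" and b0: "b x \<ge> 0" for x by (simp_all add: a_def b_def F_def)
      have a2: "(a x)\<^sup>2 = norm (g x)" for x by (simp add: a_def)
      have b2: "(b x)\<^sup>2 = norm (g x) * (norm (hval H k (invol H x) y))\<^sup>2" for x
        by (cases "g x = 0") (simp_all add: b_def F_def a_def power_divide norm_mult power_mult_distrib power2_eq_square)
      have "ennreal (norm (left_reg_L1 H m g k y)) \<le> (\<integral>\<^sup>+x. ennreal (F x) \<partial>m)"
        unfolding left_reg_L1_def left_reg_def F_def by (rule integral_norm_bound_ennreal[OF True])
      also have "\<dots> = (\<integral>\<^sup>+x. ennreal (a x) * ennreal (b x) \<partial>m)" by (simp add: ab ennreal_mult a0 b0)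
      finally have "(ennreal (norm (left_reg_L1 H m g k y)))\<^sup>2 \<le> (\<integral>\<^sup>+x. ennreal (a x) * ennreal (b x) \<partial>m)\<^sup>2"
        by (intro power_mono) auto
      also have "\<dots> \<le> (\<integral>\<^sup>+x. (ennreal (a x))\<^sup>2 \<partial>m) * (\<integral>\<^sup>+x. (ennreal (b x))\<^sup>2 \<partial>m)"
        using am bm by (intro Cauchy_Schwarz_nn_integral) auto
      also have "\<dots> = N * (\<integral>\<^sup>+x. ennreal (norm (g x) * (norm (hval H k (invol H x) y))\<^sup>2) \<partial>m)"
        by (simp add: ennreal_power a0 b0 a2 b2 N_def)
      also have "\<dots> \<le> N * (\<integral>\<^sup>+x. \<Psi> x y \<partial>m)" by (intro mult_left_mono nn_integral_mono pointwise) auto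
      finally show ?thesis by (simp add: ennreal_power)
    next
      case False
      then show ?thesis by (simp add: left_reg_L1_def left_reg_def not_integrable_integral_eq)
    qed
    have inner: "(\<integral>\<^sup>+x. \<Psi> x y \<partial>m) = (\<Sum>j. \<Sum>i. ennreal (d j) * ennreal (c i) * (\<integral>\<^sup>+x. \<kappa> j i x y \<partial>m))" for y
    proof -
      have m1: "(\<lambda>x. ennreal (d j) * ennreal (c i) * \<kappa> j i x y) \<in> borel_measurable m" for j i
        by (intro borel_measurable_times_ennreal borel_measurable_const \<kappa>x)
      have "(\<integral>\<^sup>+x. \<Psi> x y \<partial>m) = (\<Sum>j. \<integral>\<^sup>+x. (\<Sum>i. ennreal (d j) * ennreal (c i) * \<kappa> j i x y) \<partial>m)"
        unfolding \<Psi>_def by (intro nn_integral_suminf borel_measurable_suminf_order m1)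
      also have "\<dots> = (\<Sum>j. \<Sum>i. \<integral>\<^sup>+x. ennreal (d j) * ennreal (c i) * \<kappa> j i x y \<partial>m)"
        by (intro suminf_cong nn_integral_suminf m1)
      also have "\<dots> = (\<Sum>j. \<Sum>i. ennreal (d j) * ennreal (c i) * (\<integral>\<^sup>+x. \<kappa> j i x y \<partial>m))"
        by (intro suminf_cong nn_integral_cmult \<kappa>x)
      finally show ?thesis .
    qed
    have m2: "(\<lambda>y. ennreal (d j) * ennreal (c i) * (\<integral>\<^sup>+x. \<kappa> j i x y \<partial>m)) \<in> borel_measurable m" for j i
      by (intro borel_measurable_times_ennreal borel_measurable_const \<kappa>y)
    have "(\<integral>\<^sup>+y. ennreal ((norm (left_reg_L1 H m g k y))\<^sup>2) \<partial>m) \<le> (\<integral>\<^sup>+y. N * (\<integral>\<^sup>+x. \<Psi> x y \<partial>m) \<partial>m)"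
      by (intro nn_integral_mono hb)
    also have "\<dots> = N * (\<integral>\<^sup>+y. (\<integral>\<^sup>+x. \<Psi> x y \<partial>m) \<partial>m)"
      unfolding inner by (intro nn_integral_cmult borel_measurable_suminf_order m2)
    also have "(\<integral>\<^sup>+y. (\<integral>\<^sup>+x. \<Psi> x y \<partial>m) \<partial>m) = (\<Sum>j. \<integral>\<^sup>+y. (\<Sum>i. ennreal (d j) * ennreal (c i) * (\<integral>\<^sup>+x. \<kappa> j i x y \<partial>m)) \<partial>m)"
      unfolding inner by (intro nn_integral_suminf borel_measurable_suminf_order m2)
    also have "\<dots> = (\<Sum>j. \<Sum>i. \<integral>\<^sup>+y. ennreal (d j) * ennreal (c i) * (\<integral>\<^sup>+x. \<kappa> j i x y \<partial>m) \<partial>m)"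
      by (intro suminf_cong nn_integral_suminf m2)
    also have "\<dots> = (\<Sum>j. \<Sum>i. ennreal (d j) * ennreal (c i) * (\<integral>\<^sup>+y. (\<integral>\<^sup>+x. \<kappa> j i x y \<partial>m) \<partial>m))"
      by (intro suminf_cong nn_integral_cmult \<kappa>y)
    also have "\<dots> \<le> (\<Sum>j. \<Sum>i. ennreal (d j) * ennreal (c i) * (emeasure m (V j) * emeasure m (U i)))"
      unfolding \<kappa>_def by (intro suminf_le mult_left_mono haar_kernel_bound V U) auto
    also have "\<dots> = \<Gamma> * (\<Sum>i. ennreal (c i) * emeasure m (U i))"
      unfolding \<Gamma>_def suminf_prod_ennreal by (simp add: mult_ac)
    also have "N * (\<Gamma> * (\<Sum>i. ennreal (c i) * emeasure m (U i))) \<le> C"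
      unfolding C_def by (intro mult_left_mono cU4) auto
    also have "C = ennreal (enn2real C)" using C by simp
    finally show "(\<integral>\<^sup>+y. ennreal ((norm (left_reg_L1 H m g k y))\<^sup>2) \<partial>m) \<le> ennreal (enn2real C)"
      by (simp add: mult_left_mono)
  qed
qed

text \<open>The supremum in the definition of the norm is over a bounded set of reals, hence an upper bound.\<close>

lemma left_reg_le_Cstar_norm:
  assumes g: "integrable m g" and k: "k \<in> L2 m" "L2_norm m k \<le> 1"
  shows "L2_norm m (left_reg_L1 H m g k) \<le> Cstar_norm H m g"
proof -
  obtain B where B: "B \<ge> 0" "\<And>k. k \<in> L2 m \<Longrightarrow> L2_norm m k \<le> 1 \<Longrightarrow>
    (\<integral>\<^sup>+y. ennreal ((norm (left_reg_L1 H m g k y))\<^sup>2) \<partial>m) \<le> ennreal B"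
    using left_reg_square_bound[OF g] by metis
  have "bdd_above {L2_norm m (left_reg_L1 H m g k) | k. k \<in> L2 m \<and> L2_norm m k \<le> 1}"
  proof (rule bdd_aboveI)
    fix r assume "r \<in> {L2_norm m (left_reg_L1 H m g k) | k. k \<in> L2 m \<and> L2_norm m k \<le> 1}"
    then obtain k where k: "r = L2_norm m (left_reg_L1 H m g k)" "k \<in> L2 m" "L2_norm m k \<le> 1" by blast
    have "(\<integral>y. (norm (left_reg_L1 H m g k y))\<^sup>2 \<partial>m) \<le> B"
    proof (cases "integrable m (\<lambda>y. (norm (left_reg_L1 H m g k y))\<^sup>2)")
      case True
      have "(\<integral>\<^sup>+y. ennreal ((norm (left_reg_L1 H m g k y))\<^sup>2) \<partial>m) = ennreal (\<integral>y. (norm (left_reg_L1 H m g k y))\<^sup>2 \<partial>m)"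
        by (rule nn_integral_eq_integral[OF True]) simp
      then show ?thesis using B(2)[OF k(2,3)] B(1) by simp
    qed (use B(1) in \<open>simp add: not_integrable_integral_eq\<close>)
    then show "r \<le> sqrt B" unfolding k(1) L2_norm_def by (rule real_sqrt_le_mono)
  qed
  then show ?thesis unfolding Cstar_norm_def using k by (intro cSup_upper) auto
qed

section \<open>Positive definite functions of compact support\<close>

abbreviation kern :: "('h \<Rightarrow> real) \<Rightarrow> 'h \<Rightarrow> 'h \<Rightarrow> complex" where
  "kern \<phi> x y \<equiv> complex_of_real (mean \<phi> (invol H x) y)"

definition corr :: "('h \<Rightarrow> real) \<Rightarrow> 'h \<Rightarrow> real" where
  "corr \<phi> x = (\<integral>y. \<phi> y * mean \<phi> (invol H x) y \<partial>m)"

lemma invol_measurable: "invol H \<in> borel \<rightarrow>\<^sub>M borel"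
  by (rule borel_measurable_continuous_onI[OF invol_continuous])

lemma hconv_htilde_eq_corr:
  assumes \<phi>: "\<phi> \<in> bump U"
  shows "hconv H m (\<lambda>x. complex_of_real (\<phi> x)) (htilde H (\<lambda>x. complex_of_real (\<phi> x))) x = complex_of_real (corr \<phi> x)"
proof -
  have \<phi>m: "\<phi> \<in> borel_measurable borel" by (rule borel_measurable_continuous_onI[OF bumpD(1)[OF \<phi>]])
  have "hval H (htilde H (\<lambda>x. complex_of_real (\<phi> x))) (invol H y) x = kern \<phi> x y" for y
  proof -
    have P: "pt (invol H y) x = distr (pt (invol H x) y) borel (invol H)"
      using pt_invol[of y "invol H x"] by (simp add: invol_invol)
    have "hval H (htilde H (\<lambda>x. complex_of_real (\<phi> x))) (invol H y) x = (\<integral>t. complex_of_real (\<phi> (invol H t)) \<partial>pt (invol H y) x)"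
      by (simp add: hval_def htilde_def pt_def)
    also have "\<dots> = (\<integral>t. complex_of_real (\<phi> (invol H (invol H t))) \<partial>pt (invol H x) y)"
      unfolding P
      by (rule integral_distr) (use measurable_compose[OF invol_measurable \<phi>m] invol_measurable in
          \<open>simp_all add: measurable_cong_sets[OF pt_sets refl]\<close>)
    finally show ?thesis by (simp add: invol_invol mean_def)
  qed
  then show ?thesis by (simp add: hconv_def corr_def flip: of_real_mult)
qed

lemma corr_continuous:
  assumes \<phi>: "\<phi> \<in> bump U"
  shows "continuous_on UNIV (corr \<phi>)"
proof -
  define K where "K = closure {x. \<phi> x \<noteq> 0}"
  have K: "compact K" unfolding K_def by (rule bumpD(4)[OF \<phi>])
  have z: "complex_of_real (\<phi> x) = 0" if "x \<notin> K" for x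
    using that bump_outside_closure[of x \<phi>] unfolding K_def by simp
  have "integrable m (\<lambda>x. complex_of_real (\<phi> x))" using bump_integrable[OF \<phi>] by simp
  from radon_continuous_parameter_integral(1)[OF sets_haar continuous_on_of_real[OF mean_invol_continuous[OF \<phi>]] K this z]
  have "continuous_on UNIV (\<lambda>x. complex_of_real (corr \<phi> x))"
    by (simp add: corr_def flip: of_real_mult)
  from continuous_on_Re[OF this] show ?thesis by simp
qed

lemma corr_nonneg: "\<phi> \<in> bump U \<Longrightarrow> corr \<phi> x \<ge> 0"
  unfolding corr_def by (rule integral_nonneg_AE) (simp add: bumpD(2) mean_bounds(1))

lemma corr_compact_support:
  assumes \<phi>: "\<phi> \<in> bump U"
  obtains Q where "compact Q" "\<And>x y. \<phi> y \<noteq> 0 \<Longrightarrow> mean \<phi> (invol H x) y \<noteq> 0 \<Longrightarrow> x \<in> Q" "\<And>x. x \<notin> Q \<Longrightarrow> corr \<phi> x = 0"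
proof -
  define K where "K = closure {x. \<phi> x \<noteq> 0}"
  have K: "compact K" unfolding K_def by (rule bumpD(4)[OF \<phi>])
  define Q where "Q = invol H ` set_conv K (invol H ` K)"
  have Q: "compact Q" unfolding Q_def
    by (intro compact_continuous_image compact_set_conv K continuous_on_subset[OF invol_continuous]) auto
  have mem: "x \<in> Q" if "\<phi> y \<noteq> 0" "mean \<phi> (invol H x) y \<noteq> 0" for x y
  proof -
    have "y \<in> K" unfolding K_def by (rule nonzero_in_closure[of \<phi>, OF that(1)])
    then have "invol H x \<in> set_conv K (invol H ` K)"
      using mean_support(2)[OF \<phi> that(2)] unfolding K_def[symmetric] set_conv_def by blast
    then show ?thesis unfolding Q_def using invol_invol[of x] by (metis imageI)
  qed
  have "corr \<phi> x = 0" if "x \<notin> Q" for x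
  proof -
    have "(\<lambda>y. \<phi> y * mean \<phi> (invol H x) y) = (\<lambda>_. 0)" using mem that by (auto simp: fun_eq_iff)
    then show ?thesis by (simp add: corr_def)
  qed
  with Q mem show thesis by (rule that)
qed

lemma corr_integrable: "\<phi> \<in> bump U \<Longrightarrow> integrable m (corr \<phi>)"
  by (metis corr_compact_support corr_continuous integrable_compact_support)

lemma corr_bounded:
  assumes \<phi>: "\<phi> \<in> bump U"
  obtains B where "\<And>x. \<bar>corr \<phi> x\<bar> \<le> B"
proof -
  obtain Q where Q: "compact Q" "\<And>x. x \<notin> Q \<Longrightarrow> corr \<phi> x = 0" using corr_compact_support[OF \<phi>] by metis
  have "compact (corr \<phi> ` Q)" by (rule compact_continuous_image[OF continuous_on_subset[OF corr_continuous[OF \<phi>]] Q(1)]) simp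
  then obtain B where "\<forall>z\<in>corr \<phi> ` Q. norm z \<le> B" using compact_imp_bounded bounded_iff by blast
  then have "\<bar>corr \<phi> x\<bar> \<le> max B 0" for x using Q(2)[of x] by (cases "x \<in> Q") (auto simp: le_max_iff_disj)
  then show thesis by (rule that)
qed

text \<open>The integrand is continuous and nonnegative, and at \<open>y = x\<close> it is positive: the identity lies in
  the support of \<open>x' x\<close>, where \<open>x'\<close> is the involution of \<open>x\<close>, and \<open>\<phi>\<close> is positive there.\<close>

lemma corr_pos:
  assumes \<phi>: "\<phi> \<in> bump U" and x: "\<phi> x > 0" and e: "\<phi> (ident H) > 0"
  shows "corr \<phi> x > 0"
proof (rule ccontr)
  assume "\<not> ?thesis"
  then have 0: "corr \<phi> x = 0" using corr_nonneg[OF \<phi>, of x] by simp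
  define F where "F y = \<phi> y * mean \<phi> (invol H x) y" for y
  have Fc: "continuous_on UNIV F"
    unfolding F_def[abs_def] by (intro continuous_on_mult bumpD(1)[OF \<phi>] mean_continuous_right[OF \<phi>])
  have F0: "F y \<ge> 0" for y using bumpD(2)[OF \<phi>] mean_bounds(1)[OF \<phi>] by (simp add: F_def)
  define K where "K = closure {x. \<phi> x \<noteq> 0}"
  have "integrable m F"
    by (rule integrable_compact_support[OF Fc bumpD(4)[OF \<phi>, folded K_def]])
      (use bump_outside_closure[of _ \<phi>] in \<open>simp add: F_def flip: K_def\<close>)
  then have ae: "AE y in m. F y = 0"
    using integral_nonneg_eq_0_iff_AE[of m F] F0 0[unfolded corr_def, folded F_def] by simp
  define W where "W = {y. 0 < F y}"
  have W: "open W" unfolding W_def by (rule open_Collect_less[OF continuous_on_const Fc])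
  have "ident H \<in> supp (invol H x) x" unfolding supp_def ident_in_supp ..
  then have "mean \<phi> (invol H x) x > 0"
    unfolding mean_def using e bumpD(2)[OF \<phi>]
    by (intro mean_pos_supp[OF _ bumpD(1)[OF \<phi>]] bump_pt_integrable[OF \<phi>]) auto
  then have "x \<in> W" using x by (simp add: W_def F_def)
  then have "emeasure m W \<noteq> 0" using haar_open_pos[OF W] by blast
  moreover have "AE y in m. y \<notin> W" using ae by eventually_elim (simp add: W_def)
  then have "emeasure m W = 0" using W by (subst (asm) AE_iff_measurable[of W]) (auto simp: sets_haar)
  ultimately show False by simp
qed

text \<open>The \<open>L\<^sup>2\<close> norm of a function that is not measurable would be the default value \<open>0\<close>, so measurability of
  \<open>\<lambda>(g)\<phi>\<close> has to be known. Truncating \<open>g\<close> to compact sets gives continuous functions of \<open>y\<close> that converge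
  uniformly.\<close>

lemma left_reg_bump_measurable:
  assumes \<phi>: "\<phi> \<in> bump U" and g: "integrable m g"
  shows "(\<lambda>y. \<integral>x. g x * kern \<phi> x y \<partial>m) \<in> borel_measurable m"
    and "integrable m (\<lambda>x. g x * kern \<phi> x y)"
proof -
  have Fs: "continuous_on UNIV (\<lambda>p. complex_of_real (mean \<phi> (invol H (snd p)) (fst p)))"
  proof (intro continuous_on_of_real)
    have "continuous_on UNIV (\<lambda>p::'h \<times> 'h. (snd p, fst p))" by (intro continuous_intros)
    from continuous_on_compose2[OF mean_invol_continuous[OF \<phi>] this]
    show "continuous_on UNIV (\<lambda>p. mean \<phi> (invol H (snd p)) (fst p))" by simp
  qed
  have int: "integrable m (\<lambda>x. f x * kern \<phi> x y)" if f: "integrable m f" for f y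
  proof (rule Bochner_Integration.integrable_bound[OF f])
    have "continuous_on UNIV (\<lambda>x. kern \<phi> x y)"
      by (intro continuous_on_of_real continuous_on_compose2[OF mean_continuous_left[OF \<phi>] invol_continuous]) auto
    then have "(\<lambda>x. kern \<phi> x y) \<in> borel_measurable m"
      unfolding haar_measurable_iff by (rule borel_measurable_continuous_onI)
    then show "(\<lambda>x. f x * kern \<phi> x y) \<in> borel_measurable m"
      by (rule borel_measurable_times[OF borel_measurable_integrable[OF f]])
    show "AE x in m. norm (f x * kern \<phi> x y) \<le> norm (f x)"
      using mean_bounds[OF \<phi>] by (intro AE_I2) (simp add: norm_mult mult_left_le)
  qed
  then show "integrable m (\<lambda>x. g x * kern \<phi> x y)" using g by blast
  have "\<exists>Q. compact Q \<and> (\<integral>x. norm (g x - indicator Q x * g x) \<partial>m) \<le> 1 / real (Suc n)" for n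
    by (rule radon_integrable_tight[OF locally_compact radon_haar g, of "1 / real (Suc n)"]) auto
  then obtain Q where Q: "\<And>n. compact (Q n)" "\<And>n. (\<integral>x. norm (g x - indicator (Q n) x * g x) \<partial>m) \<le> 1 / real (Suc n)" by metis
  have gQ: "integrable m (\<lambda>x. indicator (Q n) x * g x)" for n
  proof -
    have "(\<lambda>x. indicator (Q n) x *\<^sub>R g x) = (\<lambda>x. indicator (Q n) x * g x)" by (auto simp: indicator_def)
    then show ?thesis
      using integrable_mult_indicator[OF radon_restrict_compact(1)[OF radon_haar Q(1)[of n]] g] by simp
  qed
  define hn where "hn n y = (\<integral>x. (indicator (Q n) x * g x) * kern \<phi> x y \<partial>m)" for n y
  have hn: "hn n \<in> borel_measurable m" for n
    using radon_continuous_parameter_integral(1)[OF sets_haar Fs Q(1)[of n] gQ[of n]]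
    unfolding hn_def[abs_def] haar_measurable_iff by (intro borel_measurable_continuous_onI) simp
  show "(\<lambda>y. \<integral>x. g x * kern \<phi> x y \<partial>m) \<in> borel_measurable m"
  proof (rule borel_measurable_LIMSEQ_metric[where f = hn, OF hn])
    fix y
    let ?h = "\<integral>x. g x * kern \<phi> x y \<partial>m"
    have close: "norm (hn n y - ?h) \<le> 1 / real (Suc n)" for n
    proof -
      have "norm (hn n y - ?h) = norm (?h - hn n y)" by (rule norm_minus_commute)
      also have "?h - hn n y = (\<integral>x. g x * kern \<phi> x y - (indicator (Q n) x * g x) * kern \<phi> x y \<partial>m)"
        unfolding hn_def by (rule Bochner_Integration.integral_diff[symmetric]) (intro int g gQ)+
      also have "norm \<dots> \<le> (\<integral>x. norm (g x * kern \<phi> x y - (indicator (Q n) x * g x) * kern \<phi> x y) \<partial>m)"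
        by (rule integral_norm_bound)
      also have "\<dots> \<le> (\<integral>x. norm (g x - indicator (Q n) x * g x) \<partial>m)"
      proof (rule integral_mono)
        show "integrable m (\<lambda>x. norm (g x * kern \<phi> x y - (indicator (Q n) x * g x) * kern \<phi> x y))"
          by (intro integrable_norm Bochner_Integration.integrable_diff int g gQ)
        show "integrable m (\<lambda>x. norm (g x - indicator (Q n) x * g x))"
          by (intro integrable_norm Bochner_Integration.integrable_diff g gQ)
        fix x
        have "norm (g x * kern \<phi> x y - (indicator (Q n) x * g x) * kern \<phi> x y)
          = norm (g x - indicator (Q n) x * g x) * mean \<phi> (invol H x) y"
          using mean_bounds(1)[OF \<phi>] by (simp flip: left_diff_distrib add: norm_mult)
        also have "\<dots> \<le> norm (g x - indicator (Q n) x * g x)"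
          using mean_bounds[OF \<phi>] by (intro mult_left_le) auto
        finally show "norm (g x * kern \<phi> x y - (indicator (Q n) x * g x) * kern \<phi> x y)
          \<le> norm (g x - indicator (Q n) x * g x)" .
      qed
      also have "\<dots> \<le> 1 / real (Suc n)" by (rule Q(2))
      finally show ?thesis .
    qed
    show "(\<lambda>n. hn n y) \<longlonglongrightarrow> ?h"
    proof (rule LIM_zero_cancel, rule Lim_null_comparison)
      show "(\<lambda>n. 1 / real (Suc n)) \<longlonglongrightarrow> 0" using LIMSEQ_inverse_real_of_nat by (simp add: inverse_eq_divide)
      show "\<forall>\<^sub>F n in sequentially. norm (hn n y - ?h) \<le> 1 / real (Suc n)" using close by simp
    qed
  qed
qed

text \<open>The pairing of \<open>\<phi> * \<phi>\<^sup>~\<close> with \<open>g\<close> is the matrix coefficient of \<open>\<lambda>(g)\<close> at \<open>\<phi>\<close>. As \<open>\<phi>\<close> has compact support,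
  only the values of \<open>g\<close> on a compact set enter on either side, and Fubini's theorem on compact rectangles
  suffices.\<close>

lemma corr_pairing:
  assumes \<phi>: "\<phi> \<in> bump U" and g: "integrable m g"
  shows "(\<integral>x. complex_of_real (corr \<phi> x) * g x \<partial>m) =
    (\<integral>y. complex_of_real (\<phi> y) * (\<integral>x. g x * kern \<phi> x y \<partial>m) \<partial>m)"
proof -
  obtain Q where Q: "compact Q" and QM: "\<And>x y. \<phi> y \<noteq> 0 \<Longrightarrow> mean \<phi> (invol H x) y \<noteq> 0 \<Longrightarrow> x \<in> Q"
    and Q0: "\<And>x. x \<notin> Q \<Longrightarrow> corr \<phi> x = 0" using corr_compact_support[OF \<phi>] by metis
  define K where "K = closure {x. \<phi> x \<noteq> 0}"
  have K: "compact K" unfolding K_def by (rule bumpD(4)[OF \<phi>])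
  have z: "complex_of_real (\<phi> x) = 0" if "x \<notin> K" for x
    using that bump_outside_closure[of x \<phi>] unfolding K_def by simp
  define g' where "g' x = indicator Q x *\<^sub>R g x" for x
  have g': "integrable m g'" unfolding g'_def[abs_def]
    by (rule integrable_mult_indicator[OF radon_restrict_compact(1)[OF radon_haar Q] g])
  have g'0: "g' x = 0" if "x \<notin> Q" for x using that by (simp add: g'_def)
  have \<phi>i: "integrable m (\<lambda>x. complex_of_real (\<phi> x))" using bump_integrable[OF \<phi>] by simp
  have "(\<integral>y. complex_of_real (\<phi> y) * (\<integral>x. g' x * kern \<phi> x y \<partial>m) \<partial>m) =
      (\<integral>x. g' x * (\<integral>y. complex_of_real (\<phi> y) * kern \<phi> x y \<partial>m) \<partial>m)"
    using fubini_compact[OF radon_haar radon_haar continuous_on_of_real[OF mean_invol_continuous[OF \<phi>]] Q K g' g'0 \<phi>i z] by simp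
  moreover have "complex_of_real (\<phi> y) * (\<integral>x. g' x * kern \<phi> x y \<partial>m) =
      complex_of_real (\<phi> y) * (\<integral>x. g x * kern \<phi> x y \<partial>m)" for y
  proof (cases "\<phi> y = 0")
    case False
    then have "(\<lambda>x. g' x * kern \<phi> x y) = (\<lambda>x. g x * kern \<phi> x y)"
      using QM by (auto simp: g'_def fun_eq_iff indicator_def)
    then show ?thesis by simp
  qed simp
  moreover have "g' x * (\<integral>y. complex_of_real (\<phi> y) * kern \<phi> x y \<partial>m) = complex_of_real (corr \<phi> x) * g x" for x
  proof -
    have "(\<integral>y. complex_of_real (\<phi> y) * kern \<phi> x y \<partial>m) = complex_of_real (corr \<phi> x)"
      by (simp add: corr_def flip: of_real_mult)
    then show ?thesis using Q0[of x] by (cases "x \<in> Q") (simp_all add: g'_def)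
  qed
  ultimately show ?thesis by simp
qed

lemma corr_pairing_bound:
  assumes \<phi>: "\<phi> \<in> bump U"
  obtains C where "\<And>g. integrable m g \<Longrightarrow> norm (\<integral>x. complex_of_real (corr \<phi> x) * g x \<partial>m) \<le> C * Cstar_norm H m g"
proof -
  define fc where "fc x = complex_of_real (\<phi> x)" for x
  have \<phi>sq: "integrable m (\<lambda>x. (\<phi> x)\<^sup>2)"
  proof (rule Bochner_Integration.integrable_bound[OF bump_integrable[OF \<phi>]])
    show "(\<lambda>x. (\<phi> x)\<^sup>2) \<in> borel_measurable m" using borel_measurable_integrable[OF bump_integrable[OF \<phi>]] by measurable
    show "AE x in m. norm ((\<phi> x)\<^sup>2) \<le> norm (\<phi> x)"
      using bumpD(2,3)[OF \<phi>] by (intro AE_I2) (simp add: power2_eq_square mult_left_le)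
  qed
  define S where "S = (\<integral>x. (\<phi> x)\<^sup>2 \<partial>m)"
  have S: "S \<ge> 0" unfolding S_def by (rule integral_nonneg_AE) simp
  \<comment> \<open>Dividing by \<open>c\<close> takes \<open>\<phi>\<close> to the unit ball of \<open>L\<^sup>2\<close>; the maximum avoids division by \<open>0\<close>.\<close>
  define c where "c = max 1 (sqrt S)"
  have c: "c \<ge> 1" "c \<ge> sqrt S" "c > 0" by (simp_all add: c_def)
  define k where "k x = fc x / complex_of_real c" for x
  have nk: "(norm (k x))\<^sup>2 = (\<phi> x)\<^sup>2 / c\<^sup>2" for x
    by (simp add: k_def fc_def norm_divide power_divide)
  have k: "k \<in> L2 m"
  proof -
    have "k \<in> borel_measurable m"
      unfolding k_def[abs_def] fc_def using borel_measurable_integrable[OF bump_integrable[OF \<phi>]] by measurable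
    then show ?thesis using \<phi>sq by (simp add: L2_def nk)
  qed
  have "L2_norm m k = sqrt S / c" using c(3) by (simp add: L2_norm_def nk S_def real_sqrt_divide)
  then have k1: "L2_norm m k \<le> 1" using c by (simp add: divide_le_eq)
  show thesis
  proof (rule that[of "sqrt S * c"])
    fix g :: "'h \<Rightarrow> complex" assume g: "integrable m g"
    define h where "h y = (\<integral>x. g x * kern \<phi> x y \<partial>m)" for y
    note hm = left_reg_bump_measurable(1)[OF \<phi> g, folded h_def]
    have hv: "hval H k x y = complex_of_real (mean \<phi> x y) / complex_of_real c" for x y
      using hval_of_real[of \<phi> x y] by (simp add: hval_def k_def[abs_def] fc_def)
    have lr: "left_reg_L1 H m g k y = h y / complex_of_real c" for y
      by (simp add: left_reg_L1_def left_reg_def hv h_def)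
    obtain B where B: "(\<integral>\<^sup>+y. ennreal ((norm (left_reg_L1 H m g k y))\<^sup>2) \<partial>m) \<le> ennreal B"
      using left_reg_square_bound[OF g] k k1 by metis
    have hk: "integrable m (\<lambda>y. (norm (left_reg_L1 H m g k y))\<^sup>2)"
    proof (rule integrableI_bounded)
      show "(\<lambda>y. (norm (left_reg_L1 H m g k y))\<^sup>2) \<in> borel_measurable m" unfolding lr using hm by measurable
      show "(\<integral>\<^sup>+y. ennreal (norm ((norm (left_reg_L1 H m g k y))\<^sup>2)) \<partial>m) < \<infinity>" using B by (simp add: le_less_trans)
    qed
    have hsq: "(norm (h y))\<^sup>2 = c\<^sup>2 * (norm (left_reg_L1 H m g k y))\<^sup>2" for y
      using c by (simp add: lr norm_divide power_divide)
    have hi: "integrable m (\<lambda>y. (norm (h y))\<^sup>2)" unfolding hsq using hk by simp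
    have L2h: "L2_norm m h = c * L2_norm m (left_reg_L1 H m g k)"
      unfolding L2_norm_def hsq using c by (simp add: real_sqrt_mult)
    have le: "L2_norm m h \<le> c * Cstar_norm H m g"
      unfolding L2h using left_reg_le_Cstar_norm[OF g k k1] c by (intro mult_left_mono) auto
    have "ennreal (norm (\<integral>y. complex_of_real (\<phi> y) * h y \<partial>m)) \<le> (\<integral>\<^sup>+y. ennreal (\<phi> y) * ennreal (norm (h y)) \<partial>m)"
    proof (cases "integrable m (\<lambda>y. complex_of_real (\<phi> y) * h y)")
      case True
      have "ennreal (norm (\<integral>y. complex_of_real (\<phi> y) * h y \<partial>m)) \<le> (\<integral>\<^sup>+y. ennreal (norm (complex_of_real (\<phi> y) * h y)) \<partial>m)"
        by (rule integral_norm_bound_ennreal[OF True])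
      then show ?thesis using bumpD(2)[OF \<phi>] by (simp add: norm_mult ennreal_mult)
    qed (simp add: not_integrable_integral_eq)
    then have "(ennreal (norm (\<integral>y. complex_of_real (\<phi> y) * h y \<partial>m)))\<^sup>2 \<le> (\<integral>\<^sup>+y. ennreal (\<phi> y) * ennreal (norm (h y)) \<partial>m)\<^sup>2"
      by (intro power_mono) auto
    also have "\<dots> \<le> (\<integral>\<^sup>+y. (ennreal (\<phi> y))\<^sup>2 \<partial>m) * (\<integral>\<^sup>+y. (ennreal (norm (h y)))\<^sup>2 \<partial>m)"
      using hm borel_measurable_integrable[OF bump_integrable[OF \<phi>]] by (intro Cauchy_Schwarz_nn_integral) auto
    also have "\<dots> = ennreal S * ennreal ((L2_norm m h)\<^sup>2)"
    proof -
      have "(\<integral>\<^sup>+y. (ennreal (\<phi> y))\<^sup>2 \<partial>m) = ennreal S"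
        unfolding S_def using bumpD(2)[OF \<phi>] by (simp add: ennreal_power nn_integral_eq_integral[OF \<phi>sq])
      moreover have "(\<integral>\<^sup>+y. (ennreal (norm (h y)))\<^sup>2 \<partial>m) = ennreal ((L2_norm m h)\<^sup>2)"
        by (simp add: ennreal_power nn_integral_eq_integral[OF hi] L2_norm_def)
      ultimately show ?thesis by simp
    qed
    finally have "(norm (\<integral>y. complex_of_real (\<phi> y) * h y \<partial>m))\<^sup>2 \<le> S * (L2_norm m h)\<^sup>2"
      using S by (simp add: ennreal_power flip: ennreal_mult)
    also have "\<dots> = (sqrt S * L2_norm m h)\<^sup>2" using S by (simp add: power_mult_distrib)
    finally have "norm (\<integral>y. complex_of_real (\<phi> y) * h y \<partial>m) \<le> sqrt S * L2_norm m h"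
      by (rule power2_le_imp_le) (simp add: L2_norm_def S)
    also have "\<dots> \<le> sqrt S * (c * Cstar_norm H m g)" using le S by (intro mult_left_mono) auto
    finally show "norm (\<integral>x. complex_of_real (corr \<phi> x) * g x \<partial>m) \<le> sqrt S * c * Cstar_norm H m g"
      unfolding corr_pairing[OF \<phi> g] h_def by (simp add: mult.assoc)
  qed
qed

text \<open>The norm of \<open>\<phi> * \<phi>\<^sup>~\<close> as a functional is finite because the pairing with \<open>g\<close> is a matrix coefficient
  of \<open>\<lambda>(g)\<close>.\<close>

lemma corr_in_A_set:
  assumes \<phi>: "\<phi> \<in> bump U"
  shows "(\<lambda>x. complex_of_real (corr \<phi> x)) \<in> A_set H m"
proof -
  let ?L = "fun_space {f. integrable m f} (Cstar_norm H m)"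
  define a where "a = (\<lambda>x. complex_of_real (corr \<phi> x))"
  have ac: "continuous_on UNIV a" unfolding a_def by (intro continuous_on_of_real corr_continuous[OF \<phi>])
  have am: "a \<in> borel_measurable m" using borel_measurable_continuous_onI[OF ac] by (simp add: haar_measurable_iff)
  obtain B where B: "\<And>x. \<bar>corr \<phi> x\<bar> \<le> B" using corr_bounded[OF \<phi>] by blast
  have ai: "integrable m (\<lambda>x. a x * g x)" if g: "integrable m g" for g
  proof (rule Bochner_Integration.integrable_bound)
    show "integrable m (\<lambda>x. complex_of_real B * g x)" using g by simp
    show "(\<lambda>x. a x * g x) \<in> borel_measurable m" using am borel_measurable_integrable[OF g] by measurable
    have "\<bar>corr \<phi> x\<bar> \<le> \<bar>B\<bar>" for x using B[of x] by linarith
    then show "AE x in m. norm (a x * g x) \<le> norm (complex_of_real B * g x)"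
      by (intro AE_I2) (simp add: a_def norm_mult mult_right_mono)
  qed
  have fnl: "functional m a \<in> carrier (B_dual H m)"
    unfolding B_dual_def mem_dual_iff
  proof (intro conjI)
    obtain C where "\<And>g. integrable m g \<Longrightarrow> norm (\<integral>x. a x * g x \<partial>m) \<le> C * Cstar_norm H m g"
      using corr_pairing_bound[OF \<phi>] unfolding a_def by metis
    then show "\<exists>K. \<forall>x\<in>carrier ?L. norm (functional m a x) \<le> K * nrm ?L x"
      by (intro exI[of _ C]) (simp add: fun_space_def functional_def)
    show "\<forall>x\<in>carrier ?L. \<forall>y\<in>carrier ?L.
        functional m a (x \<oplus>\<^bsub>?L\<^esub> y) = functional m a x + functional m a y"
      using ai by (simp add: fun_space_def functional_def distrib_left)
    show "\<forall>c. \<forall>x\<in>carrier ?L.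
        functional m a (c \<odot>\<^bsub>?L\<^esub> x) = c * functional m a x"
      by (simp add: fun_space_def functional_def mult.left_commute[of _ _ "_ :: complex"])
  qed (simp add: fun_space_def functional_def)
  have bd: "bounded (range a)" unfolding bounded_iff using B by (auto simp: a_def)
  have "a \<in> B_lambda H m" using ac bd fnl by (simp add: B_lambda_def)
  moreover have "a \<in> A_span H m"
  proof -
    have "a = (\<lambda>x. \<Sum>i<(1::nat). 1 * hconv H m (\<lambda>x. complex_of_real (\<phi> x)) (htilde H (\<lambda>x. complex_of_real (\<phi> x))) x)"
      by (simp add: a_def hconv_htilde_eq_corr[OF \<phi>])
    then show ?thesis unfolding A_span_def using bump_of_real_Cc[OF \<phi>]
      by (intro CollectI exI[of _ "1::nat"] exI[of _ "\<lambda>_. 1"] exI[of _ "\<lambda>_ x. complex_of_real (\<phi> x)"]) simp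
  qed
  moreover have "B_norm H m (\<lambda>x. a x - a x) = 0"
  proof -
    have L0: "L2_norm m (\<lambda>_. 0) = 0" by (simp add: L2_norm_def)
    have "{L2_norm m (left_reg_L1 H m (\<lambda>_. 0) g) | g. g \<in> L2 m \<and> L2_norm m g \<le> 1} = {0}"
    proof -
      have "left_reg_L1 H m (\<lambda>_. 0) g = (\<lambda>_. 0)" for g by (simp add: left_reg_L1_def fun_eq_iff)
      moreover have "(\<lambda>_. 0) \<in> L2 m" by (simp add: L2_def)
      ultimately show ?thesis using L0 by force
    qed
    then have "Cstar_norm H m (\<lambda>_. 0) = 0" by (simp add: Cstar_norm_def)
    then have "{norm (functional m (\<lambda>x. 0) g) | g. g \<in> carrier ?L \<and>
        nrm ?L g \<le> 1} = {0}"
      by (auto simp: functional_def fun_space_def intro!: exI[of _ "\<lambda>_. 0"])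
    then show ?thesis unfolding B_norm_def B_dual_def dual_space_ops by simp
  qed
  ultimately show ?thesis unfolding A_set_def a_def[symmetric] by (auto intro!: bexI[of _ a])
qed

section \<open>The main theorem\<close>

text \<open>For compact \<open>K\<close> choose \<open>a\<close> in the algebra that is bounded away from \<open>0\<close> on \<open>K\<close>, and let
  \<open>\<phi>(f) = \<integral> (1\<^sub>K / a) f \<partial>m\<close>. Then \<open>\<phi>(a f) = \<integral> 1\<^sub>K f \<partial>m\<close> is a functional of norm at most \<open>1\<close>, whereas
  \<open>\<phi>(a) = m(K)\<close>. A functional \<open>E\<close> on the dual that sends the former to the latter thus bounds \<open>m(K)\<close> by its
  own norm, for all \<open>K\<close>.\<close>

lemma amenable_Lebesgue_Fourier_imp_finite:
  assumes A: "banach_algebra (fourier_algebra H m)"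
    and am: "amenable TYPE(('h \<Rightarrow> complex) \<Rightarrow> complex) (lebesgue_fourier_algebra H m)"
  shows "emeasure m UNIV < \<infinity>"
proof -
  define LA where "LA = lebesgue_fourier_algebra H m"
  have carr: "carrier LA = {f. integrable m f} \<inter> A_set H m" and
    ops: "f \<oplus>\<^bsub>LA\<^esub> f' = (\<lambda>x. f x + f' x)" "f \<otimes>\<^bsub>LA\<^esub> f' = (\<lambda>x. f x * f' x)" "c \<odot>\<^bsub>LA\<^esub> f = (\<lambda>x. c * f x)"
    and nrmLA: "nrm LA f = L1_norm m f + B_norm H m f" for f f' c
    by (simp_all add: LA_def lebesgue_fourier_algebra_def fun_space_def)
  have cA: "cnormed_space (fourier_algebra H m)" using A by (simp add: banach_algebra_def banach_space_def)
  have cLA: "cnormed_space LA" using am by (simp add: LA_def amenable_def banach_algebra_def banach_space_def)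
  have LAmult: "f \<otimes>\<^bsub>LA\<^esub> f' \<in> carrier LA" if "f \<in> carrier LA" "f' \<in> carrier LA" for f f'
    using am that by (auto simp: LA_def amenable_def banach_algebra_def clinear_on_def)
  have L1le: "L1_norm m f \<le> nrm LA f" if "f \<in> carrier LA" for f
    using nrm_nonneg[OF cA, of f] that by (simp add: nrmLA carr fourier_algebra_def fun_space_def)
  obtain E where E: "E \<in> carrier (dual_space (dual_space LA))"
    and unit: "\<And>\<phi> a. \<phi> \<in> carrier (dual_space LA) \<Longrightarrow> a \<in> carrier LA \<Longrightarrow> E (\<lambda>b\<in>carrier LA. \<phi> (a \<otimes>\<^bsub>LA\<^esub> b)) = \<phi> a"
    using amenable_bidual_unit[OF am] unfolding LA_def by blast
  define C where "C = nrm (dual_space (dual_space LA)) E"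
  have C0: "C \<ge> 0" unfolding C_def by (rule dual_norm_nonneg[OF dual_cnormed_space[OF cLA] E])
  define I where "I w = (\<lambda>f\<in>carrier LA. \<integral>x. w x * f x \<partial>m)" for w :: "'h \<Rightarrow> complex"
  have I: "I w \<in> carrier (dual_space LA)" "nrm (dual_space LA) (I w) \<le> B"
    if w: "w \<in> borel_measurable borel" "\<And>x. norm (w x) \<le> B" for w B
  proof -
    have B: "B \<ge> 0" using w(2) norm_ge_zero order_trans by blast
    have int: "integrable m (\<lambda>x. w x * f x)" if "f \<in> carrier LA" for f
    proof (rule Bochner_Integration.integrable_bound)
      have f: "integrable m f" using that by (simp add: carr)
      show "integrable m (\<lambda>x. complex_of_real B * f x)" using f by simp
      show "(\<lambda>x. w x * f x) \<in> borel_measurable m"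
        using borel_measurable_integrable[OF f] w(1) by (intro borel_measurable_times) (simp_all add: haar_measurable_iff)
      show "AE x in m. norm (w x * f x) \<le> norm (complex_of_real B * f x)"
        using w(2) B by (intro AE_I2) (simp add: norm_mult mult_right_mono)
    qed
    have bound: "norm (I w f) \<le> B * nrm LA f" if f: "f \<in> carrier LA" for f
    proof -
      have fi: "integrable m f" using f by (simp add: carr)
      have "norm (I w f) \<le> (\<integral>x. norm (w x * f x) \<partial>m)" using f by (simp add: I_def integral_norm_bound)
      also have "\<dots> \<le> (\<integral>x. B * norm (f x) \<partial>m)"
        using int[OF f] fi w(2) by (intro integral_mono integrable_norm integrable_mult_right) (auto simp: norm_mult mult_right_mono)
      also have "\<dots> = B * L1_norm m f" by (simp add: L1_norm_def)
      also have "\<dots> \<le> B * nrm LA f" using L1le[OF f] B by (intro mult_left_mono)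
      finally show ?thesis .
    qed
    show "nrm (dual_space LA) (I w) \<le> B" by (rule dual_norm_least[OF cLA B bound])
    show "I w \<in> carrier (dual_space LA)"
      unfolding mem_dual_iff
    proof (intro conjI ballI allI)
      show "\<exists>K. \<forall>f\<in>carrier LA. norm (I w f) \<le> K * nrm LA f" using bound by blast
      show "I w \<in> extensional (carrier LA)" by (simp add: I_def)
      fix f assume f: "f \<in> carrier LA"
      show "I w (c \<odot>\<^bsub>LA\<^esub> f) = c * I w f" for c
        using f smult_in_carrier[OF cLA f, of c] by (simp add: I_def ops mult.left_commute[of _ c])
      fix f' assume f': "f' \<in> carrier LA"
      show "I w (f \<oplus>\<^bsub>LA\<^esub> f') = I w f + I w f'"
        using f f' add_in_carrier[OF cLA f f'] int by (simp add: I_def ops distrib_left)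
    qed
  qed
  have bound: "emeasure m K \<le> ennreal C" if K: "compact K" for K
  proof (cases "K = {}")
    case False
    have Kb: "K \<in> sets borel" by (rule borel_closed[OF compact_imp_closed[OF K]])
    have "compact (insert (ident H) K)" using K by simp
    then obtain \<phi> where \<phi>: "\<phi> \<in> bump UNIV" "\<And>x. x \<in> insert (ident H) K \<Longrightarrow> \<phi> x = 1"
      using urysohn_bump[OF locally_compact, of "insert (ident H) K" UNIV] by auto
    define a where "a x = complex_of_real (corr \<phi> x)" for x
    have a: "a \<in> carrier LA"
      unfolding carr a_def[abs_def] using corr_in_A_set[OF \<phi>(1)] corr_integrable[OF \<phi>(1)] by simp
    have pos: "corr \<phi> x > 0" if "x \<in> K" for x
      by (rule corr_pos[OF \<phi>(1)]) (use \<phi>(2) that in auto)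
    obtain z where z: "z \<in> K" "\<forall>x\<in>K. corr \<phi> z \<le> corr \<phi> x"
      using continuous_attains_inf[OF K False continuous_on_subset[OF corr_continuous[OF \<phi>(1)]]] by auto
    define \<delta> where "\<delta> = corr \<phi> z"
    have \<delta>: "\<delta> > 0" "\<And>x. x \<in> K \<Longrightarrow> \<delta> \<le> corr \<phi> x" using pos z by (auto simp: \<delta>_def)
    define w where "w x = indicator K x / a x" for x
    have am': "a \<in> borel_measurable borel"
      unfolding a_def[abs_def] by (intro borel_measurable_continuous_onI continuous_on_of_real corr_continuous[OF \<phi>(1)])
    have wm: "w \<in> borel_measurable borel"
      unfolding w_def[abs_def] using Kb am' by (intro borel_measurable_divide borel_measurable_indicator)
    have wb: "norm (w x) \<le> 1 / \<delta>" for x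
    proof (cases "x \<in> K")
      case True
      then show ?thesis using \<delta>(1) \<delta>(2)[OF True] pos[OF True]
        by (simp add: w_def a_def norm_divide frac_le)
    qed (use \<delta> in \<open>simp add: w_def\<close>)
    have wa: "w x * a x = indicator K x" for x
      using pos[of x] by (cases "x \<in> K") (auto simp: w_def a_def)
    define \<eta> where "\<eta> = I (indicator K)"
    have indm: "(indicator K :: 'h \<Rightarrow> complex) \<in> borel_measurable borel" using Kb by simp
    have \<eta>: "\<eta> \<in> carrier (dual_space LA)" "nrm (dual_space LA) \<eta> \<le> 1"
      unfolding \<eta>_def using I[OF indm, of 1] by (simp_all add: indicator_def)
    have "I w (a \<otimes>\<^bsub>LA\<^esub> b) = \<eta> b" if b: "b \<in> carrier LA" for b
    proof -
      have "I w (a \<otimes>\<^bsub>LA\<^esub> b) = (\<integral>x. w x * (a x * b x) \<partial>m)"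
        using LAmult[OF a b] by (simp add: I_def ops)
      also have "(\<lambda>x. w x * (a x * b x)) = (\<lambda>x. indicator K x * b x)"
        unfolding mult.assoc[symmetric] wa ..
      also have "(\<integral>x. indicator K x * b x \<partial>m) = \<eta> b" using b by (simp add: I_def \<eta>_def)
      finally show ?thesis .
    qed
    then have "(\<lambda>b\<in>carrier LA. I w (a \<otimes>\<^bsub>LA\<^esub> b)) = (\<lambda>b\<in>carrier LA. \<eta> b)" by (rule restrict_ext)
    also have "\<dots> = \<eta>" using \<eta>(1) by (intro extensional_restrict) (simp add: mem_dual_iff)
    finally have "E \<eta> = I w a" using unit[OF I(1)[OF wm wb] a] by simp
    also have "\<dots> = complex_of_real (measure m K)"
    proof -
      have "(indicator K :: 'h \<Rightarrow> complex) = (\<lambda>x. complex_of_real (indicator K x))"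
        by (auto simp: indicator_def)
      moreover have "I w a = (\<integral>x. indicator K x \<partial>m)" using a by (simp add: I_def wa)
      ultimately have "I w a = (\<integral>x. complex_of_real (indicator K x) \<partial>m)" by simp
      also have "\<dots> = complex_of_real (measure m K)" using Kb by (simp add: sets_haar)
      finally show ?thesis .
    qed
    finally have "measure m K = norm (E \<eta>)" by simp
    also have "\<dots> \<le> C * nrm (dual_space LA) \<eta>"
      unfolding C_def by (rule dual_norm_bound[OF dual_cnormed_space[OF cLA] E \<eta>(1)])
    also have "\<dots> \<le> C" using \<eta>(2) C0 by (simp add: mult_left_le)
    finally have "measure m K \<le> C" .
    moreover have "emeasure m K = ennreal (measure m K)"
      using radon_compact_finite[OF radon_haar K] by (intro emeasure_eq_ennreal_measure) simp
    ultimately show ?thesis by (simp add: ennreal_leI)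
  qed simp
  have "emeasure m UNIV = (SUP K\<in>{K. compact K \<and> K \<subseteq> UNIV}. emeasure m K)"
    using radon_haar unfolding radon_def by (elim conjE) (drule spec[of _ UNIV], simp)
  also have "\<dots> \<le> ennreal C" using bound by (intro SUP_least) simp
  finally show ?thesis by (simp add: le_less_trans)
qed

end

text \<open>The two algebras have the same elements, and the norm of the Lebesgue-Fourier algebra is the larger
  one. So bimodules and bounded derivations for the Fourier algebra are also bimodules and bounded
  derivations for the Lebesgue-Fourier algebra, with the same meaning of inner.\<close>

lemma amenable_from_Lebesgue_Fourier:
  fixes H :: "'h::t2_space hypergroup_data" and m :: "'h measure"
  assumes A: "banach_algebra (fourier_algebra H m)"
    and sub: "A_set H m \<subseteq> {f. integrable m f}"
    and am: "amenable TYPE('x) (lebesgue_fourier_algebra H m)"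
  shows "amenable TYPE('x) (fourier_algebra H m)"
proof -
  let ?A = "fourier_algebra H m" and ?L = "lebesgue_fourier_algebra H m"
  have car: "carrier ?L = carrier ?A"
    using sub by (auto simp: lebesgue_fourier_algebra_def fourier_algebra_def fun_space_def)
  have ops: "f \<oplus>\<^bsub>?L\<^esub> f' = f \<oplus>\<^bsub>?A\<^esub> f'" "f \<otimes>\<^bsub>?L\<^esub> f' = f \<otimes>\<^bsub>?A\<^esub> f'" "c \<odot>\<^bsub>?L\<^esub> f = c \<odot>\<^bsub>?A\<^esub> f" for f f' c
    by (simp_all add: lebesgue_fourier_algebra_def fourier_algebra_def fun_space_def)
  have cA: "cnormed_space ?A" using A by (simp add: banach_algebra_def banach_space_def)
  have le: "nrm ?A f \<le> nrm ?L f" for f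
    by (simp add: lebesgue_fourier_algebra_def fourier_algebra_def fun_space_def L1_norm_def)
  have bound: "\<exists>K. \<forall>a\<in>carrier ?L. P a (K * nrm ?L a)"
    if ex: "\<exists>K. \<forall>a\<in>carrier ?A. P a (K * nrm ?A a)" and mono: "\<And>a r s. P a r \<Longrightarrow> r \<le> s \<Longrightarrow> P a s"
    for P :: "('h \<Rightarrow> complex) \<Rightarrow> real \<Rightarrow> bool"
  proof -
    obtain K where K: "\<And>a. a \<in> carrier ?A \<Longrightarrow> P a (K * nrm ?A a)" using ex by blast
    have "P a (\<bar>K\<bar> * nrm ?L a)" if a: "a \<in> carrier ?L" for a
    proof (rule mono[OF K])
      show "a \<in> carrier ?A" using a car by simp
      then have "K * nrm ?A a \<le> \<bar>K\<bar> * nrm ?A a" using nrm_nonneg[OF cA] by (intro mult_right_mono) auto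
      also have "\<dots> \<le> \<bar>K\<bar> * nrm ?L a" by (intro mult_left_mono le) simp
      finally show "K * nrm ?A a \<le> \<bar>K\<bar> * nrm ?L a" .
    qed
    then show ?thesis by blast
  qed
  have lin: "clinear_on ?L W T = clinear_on ?A W T" for W :: "'w cnspace" and T
    by (simp add: clinear_on_def car ops)
  show ?thesis
    unfolding amenable_def
  proof (intro conjI A allI impI)
    fix X :: "'x cnspace" and L R D
    assume X: "banach_bimodule ?A X L R"
      and D: "bounded_derivation ?A (dual_space X) (dual_lact X R) (dual_ract X L) D"
    have cX: "cnormed_space X" using X by (simp add: banach_bimodule_def banach_space_def)
    have "banach_bimodule ?L X L R"
    proof -
      have "\<exists>K. \<forall>a\<in>carrier ?L. \<forall>x\<in>carrier X. nrm X (L a x) \<le> K * nrm ?L a * nrm X x \<and> nrm X (R x a) \<le> K * nrm ?L a * nrm X x"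
      proof (rule bound[where P = "\<lambda>a r. \<forall>x\<in>carrier X. nrm X (L a x) \<le> r * nrm X x \<and> nrm X (R x a) \<le> r * nrm X x"])
        show "\<exists>K. \<forall>a\<in>carrier ?A. \<forall>x\<in>carrier X. nrm X (L a x) \<le> K * nrm ?A a * nrm X x \<and> nrm X (R x a) \<le> K * nrm ?A a * nrm X x"
          using X unfolding banach_bimodule_def by (elim conjE)
        fix a and r s :: real
        assume h: "\<forall>x\<in>carrier X. nrm X (L a x) \<le> r * nrm X x \<and> nrm X (R x a) \<le> r * nrm X x" and rs: "r \<le> s"
        have "r * nrm X x \<le> s * nrm X x" if "x \<in> carrier X" for x
          using nrm_nonneg[OF cX that] rs by (rule mult_right_mono[rotated])
        then show "\<forall>x\<in>carrier X. nrm X (L a x) \<le> s * nrm X x \<and> nrm X (R x a) \<le> s * nrm X x"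
          using h order_trans by blast
      qed
      then show ?thesis
        using X unfolding banach_bimodule_def lin ops unfolding car by (elim conjE) (intro conjI)
    qed
    moreover have "bounded_derivation ?L (dual_space X) (dual_lact X R) (dual_ract X L) D"
    proof -
      have "\<exists>K. \<forall>a\<in>carrier ?L. nrm (dual_space X) (D a) \<le> K * nrm ?L a"
      proof (rule bound[where P = "\<lambda>a r. nrm (dual_space X) (D a) \<le> r"])
        show "\<exists>K. \<forall>a\<in>carrier ?A. nrm (dual_space X) (D a) \<le> K * nrm ?A a"
          using D unfolding bounded_derivation_def by (elim conjE)
      qed simp
      then show ?thesis
        using D unfolding bounded_derivation_def lin ops unfolding car by (elim conjE) (intro conjI)
    qed
    ultimately have "inner_derivation ?L (dual_space X) (dual_lact X R) (dual_ract X L) D"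
      using am unfolding amenable_def by blast
    then show "inner_derivation ?A (dual_space X) (dual_lact X R) (dual_ract X L) D"
      unfolding inner_derivation_def car .
  qed
qed

theorem corollary3p5:
  fixes H :: "'h::t2_space hypergroup_data" and m :: "'h measure"
  assumes regular: "regular_fourier_hypergroup H m"
    and amenable_dual: "amenable TYPE(('h \<Rightarrow> complex) \<Rightarrow> complex) (lebesgue_fourier_algebra H m)"
    and amenable: "amenable TYPE('x) (lebesgue_fourier_algebra H m)"
  shows "compact (UNIV :: 'h set) \<and> amenable TYPE('x) (fourier_algebra H m)"
proof
  interpret hypergroup H using regular by (simp add: regular_fourier_hypergroup_def)
  interpret haar_hypergroup H m
    using regular by unfold_locales (simp add: regular_fourier_hypergroup_def)
  have A: "banach_algebra (fourier_algebra H m)" using regular by (simp add: regular_fourier_hypergroup_def)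
  have fin: "emeasure m UNIV < \<infinity>" by (rule amenable_Lebesgue_Fourier_imp_finite[OF A amenable_dual])
  show "compact (UNIV :: 'h set)" by (rule finite_haar_imp_compact[OF fin])
  interpret finite_measure m by (rule finite_measureI) (use fin in simp)
  have "integrable m f" if f: "f \<in> A_set H m" for f
  proof -
    have f': "continuous_on UNIV f" "bounded (range f)" using f by (auto simp: A_set_def B_lambda_def)
    obtain B where "\<And>x. norm (f x) \<le> B" using f'(2) unfolding bounded_iff by auto
    then show ?thesis
      using borel_measurable_continuous_onI[OF f'(1)] by (intro integrable_const_bound[of _ B]) (auto simp: haar_measurable_iff)
  qed
  then show "amenable TYPE('x) (fourier_algebra H m)"
    by (intro amenable_from_Lebesgue_Fourier[OF A _ amenable]) auto
qed

end
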